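(* Let $\mathbb{F}$ be a field, $G$ a finite group and $1\le m\le n$. The assignment $$g\mapsto g,\quad s_k\mapsto (k,k+1),\quad x_l\mapsto\sum_{i=l+1}^n t_{li}\,(l,i)\qquad (g\in G^m,\ 1\le k\le m-1,\ 1\le l\le m)$$ defines an algebra homomorphism $\Psi:\mathcal{H}_m(G)\to\mathcal{Z}_{m,n}$. Moreover $\Psi\circ\overline{\Phi}=\Phi\circ\overline{\Psi}$ as maps $\overline{\mathcal{H}}_m(G)\to\mathcal{Z}_{m,n}$. Hence the algebra $\mathcal{Z}_{m,n}$ is generated by the center of the subalgebra $\mathbb{F}G'_{n-m}$ and the image of $\Psi$.
   Context: For $n\ge 1$, $\overline{G}_n$ is the semigroup of $n\times n$ matrices with entries in $G\cup\{0\}$ having at most one nonzero entry in each row and column, under matrix multiplication with $g0=0g=0$, $g+0=0+g=g$ (0 an extra symbol); $\overline{G}_0=\{1\}$; $G_n\subseteq\overline{G}_n$ is the subgroup of matrices with exactly one nonzero entry in each row and column (the wreath product of $G$ with $S_n$). $\mathbb{F}\overline{G}_n$ is the semigroup algebra with basis $\overline{G}_n$ (the zero matrix is one of the basis elements). A permutation $\sigma\in S_n$ is identified with the matrix having $1$ in position $(i,j)$ iff $\sigma(j)=i$, and $g=(g_1,\dots,g_n)\in G^n$ with the diagonal matrix with entries $g_i$; $s_i=(i,i+1)$; ${}^{w}g=(g_{w^{-1}(1)},\ldots,g_{w^{-1}(n)})$; $h^{(i)}\in G^n$ has $h$ in position $i$ and $1$ elsewhere; $\varepsilon_i$ is the diagonal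 matrix with $(i,i)$ entry $0$ and other diagonal entries $1$; $t_{kl}=\sum_{h\in G}h^{(k)}(h^{-1})^{(l)}$. For $m\le n$, $\overline{G}_m$ is embedded in $\overline{G}_n$ by $\gamma\mapsto \mathrm{diag}(\gamma,1,\dots,1)$. $\overline{G}'_{n-m}\subseteq\overline{G}_n$ is the subsemigroup of matrices whose first $m$ diagonal entries equal $1$, and $G'_{n-m}=G_n\cap\overline{G}'_{n-m}$. $\overline{\mathcal{Z}}_{m,n}$ is the centralizer of $\overline{G}'_{n-m}$ in $\mathbb{F}\overline{G}_n$ and $\mathcal{Z}_{m,n}$ is the centralizer of $G'_{n-m}$ in $\mathbb{F}G_n$. $\mathcal{H}_m(G)$ (wreath Hecke algebra) is the algebra generated by $g\in G^m$, $s_1,\ldots,s_{m-1}$, $x_1,\ldots,x_m$ subject to the multiplication relations of $G^m$, $s_i^2=1$, $s_is_j=s_js_i$ ($|i-j|>1$), $s_is_{i+1}s_i=s_{i+1}s_is_{i+1}$, $s_ig={}^{s_i}g\,s_i$, $gx_k=x_kg$, $s_kx_k=x_{k+1}s_k+t_{k,k+1}$, $s_kx_l=x_ls_k$ ($l\ne k,k+1$), $x_kx_l=x_lx_k$. For $\gamma\in\overline{G}_n$, $\deg(\gamma)=|\{k:\gamma_{kk}\ne 1\}|$, extended to linear combinations as the maximum over elements with nonzero coefficient. $\theta_n:\mathbb{F}\overline{G}_n\to\mathbb{F}\overline{G}_{n-1}$ is the linear map sending $\gamma\in\overline{G}_n$ to its upper left corner of order $n-1$. $\overline{\mathcal{Z}}_m$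 is the algebra of sequences $(\alpha_n)_{n\ge m}$ with $\alpha_n\in\overline{\mathcal{Z}}_{m,n}$, $\theta_n(\alpha_n)=\alpha_{n-1}$ for $n>m$, $\sup_n\deg(\alpha_n)<\infty$, with componentwise operations; $\mathbb{F}\overline{G}_m$ embeds in it as constant sequences. Put $u_{k|n}=\sum_{i=k+1}^n t_{ki}(k,i)(1-\varepsilon_k)(1-\varepsilon_i)\in\overline{\mathcal{Z}}_{m,n}$ and $u_k=(u_{k|n})_{n\ge m}\in\overline{\mathcal{Z}}_m$ for $1\le k\le m$; $\overline{\mathcal{H}}_m(G)$ is the subalgebra of $\overline{\mathcal{Z}}_m$ generated by $\mathbb{F}\overline{G}_m$ and $u_1,\dots,u_m$. The maps are: $\overline{\Psi}:\overline{\mathcal{H}}_m(G)\to\overline{\mathcal{Z}}_{m,n}$, the algebra homomorphism with $g\mapsto g$, $s_l\mapsto s_l$, $\varepsilon_k\mapsto\varepsilon_k$, $u_k\mapsto u_{k|n}$; $\overline{\Phi}:\overline{\mathcal{H}}_m(G)\to\mathcal{H}_m(G)$, the algebra epimorphism with $g\mapsto g$, $s_k\mapsto s_k$, $u_l\mapsto x_l$, $\varepsilon_l\mapsto 0$; and $\Phi:\overline{\mathcal{Z}}_{m,n}\to\mathcal{Z}_{m,n}$, the restriction of the algebra homomorphism $\mathbb{F}\overline{G}_n\to\mathbb{F}G_n$ that is the identity on $G_n$ and sends each $\varepsilon_j$ to $0$. *)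

theory Defs
  imports "HOL-Algebra.Module" "HOL-Algebra.QuotRing" "HOL-Algebra.Product_Groups"
    "HOL-Combinatorics.Transposition"
begin

section \<open>Algebras over a field\<close>

text \<open>
  An associative unital algebra over a field \<open>'f\<close> is represented by a \<open>module\<close> record of
  HOL-Algebra, the scalars being all elements of the type \<open>'f\<close>.
\<close>

definition alg_hom ::
  "('f, 'a, 'c) module_scheme \<Rightarrow> ('f, 'b, 'd) module_scheme \<Rightarrow> ('a \<Rightarrow> 'b) set" where
  "alg_hom A B =
     {\<phi> \<in> ring_hom A B. \<forall>c. \<forall>a \<in> carrier A. \<phi> (c \<odot>\<^bsub>A\<^esub> a) = c \<odot>\<^bsub>B\<^esub> \<phi> a}"

text \<open>Over a field, closure under negation and containment of zero follow from closure under
  scalar multiples.\<close>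

definition subalg :: "('f, 'a, 'c) module_scheme \<Rightarrow> 'a set \<Rightarrow> bool" where
  "subalg A B \<longleftrightarrow>
     B \<subseteq> carrier A \<and> \<one>\<^bsub>A\<^esub> \<in> B \<and>
     (\<forall>a \<in> B. \<forall>b \<in> B. a \<oplus>\<^bsub>A\<^esub> b \<in> B \<and> a \<otimes>\<^bsub>A\<^esub> b \<in> B) \<and>
     (\<forall>c. \<forall>a \<in> B. c \<odot>\<^bsub>A\<^esub> a \<in> B)"

definition gen_alg :: "('f, 'a, 'c) module_scheme \<Rightarrow> 'a set \<Rightarrow> 'a set" where
  "gen_alg A X = \<Inter>{B. subalg A B \<and> X \<subseteq> B}"

definition centralizer_in :: "('a, 'c) monoid_scheme \<Rightarrow> 'a set \<Rightarrow> 'a set" where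
  "centralizer_in A X = {a \<in> carrier A. \<forall>x \<in> X. a \<otimes>\<^bsub>A\<^esub> x = x \<otimes>\<^bsub>A\<^esub> a}"

definition center_of :: "('a, 'c) monoid_scheme \<Rightarrow> 'a set" where
  "center_of A = centralizer_in A (carrier A)"

text \<open>The scalar multiplication on a quotient by an ideal, which \<open>Quot\<close> does not provide.\<close>

definition quot_alg :: "('f, 'a, 'c) module_scheme \<Rightarrow> 'a set \<Rightarrow> ('f, 'a set) module" where
  "quot_alg A I =
     \<lparr>carrier = carrier (A Quot I), monoid.mult = monoid.mult (A Quot I),
      one = \<one>\<^bsub>A Quot I\<^esub>, zero = \<zero>\<^bsub>A Quot I\<^esub>, add = add (A Quot I),
      smult = (\<lambda>c X. \<Union>a \<in> X. I +>\<^bsub>A\<^esub> (c \<odot>\<^bsub>A\<^esub> a))\<rparr>"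

text \<open>
  The semigroup algebra of a monoid \<open>S\<close>: finitely supported functions on \<open>carrier S\<close>
  (extended by 0) with convolution. The operations do not depend on \<open>carrier S\<close>, so the algebra
  of a submonoid is literally a subset of the algebra of the monoid.
\<close>

definition sg_alg :: "('a, 'c) monoid_scheme \<Rightarrow> ('f::field, 'a \<Rightarrow> 'f) module" where
  "sg_alg S =
     \<lparr>carrier = {a. finite {x. a x \<noteq> 0} \<and> {x. a x \<noteq> 0} \<subseteq> carrier S},
      monoid.mult = (\<lambda>a b z. \<Sum>x | a x \<noteq> 0. \<Sum>y | b y \<noteq> 0.
                        if x \<otimes>\<^bsub>S\<^esub> y = z then a x * b y else 0),
      one = (\<lambda>z. if z = \<one>\<^bsub>S\<^esub> then 1 else 0),
      zero = (\<lambda>z. 0),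
      add = (\<lambda>a b z. a z + b z),
      smult = (\<lambda>c a z. c * a z)\<rparr>"

definition basis :: "'a \<Rightarrow> 'a \<Rightarrow> 'f::field" where
  "basis x = (\<lambda>z. if z = x then 1 else 0)"

definition lin_ext :: "('a \<Rightarrow> 'b) \<Rightarrow> ('a \<Rightarrow> 'f::field) \<Rightarrow> 'b \<Rightarrow> 'f" where
  "lin_ext f a = (\<lambda>z. \<Sum>x | a x \<noteq> 0 \<and> f x = z. a x)"


section \<open>Monomial and submonomial matrices over a group\<close>

text \<open>
  An entry in \<open>G \<union> {0}\<close> is \<open>None\<close> (the symbol 0) or \<open>Some g\<close>. Rows and columns are numbered
  from 1; all entries outside \<open>{1..n} \<times> {1..n}\<close> are \<open>None\<close>.
\<close>

type_synonym 'g zmat = "nat \<Rightarrow> nat \<Rightarrow> 'g option"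

fun zmul :: "('g, 'c) monoid_scheme \<Rightarrow> 'g option \<Rightarrow> 'g option \<Rightarrow> 'g option" where
  "zmul G (Some g) (Some h) = Some (g \<otimes>\<^bsub>G\<^esub> h)"
| "zmul G None y = None"
| "zmul G (Some g) None = None"

text \<open>A sum of two elements of \<open>G\<close> never occurs in a product of submonomial matrices.\<close>

fun zadd :: "'g option \<Rightarrow> 'g option \<Rightarrow> 'g option" where
  "zadd None y = y"
| "zadd (Some g) None = Some g"
| "zadd (Some g) (Some h) = undefined"

definition mat_mul :: "('g, 'c) monoid_scheme \<Rightarrow> nat \<Rightarrow> 'g zmat \<Rightarrow> 'g zmat \<Rightarrow> 'g zmat" where
  "mat_mul G n A B =
     (\<lambda>i j. foldr zadd (map (\<lambda>k. zmul G (A i k) (B k j)) [1..<Suc n]) None)"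

definition diag :: "nat \<Rightarrow> (nat \<Rightarrow> 'g option) \<Rightarrow> 'g zmat" where
  "diag n d = (\<lambda>i j. if i = j \<and> i \<in> {1..n} then d i else None)"

definition Gbar :: "('g, 'c) monoid_scheme \<Rightarrow> nat \<Rightarrow> 'g zmat monoid" where
  "Gbar G n =
     \<lparr>carrier = {A. (\<forall>i j. A i j \<noteq> None \<longrightarrow> i \<in> {1..n} \<and> j \<in> {1..n}) \<and>
                    (\<forall>i j. A i j \<in> insert None (Some ` carrier G)) \<and>
                    (\<forall>i j j'. A i j \<noteq> None \<and> A i j' \<noteq> None \<longrightarrow> j = j') \<and>
                    (\<forall>i i' j. A i j \<noteq> None \<and> A i' j \<noteq> None \<longrightarrow> i = i')},
      monoid.mult = mat_mul G n,
      one = diag n (\<lambda>i. Some \<one>\<^bsub>G\<^esub>)\<rparr>"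

definition Gwr :: "('g, 'c) monoid_scheme \<Rightarrow> nat \<Rightarrow> 'g zmat monoid" where
  "Gwr G n = (Gbar G n)\<lparr>carrier :=
     {A \<in> carrier (Gbar G n). (\<forall>i \<in> {1..n}. \<exists>!j. A i j \<noteq> None) \<and>
                              (\<forall>j \<in> {1..n}. \<exists>!i. A i j \<noteq> None)}\<rparr>"

text \<open>\<open>Gbar_tail G m n\<close> and \<open>Gwr_tail G m n\<close> are the copies of the matrices of order \<open>n - m\<close>
  acting on the last \<open>n - m\<close> coordinates.\<close>

definition Gbar_tail :: "('g, 'c) monoid_scheme \<Rightarrow> nat \<Rightarrow> nat \<Rightarrow> 'g zmat monoid" where
  "Gbar_tail G m n = (Gbar G n)\<lparr>carrier :=
     {A \<in> carrier (Gbar G n). \<forall>i \<in> {1..m}. A i i = Some \<one>\<^bsub>G\<^esub>}\<rparr>"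

definition Gwr_tail :: "('g, 'c) monoid_scheme \<Rightarrow> nat \<Rightarrow> nat \<Rightarrow> 'g zmat monoid" where
  "Gwr_tail G m n = (Gbar G n)\<lparr>carrier := carrier (Gwr G n) \<inter> carrier (Gbar_tail G m n)\<rparr>"

definition perm_mat :: "('g, 'c) monoid_scheme \<Rightarrow> nat \<Rightarrow> (nat \<Rightarrow> nat) \<Rightarrow> 'g zmat" where
  "perm_mat G n \<sigma> =
     (\<lambda>i j. if i \<in> {1..n} \<and> j \<in> {1..n} \<and> \<sigma> j = i then Some \<one>\<^bsub>G\<^esub> else None)"

abbreviation transp_mat :: "('g, 'c) monoid_scheme \<Rightarrow> nat \<Rightarrow> nat \<Rightarrow> nat \<Rightarrow> 'g zmat" where
  "transp_mat G n k i \<equiv> perm_mat G n (transpose k i)"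

abbreviation Gpow :: "('g, 'c) monoid_scheme \<Rightarrow> nat \<Rightarrow> (nat \<Rightarrow> 'g) monoid" where
  "Gpow G n \<equiv> product_group {1..n} (\<lambda>_. G)"

abbreviation tuple_mat :: "nat \<Rightarrow> (nat \<Rightarrow> 'g) \<Rightarrow> 'g zmat" where
  "tuple_mat n g \<equiv> diag n (\<lambda>i. Some (g i))"

definition eps_mat :: "('g, 'c) monoid_scheme \<Rightarrow> nat \<Rightarrow> nat \<Rightarrow> 'g zmat" where
  "eps_mat G n k = diag n (\<lambda>i. if i = k then None else Some \<one>\<^bsub>G\<^esub>)"

definition single :: "('g, 'c) monoid_scheme \<Rightarrow> nat \<Rightarrow> nat \<Rightarrow> 'g \<Rightarrow> nat \<Rightarrow> 'g" where
  "single G n k h = (\<lambda>i \<in> {1..n}. if i = k then h else \<one>\<^bsub>G\<^esub>)"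

definition tuple_act :: "nat \<Rightarrow> (nat \<Rightarrow> nat) \<Rightarrow> (nat \<Rightarrow> 'g) \<Rightarrow> nat \<Rightarrow> 'g" where
  "tuple_act n w g = (\<lambda>i \<in> {1..n}. g (inv_into UNIV w i))"

text \<open>
  The elements \<open>t\<^sub>k\<^sub>l\<close> are needed in several algebras \<open>A\<close>; \<open>e\<close> is the map from \<open>G\<^sup>n\<close> to \<open>A\<close>.
\<close>

definition t_elem ::
  "('g, 'c) monoid_scheme \<Rightarrow> nat \<Rightarrow> ('a, 'd) ring_scheme \<Rightarrow> ((nat \<Rightarrow> 'g) \<Rightarrow> 'a) \<Rightarrow>
   nat \<Rightarrow> nat \<Rightarrow> 'a" where
  "t_elem G n A e k l =
     (\<Oplus>\<^bsub>A\<^esub> h \<in> carrier G. e (single G n k h) \<otimes>\<^bsub>A\<^esub> e (single G n l (inv\<^bsub>G\<^esub> h)))"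

definition embed_mat :: "('g, 'c) monoid_scheme \<Rightarrow> nat \<Rightarrow> nat \<Rightarrow> 'g zmat \<Rightarrow> 'g zmat" where
  "embed_mat G m n A =
     (\<lambda>i j. if i \<in> {1..m} \<and> j \<in> {1..m} then A i j
            else if i = j \<and> i \<in> {m+1..n} then Some \<one>\<^bsub>G\<^esub> else None)"

definition corner :: "nat \<Rightarrow> 'g zmat \<Rightarrow> 'g zmat" where
  "corner k A = (\<lambda>i j. if i \<in> {1..k} \<and> j \<in> {1..k} then A i j else None)"

definition mat_deg :: "('g, 'c) monoid_scheme \<Rightarrow> nat \<Rightarrow> 'g zmat \<Rightarrow> nat" where
  "mat_deg G n A = card {k \<in> {1..n}. A k k \<noteq> Some \<one>\<^bsub>G\<^esub>}"


section \<open>Semigroup algebras and centralizers\<close>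

abbreviation FGbar :: "('g, 'c) monoid_scheme \<Rightarrow> nat \<Rightarrow> ('f::field, 'g zmat \<Rightarrow> 'f) module" where
  "FGbar G n \<equiv> sg_alg (Gbar G n)"

abbreviation FGwr :: "('g, 'c) monoid_scheme \<Rightarrow> nat \<Rightarrow> ('f::field, 'g zmat \<Rightarrow> 'f) module" where
  "FGwr G n \<equiv> sg_alg (Gwr G n)"

definition Zbar ::
  "('g, 'c) monoid_scheme \<Rightarrow> nat \<Rightarrow> nat \<Rightarrow> ('f::field, 'g zmat \<Rightarrow> 'f) module" where
  "Zbar G m n = (FGbar G n)\<lparr>carrier :=
     centralizer_in (FGbar G n) (basis ` carrier (Gbar_tail G m n))\<rparr>"

definition Zwr ::
  "('g, 'c) monoid_scheme \<Rightarrow> nat \<Rightarrow> nat \<Rightarrow> ('f::field, 'g zmat \<Rightarrow> 'f) module" where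
  "Zwr G m n = (FGwr G n)\<lparr>carrier :=
     centralizer_in (FGwr G n) (basis ` carrier (Gwr_tail G m n))\<rparr>"

text \<open>\<open>theta n\<close> maps the algebra of order \<open>n\<close> to that of order \<open>n - 1\<close>. The zero
  element is given degree 0, which does not affect boundedness of degrees.\<close>

definition theta :: "nat \<Rightarrow> ('g zmat \<Rightarrow> 'f::field) \<Rightarrow> 'g zmat \<Rightarrow> 'f" where
  "theta n = lin_ext (corner (n - 1))"

definition elem_deg :: "('g, 'c) monoid_scheme \<Rightarrow> nat \<Rightarrow> ('g zmat \<Rightarrow> 'f::field) \<Rightarrow> nat" where
  "elem_deg G n a = Max (insert 0 (mat_deg G n ` {A. a A \<noteq> 0}))"

text \<open>A sequence indexed by \<open>n \<ge> m\<close> is an extensional function on \<open>{m..}\<close>.\<close>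

definition Zseq ::
  "('g, 'c) monoid_scheme \<Rightarrow> nat \<Rightarrow> ('f::field, nat \<Rightarrow> 'g zmat \<Rightarrow> 'f) module" where
  "Zseq G m =
     \<lparr>carrier = {\<alpha> \<in> \<Pi>\<^sub>E n \<in> {m..}. carrier (Zbar G m n).
                   (\<forall>n > m. theta n (\<alpha> n) = \<alpha> (n - 1)) \<and>
                   bdd_above ((\<lambda>n. elem_deg G n (\<alpha> n)) ` {m..})},
      monoid.mult = (\<lambda>\<alpha> \<beta>. \<lambda>n \<in> {m..}. \<alpha> n \<otimes>\<^bsub>Zbar G m n\<^esub> \<beta> n),
      one = (\<lambda>n \<in> {m..}. \<one>\<^bsub>Zbar G m n :: ('f, _) module\<^esub>),
      zero = (\<lambda>n \<in> {m..}. \<zero>\<^bsub>Zbar G m n :: ('f, _) module\<^esub>),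
      add = (\<lambda>\<alpha> \<beta>. \<lambda>n \<in> {m..}. \<alpha> n \<oplus>\<^bsub>Zbar G m n\<^esub> \<beta> n),
      smult = (\<lambda>c \<alpha>. \<lambda>n \<in> {m..}. c \<odot>\<^bsub>Zbar G m n\<^esub> \<alpha> n)\<rparr>"

definition const_seq ::
  "('g, 'c) monoid_scheme \<Rightarrow> nat \<Rightarrow> ('g zmat \<Rightarrow> 'f::field) \<Rightarrow> nat \<Rightarrow> 'g zmat \<Rightarrow> 'f" where
  "const_seq G m a = (\<lambda>n \<in> {m..}. lin_ext (embed_mat G m n) a)"

definition u_at :: "('g, 'c) monoid_scheme \<Rightarrow> nat \<Rightarrow> nat \<Rightarrow> 'g zmat \<Rightarrow> 'f::field" where
  "u_at G k n =
     (let A = FGbar G n; \<epsilon> = (\<lambda>i. basis (eps_mat G n i)) in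
      \<Oplus>\<^bsub>A\<^esub> i \<in> {k+1..n}.
        t_elem G n A (\<lambda>g. basis (tuple_mat n g)) k i \<otimes>\<^bsub>A\<^esub> basis (transp_mat G n k i)
          \<otimes>\<^bsub>A\<^esub> (\<one>\<^bsub>A\<^esub> \<ominus>\<^bsub>A\<^esub> \<epsilon> k) \<otimes>\<^bsub>A\<^esub> (\<one>\<^bsub>A\<^esub> \<ominus>\<^bsub>A\<^esub> \<epsilon> i))"

definition u_seq :: "('g, 'c) monoid_scheme \<Rightarrow> nat \<Rightarrow> nat \<Rightarrow> nat \<Rightarrow> 'g zmat \<Rightarrow> 'f::field" where
  "u_seq G m k = (\<lambda>n \<in> {m..}. u_at G k n)"

definition Hbar ::
  "('g, 'c) monoid_scheme \<Rightarrow> nat \<Rightarrow> ('f::field, nat \<Rightarrow> 'g zmat \<Rightarrow> 'f) module" where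
  "Hbar G m = (Zseq G m)\<lparr>carrier :=
     gen_alg (Zseq G m) (const_seq G m ` carrier (FGbar G m) \<union> u_seq G m ` {1..m})\<rparr>"


section \<open>The wreath Hecke algebra\<close>

text \<open>The free algebra on a set is the semigroup algebra of the monoid of words; the wreath Hecke
  algebra is its quotient by the two-sided ideal generated by the relations.\<close>

datatype 'g hgen = GenG "nat \<Rightarrow> 'g" | GenS nat | GenX nat

definition free_monoid :: "'a set \<Rightarrow> 'a list monoid" where
  "free_monoid X = \<lparr>carrier = lists X, monoid.mult = (@), one = []\<rparr>"

definition hecke_free ::
  "('g, 'c) monoid_scheme \<Rightarrow> nat \<Rightarrow> ('f::field, 'g hgen list \<Rightarrow> 'f) module" where
  "hecke_free G m = sg_alg (free_monoid
     (GenG ` carrier (Gpow G m) \<union> GenS ` {1..<m} \<union> GenX ` {1..m}))"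

abbreviation gG :: "(nat \<Rightarrow> 'g) \<Rightarrow> 'g hgen list \<Rightarrow> 'f::field" where
  "gG g \<equiv> basis [GenG g]"

abbreviation gS :: "nat \<Rightarrow> 'g hgen list \<Rightarrow> 'f::field" where
  "gS i \<equiv> basis [GenS i]"

abbreviation gX :: "nat \<Rightarrow> 'g hgen list \<Rightarrow> 'f::field" where
  "gX k \<equiv> basis [GenX k]"

text \<open>A pair \<open>(a, b)\<close> stands for the relation \<open>a = b\<close>.\<close>

inductive_set hecke_rels ::
  "('g, 'c) monoid_scheme \<Rightarrow> nat \<Rightarrow> (('g hgen list \<Rightarrow> 'f::field) \<times> ('g hgen list \<Rightarrow> 'f)) set"
  for G :: "('g, 'c) monoid_scheme" and m :: nat where
  G_one: "(gG \<one>\<^bsub>Gpow G m\<^esub>, \<one>\<^bsub>hecke_free G m\<^esub>) \<in> hecke_rels G m"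
| G_mult: "g \<in> carrier (Gpow G m) \<Longrightarrow> h \<in> carrier (Gpow G m) \<Longrightarrow>
    (gG g \<otimes>\<^bsub>hecke_free G m\<^esub> gG h, gG (g \<otimes>\<^bsub>Gpow G m\<^esub> h)) \<in> hecke_rels G m"
| S_square: "i \<in> {1..<m} \<Longrightarrow>
    (gS i \<otimes>\<^bsub>hecke_free G m\<^esub> gS i, \<one>\<^bsub>hecke_free G m\<^esub>) \<in> hecke_rels G m"
| S_far: "i \<in> {1..<m} \<Longrightarrow> j \<in> {1..<m} \<Longrightarrow> i + 1 < j \<or> j + 1 < i \<Longrightarrow>
    (gS i \<otimes>\<^bsub>hecke_free G m\<^esub> gS j, gS j \<otimes>\<^bsub>hecke_free G m\<^esub> gS i) \<in> hecke_rels G m"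
| S_braid: "i \<in> {1..<m} \<Longrightarrow> i + 1 \<in> {1..<m} \<Longrightarrow>
    (gS i \<otimes>\<^bsub>hecke_free G m\<^esub> gS (i+1) \<otimes>\<^bsub>hecke_free G m\<^esub> gS i,
     gS (i+1) \<otimes>\<^bsub>hecke_free G m\<^esub> gS i \<otimes>\<^bsub>hecke_free G m\<^esub> gS (i+1)) \<in> hecke_rels G m"
| S_G: "i \<in> {1..<m} \<Longrightarrow> g \<in> carrier (Gpow G m) \<Longrightarrow>
    (gS i \<otimes>\<^bsub>hecke_free G m\<^esub> gG g,
     gG (tuple_act m (transpose i (i+1)) g) \<otimes>\<^bsub>hecke_free G m\<^esub> gS i) \<in> hecke_rels G m"
| G_X: "g \<in> carrier (Gpow G m) \<Longrightarrow> k \<in> {1..m} \<Longrightarrow>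
    (gG g \<otimes>\<^bsub>hecke_free G m\<^esub> gX k, gX k \<otimes>\<^bsub>hecke_free G m\<^esub> gG g) \<in> hecke_rels G m"
| S_X: "k \<in> {1..<m} \<Longrightarrow>
    (gS k \<otimes>\<^bsub>hecke_free G m\<^esub> gX k,
     gX (k+1) \<otimes>\<^bsub>hecke_free G m\<^esub> gS k
       \<oplus>\<^bsub>hecke_free G m\<^esub> t_elem G m (hecke_free G m) gG k (k+1)) \<in> hecke_rels G m"
| S_X_far: "k \<in> {1..<m} \<Longrightarrow> l \<in> {1..m} \<Longrightarrow> l \<noteq> k \<Longrightarrow> l \<noteq> k + 1 \<Longrightarrow>
    (gS k \<otimes>\<^bsub>hecke_free G m\<^esub> gX l, gX l \<otimes>\<^bsub>hecke_free G m\<^esub> gS k) \<in> hecke_rels G m"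
| X_X: "k \<in> {1..m} \<Longrightarrow> l \<in> {1..m} \<Longrightarrow>
    (gX k \<otimes>\<^bsub>hecke_free G m\<^esub> gX l, gX l \<otimes>\<^bsub>hecke_free G m\<^esub> gX k) \<in> hecke_rels G m"

definition hecke_ideal :: "('g, 'c) monoid_scheme \<Rightarrow> nat \<Rightarrow> ('g hgen list \<Rightarrow> 'f::field) set" where
  "hecke_ideal G m =
     Idl\<^bsub>hecke_free G m\<^esub> {a \<ominus>\<^bsub>hecke_free G m\<^esub> b | a b. (a, b) \<in> hecke_rels G m}"

definition hecke ::
  "('g, 'c) monoid_scheme \<Rightarrow> nat \<Rightarrow> ('f::field, ('g hgen list \<Rightarrow> 'f) set) module" where
  "hecke G m = quot_alg (hecke_free G m) (hecke_ideal G m)"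

definition hecke_gen ::
  "('g, 'c) monoid_scheme \<Rightarrow> nat \<Rightarrow> 'g hgen \<Rightarrow> ('g hgen list \<Rightarrow> 'f::field) set" where
  "hecke_gen G m x = hecke_ideal G m +>\<^bsub>hecke_free G m\<^esub> basis [x]"


section \<open>The homomorphisms\<close>

text \<open>
  Homomorphisms are characterised by their values on generators, on which they are determined;
  outside the carrier of their domain they are arbitrary, except for \<open>is_Phi\<close>. Elements of
  \<open>Hbar\<close> coming from matrices of order \<open>m\<close> are written as constant sequences.
\<close>

definition is_Psi ::
  "('g, 'c) monoid_scheme \<Rightarrow> nat \<Rightarrow> nat \<Rightarrow>
   (('g hgen list \<Rightarrow> 'f::field) set \<Rightarrow> 'g zmat \<Rightarrow> 'f) \<Rightarrow> bool" where
  "is_Psi G m n \<Psi> \<longleftrightarrow>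
     \<Psi> \<in> alg_hom (hecke G m) (Zwr G m n) \<and>
     (\<forall>g \<in> carrier (Gpow G m).
        \<Psi> (hecke_gen G m (GenG g)) = basis (embed_mat G m n (tuple_mat m g))) \<and>
     (\<forall>k \<in> {1..<m}. \<Psi> (hecke_gen G m (GenS k)) = basis (transp_mat G n k (k+1))) \<and>
     (\<forall>l \<in> {1..m}. \<Psi> (hecke_gen G m (GenX l)) =
        (\<Oplus>\<^bsub>FGwr G n\<^esub> i \<in> {l+1..n}.
           t_elem G n (FGwr G n) (\<lambda>g. basis (tuple_mat n g)) l i
             \<otimes>\<^bsub>FGwr G n\<^esub> basis (transp_mat G n l i)))"

definition is_Psibar ::
  "('g, 'c) monoid_scheme \<Rightarrow> nat \<Rightarrow> nat \<Rightarrow>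
   ((nat \<Rightarrow> 'g zmat \<Rightarrow> 'f::field) \<Rightarrow> 'g zmat \<Rightarrow> 'f) \<Rightarrow> bool" where
  "is_Psibar G m n \<psi> \<longleftrightarrow>
     \<psi> \<in> alg_hom (Hbar G m) (Zbar G m n) \<and>
     (\<forall>g \<in> carrier (Gpow G m).
        \<psi> (const_seq G m (basis (tuple_mat m g))) = basis (embed_mat G m n (tuple_mat m g))) \<and>
     (\<forall>l \<in> {1..<m}.
        \<psi> (const_seq G m (basis (transp_mat G m l (l+1)))) = basis (transp_mat G n l (l+1))) \<and>
     (\<forall>k \<in> {1..m}. \<psi> (const_seq G m (basis (eps_mat G m k))) = basis (eps_mat G n k)) \<and>
     (\<forall>k \<in> {1..m}. \<psi> (u_seq G m k) = u_at G k n)"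

definition is_Phibar ::
  "('g, 'c) monoid_scheme \<Rightarrow> nat \<Rightarrow>
   ((nat \<Rightarrow> 'g zmat \<Rightarrow> 'f::field) \<Rightarrow> ('g hgen list \<Rightarrow> 'f) set) \<Rightarrow> bool" where
  "is_Phibar G m \<phi> \<longleftrightarrow>
     \<phi> \<in> alg_hom (Hbar G m) (hecke G m) \<and>
     \<phi> ` carrier (Hbar G m) = carrier (hecke G m) \<and>
     (\<forall>g \<in> carrier (Gpow G m).
        \<phi> (const_seq G m (basis (tuple_mat m g))) = hecke_gen G m (GenG g)) \<and>
     (\<forall>k \<in> {1..<m}.
        \<phi> (const_seq G m (basis (transp_mat G m k (k+1)))) = hecke_gen G m (GenS k)) \<and>
     (\<forall>l \<in> {1..m}. \<phi> (u_seq G m l) = hecke_gen G m (GenX l)) \<and>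
     (\<forall>l \<in> {1..m}.
        \<phi> (const_seq G m (basis (eps_mat G m l))) = \<zero>\<^bsub>hecke G m :: ('f, _) module\<^esub>)"

definition is_Phi ::
  "('g, 'c) monoid_scheme \<Rightarrow> nat \<Rightarrow> nat \<Rightarrow>
   (('g zmat \<Rightarrow> 'f::field) \<Rightarrow> 'g zmat \<Rightarrow> 'f) \<Rightarrow> bool" where
  "is_Phi G m n \<Phi> \<longleftrightarrow>
     (\<exists>\<phi> \<in> alg_hom (FGbar G n) (FGwr G n).
        (\<forall>A \<in> carrier (Gwr G n). \<phi> (basis A) = basis A) \<and>
        (\<forall>j \<in> {1..n}. \<phi> (basis (eps_mat G n j)) = \<zero>\<^bsub>FGwr G n :: ('f, _) module\<^esub>) \<and>
        \<Phi> = restrict \<phi> (carrier (Zbar G m n)))"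

end

theory Submission
  imports Defs "HOL-Combinatorics.Permutations"
begin

text \<open>
  Write \<open>X\<^sub>k\<close> for the sum of the labelled transpositions exchanging \<open>k\<close> with some \<open>i > k\<close>, the
  proposed image of \<open>x\<^sub>k\<close>. A monomial matrix conjugates labelled transpositions to labelled
  transpositions; summing over all labels makes the outcome depend only on the underlying
  permutation of the indices. This yields at once the relations of the wreath Hecke algebra and the
  fact that \<open>X\<^sub>k\<close> centralizes the matrices fixing \<open>1, \<dots>, k\<close>.

  The two composites are compared on generators. For this the bounded sequences have to form an
  algebra: \<open>\<theta>\<^sub>n(\<alpha> \<epsilon>\<^sub>n \<beta>) = \<theta>\<^sub>n(\<alpha>) \<theta>\<^sub>n(\<beta>)\<close> holds for all \<open>\<alpha>\<close> and \<open>\<beta>\<close>, and elements commuting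
  with \<open>\<epsilon>\<^sub>n\<close> satisfy \<open>\<theta>\<^sub>n(\<alpha> \<epsilon>\<^sub>n \<beta>) = \<theta>\<^sub>n(\<alpha> \<beta>)\<close>.

  The centralizer is spanned by the sums over the orbits of \<open>G'\<^sub>n\<^sub>-\<^sub>m\<close> acting by conjugation on \<open>G\<^sub>n\<close>.
  Induct on the number of \<open>j > m\<close> with \<open>\<gamma>\<^sub>j\<^sub>j \<noteq> 1\<close>. If \<open>\<gamma>\<close> preserves \<open>{1, \<dots>, m}\<close>, it is the product of
  some \<open>w \<in> G\<^sub>m\<close> and some \<open>c \<in> G'\<^sub>n\<^sub>-\<^sub>m\<close>, and its orbit sum is \<open>w\<close> times the class sum of \<open>c\<close>. Otherwise
  \<open>\<gamma>\<close> sends some \<open>k \<le> m\<close> to an index greater than \<open>m\<close>; splitting off a labelled transposition lowers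
  the degree of \<open>\<gamma>\<close>, and multiplying the smaller orbit sum by \<open>X\<^sub>k\<close> gives back that of \<open>\<gamma>\<close> modulo
  smaller degree, all coefficients being 1, so the characteristic of the field plays no role.
\<close>

section \<open>Linear extension and semigroup algebras\<close>

text \<open>Over a field of arbitrary characteristic one cannot divide by the order of the tail
  group, so orbit sums have to be produced with exact coefficients. In the product of the orbit sum
  of \<gamma>' with \<open>X\<^sub>k\<close>, a term \<open>B tau\<close> reaches the top tail
  degree only if \<open>tau\<close> joins \<open>k\<close> to some i > m at which \<open>B\<close>
  has diagonal entry 1. Such a product determines its factors, because its column \<open>k\<close>
  displays \<open>i\<close> and the label of \<open>tau\<close>. All such products lie in one orbit:
  tail matrices that differ from the identity only at such indices commute with \<open>B\<close>,
  and they move any such \<open>tau\<close> to any other.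

  The factors \<open>1 - \<epsilon>\<close> in \<open>u\<^sub>k\<close> answer a second difficulty:
  matrices of the tail semigroup may have zero rows and columns. The terms of
  \<open>u\<^sub>k\<close> at such an index are annihilated, and the remaining ones are permuted as
  by a monomial matrix. Since \<Phi> kills every \<epsilon>, these factors become 1 and
  \<open>u\<^sub>k\<close> becomes \<open>X\<^sub>k\<close>.

  Agreement on generators suffices for the square because a matrix with a zero column is one with
  fewer zero columns times some \<epsilon>.\<close>

definition lin_lift :: "('a \<Rightarrow> 'b \<Rightarrow> 'f) \<Rightarrow> ('a \<Rightarrow> 'f::field) \<Rightarrow> 'b \<Rightarrow> 'f" where
  "lin_lift f a = (\<lambda>z. \<Sum>x | a x \<noteq> 0. a x * f x z)"

abbreviation fin_supp :: "('a \<Rightarrow> 'f::field) \<Rightarrow> bool" where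
  "fin_supp a \<equiv> finite {x. a x \<noteq> 0}"

text \<open>Allows any finite range containing the support, so that vectors with different supports
  can be summed over a common one.\<close>

lemma lin_lift_eq_sum:
  assumes "finite X" "\<And>x. a x \<noteq> 0 \<Longrightarrow> x \<in> X"
  shows "lin_lift f a z = (\<Sum>x\<in>X. a x * f x z)"
  unfolding lin_lift_def by (rule sum.mono_neutral_left) (use assms in auto)

lemma lin_lift_zero [simp]: "lin_lift f (\<lambda>z. 0) = (\<lambda>z. 0)"
  by (simp add: lin_lift_def)

lemma lin_lift_basis [simp]: "lin_lift f (basis x) = f x"
proof
  fix z
  show "lin_lift f (basis x) z = f x z" by (simp add: lin_lift_def basis_def)
qed

lemma lin_lift_add:
  assumes "fin_supp a" "fin_supp b"
  shows "lin_lift f (\<lambda>z. a z + b z) = (\<lambda>z. lin_lift f a z + lin_lift f b z)"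
proof
  fix z
  let ?X = "{x. a x \<noteq> 0} \<union> {x. b x \<noteq> 0}"
  have *: "lin_lift f c z = (\<Sum>x\<in>?X. c x * f x z)" if "{x. c x \<noteq> 0} \<subseteq> ?X" for c
    by (rule lin_lift_eq_sum) (use assms that in auto)
  have "lin_lift f a z = (\<Sum>x\<in>?X. a x * f x z)" "lin_lift f b z = (\<Sum>x\<in>?X. b x * f x z)"
    "lin_lift f (\<lambda>z. a z + b z) z = (\<Sum>x\<in>?X. (a x + b x) * f x z)"
    by (rule *; auto)+
  then show "lin_lift f (\<lambda>z. a z + b z) z = lin_lift f a z + lin_lift f b z"
    by (simp add: sum.distrib algebra_simps)
qed

lemma lin_lift_smult: "lin_lift f (\<lambda>z. c * a z) = (\<lambda>z. c * lin_lift f a z)"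
  by (cases "c = 0") (auto simp: lin_lift_def sum_distrib_left mult.assoc)

lemma lin_lift_cong:
  assumes "\<And>x. a x \<noteq> 0 \<Longrightarrow> f x = g x"
  shows "lin_lift f a = lin_lift g a"
  unfolding lin_lift_def using assms by (auto intro!: ext sum.cong)

lemma lin_lift_add_fun:
  "lin_lift (\<lambda>x z. f x z + g x z) a = (\<lambda>z. lin_lift f a z + lin_lift g a z)"
  by (simp add: lin_lift_def sum.distrib algebra_simps)

lemma lin_lift_smult_fun: "lin_lift (\<lambda>x z. c * f x z) a = (\<lambda>z. c * lin_lift f a z)"
  by (simp add: lin_lift_def sum_distrib_left algebra_simps)

lemma lin_lift_sum_fun:
  "lin_lift (\<lambda>x z. \<Sum>i\<in>I. f i x z) a = (\<lambda>z. \<Sum>i\<in>I. lin_lift (f i) a z)"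
  unfolding lin_lift_def by (subst sum.swap) (simp add: sum_distrib_left)

text \<open>Valid for arbitrary supports: a sum over an infinite set is 0 by convention, and then
  both sides vanish.\<close>

lemma lin_lift_swap:
  "lin_lift (\<lambda>x. lin_lift (f x) b) a = lin_lift (\<lambda>y. lin_lift (\<lambda>x. f x y) a) b"
proof
  fix z
  have "lin_lift (\<lambda>x. lin_lift (f x) b) a z = (\<Sum>x | a x \<noteq> 0. \<Sum>y | b y \<noteq> 0. a x * (b y * f x y z))"
    by (simp add: lin_lift_def sum_distrib_left)
  also have "\<dots> = (\<Sum>y | b y \<noteq> 0. \<Sum>x | a x \<noteq> 0. a x * (b y * f x y z))"
    by (rule sum.swap)
  also have "\<dots> = lin_lift (\<lambda>y. lin_lift (\<lambda>x. f x y) a) b z"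
    by (simp add: lin_lift_def sum_distrib_left mult.left_commute)
  finally show "lin_lift (\<lambda>x. lin_lift (f x) b) a z = lin_lift (\<lambda>y. lin_lift (\<lambda>x. f x y) a) b z" .
qed

lemma lin_lift_supp: "{z. lin_lift f a z \<noteq> 0} \<subseteq> (\<Union>x\<in>{x. a x \<noteq> 0}. {z. f x z \<noteq> 0})"
proof
  fix z assume "z \<in> {z. lin_lift f a z \<noteq> 0}"
  then have "(\<Sum>x | a x \<noteq> 0. a x * f x z) \<noteq> 0" by (simp add: lin_lift_def)
  then obtain x where "a x \<noteq> 0" "a x * f x z \<noteq> 0"
    by (rule sum.not_neutral_contains_not_neutral) auto
  then show "z \<in> (\<Union>x\<in>{x. a x \<noteq> 0}. {z. f x z \<noteq> 0})" by auto
qed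

lemma fin_supp_lin_lift:
  assumes "fin_supp a" "\<And>x. a x \<noteq> 0 \<Longrightarrow> fin_supp (f x)"
  shows "fin_supp (lin_lift f a)"
  by (rule finite_subset[OF lin_lift_supp]) (use assms in auto)

lemma fin_supp_basis [simp]: "fin_supp (basis x)"
  by (rule finite_subset[of _ "{x}"]) (auto simp: basis_def)

text \<open>Iterated products and composites of linear maps are flattened with this rule; what
  remains is a comparison on basis elements. The finiteness hypotheses make the common range
  \<open>?Y\<close> finite.\<close>

lemma lin_lift_lin_lift:
  assumes "fin_supp a" "\<And>x. a x \<noteq> 0 \<Longrightarrow> fin_supp (g x)"
  shows "lin_lift f (lin_lift g a) = lin_lift (\<lambda>x. lin_lift f (g x)) a"
proof
  fix z
  let ?Y = "\<Union>x\<in>{x. a x \<noteq> 0}. {y. g x y \<noteq> 0}"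
  have fY: "finite ?Y" using assms by auto
  have "lin_lift f (lin_lift g a) z = (\<Sum>y\<in>?Y. lin_lift g a y * f y z)"
    by (rule lin_lift_eq_sum[OF fY]) (use lin_lift_supp[of g a] in blast)
  also have "\<dots> = (\<Sum>y\<in>?Y. \<Sum>x | a x \<noteq> 0. a x * (g x y * f y z))"
    by (simp add: lin_lift_def sum_distrib_right mult.assoc)
  also have "\<dots> = (\<Sum>x | a x \<noteq> 0. \<Sum>y\<in>?Y. a x * (g x y * f y z))"
    by (rule sum.swap)
  also have "\<dots> = (\<Sum>x | a x \<noteq> 0. a x * lin_lift f (g x) z)"
  proof (rule sum.cong[OF refl])
    fix x assume "x \<in> {x. a x \<noteq> 0}"
    then have "lin_lift f (g x) z = (\<Sum>y\<in>?Y. g x y * f y z)"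
      by (intro lin_lift_eq_sum[OF fY]) auto
    then show "(\<Sum>y\<in>?Y. a x * (g x y * f y z)) = a x * lin_lift f (g x) z"
      by (simp add: sum_distrib_left)
  qed
  finally show "lin_lift f (lin_lift g a) z = lin_lift (\<lambda>x. lin_lift f (g x)) a z"
    by (simp add: lin_lift_def)
qed

lemma lin_ext_eq_lin_lift:
  assumes "fin_supp a"
  shows "lin_ext f a = lin_lift (\<lambda>x. basis (f x)) a"
proof
  fix z
  have "lin_ext f a z = (\<Sum>x | a x \<noteq> 0. if f x = z then a x else 0)"
    using sum.inter_filter[OF assms] by (simp add: lin_ext_def)
  also have "\<dots> = lin_lift (\<lambda>x. basis (f x)) a z"
    by (auto simp: lin_lift_def basis_def intro!: sum.cong)
  finally show "lin_ext f a z = lin_lift (\<lambda>x. basis (f x)) a z" .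
qed

section \<open>The semigroup algebra as a ring\<close>

lemma sg_alg_carrier:
  "a \<in> carrier (sg_alg S) \<longleftrightarrow> fin_supp a \<and> (\<forall>x. a x \<noteq> 0 \<longrightarrow> x \<in> carrier S)"
  by (auto simp: sg_alg_def)

lemma sg_alg_ops:
  "a \<oplus>\<^bsub>sg_alg S\<^esub> b = (\<lambda>z. a z + b z)" "\<zero>\<^bsub>sg_alg S\<^esub> = (\<lambda>z. 0)" "\<one>\<^bsub>sg_alg S\<^esub> = basis \<one>\<^bsub>S\<^esub>"
  "c \<odot>\<^bsub>sg_alg S\<^esub> a = (\<lambda>z. c * a z)"
  by (simp_all add: sg_alg_def basis_def)

lemma sg_alg_fin: "a \<in> carrier (sg_alg S) \<Longrightarrow> fin_supp a"
  by (simp add: sg_alg_def)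

text \<open>Once convolution is a nested \<open>lin_lift\<close>, the ring laws and the
  multiplicativity of linear extensions come from the calculus above. The identity holds for
  arbitrary functions, as both sides sum over the two supports themselves.\<close>

lemma sg_alg_mult:
  "a \<otimes>\<^bsub>sg_alg S\<^esub> b = lin_lift (\<lambda>x. lin_lift (\<lambda>y. basis (x \<otimes>\<^bsub>S\<^esub> y)) b) a"
  unfolding sg_alg_def lin_lift_def basis_def
  by (auto simp: fun_eq_iff sum_distrib_left intro!: sum.cong)

lemma basis_mult: "basis x \<otimes>\<^bsub>sg_alg S\<^esub> basis y = basis (x \<otimes>\<^bsub>S\<^esub> y)"
  by (simp add: sg_alg_mult)

lemma basis_mult_left: "basis x \<otimes>\<^bsub>sg_alg S\<^esub> b = lin_lift (\<lambda>y. basis (x \<otimes>\<^bsub>S\<^esub> y)) b"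
  by (simp add: sg_alg_mult)

lemma basis_mult_right: "a \<otimes>\<^bsub>sg_alg S\<^esub> basis y = lin_lift (\<lambda>x. basis (x \<otimes>\<^bsub>S\<^esub> y)) a"
  by (simp add: sg_alg_mult)

lemma basis_in [simp]: "basis x \<in> carrier (sg_alg S) \<longleftrightarrow> x \<in> carrier S"
  by (auto simp: sg_alg_carrier basis_def)

lemma lin_lift_in:
  assumes "a \<in> carrier (sg_alg S)" "\<And>x. x \<in> carrier S \<Longrightarrow> f x \<in> carrier (sg_alg T)"
  shows "lin_lift f a \<in> carrier (sg_alg T)"
  using assms lin_lift_supp[of f a] fin_supp_lin_lift[of a f]
  unfolding sg_alg_carrier by blast

lemma sg_alg_add_in:
  assumes "a \<in> carrier (sg_alg S)" "b \<in> carrier (sg_alg S)"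
  shows "(\<lambda>z. a z + b z) \<in> carrier (sg_alg S)"
proof -
  have "{x. a x + b x \<noteq> 0} \<subseteq> {x. a x \<noteq> 0} \<union> {x. b x \<noteq> 0}" by auto
  moreover have "finite ({x. a x \<noteq> 0} \<union> {x. b x \<noteq> 0})" using assms by (simp add: sg_alg_carrier)
  ultimately have "fin_supp (\<lambda>x. a x + b x)" by (rule finite_subset)
  then show ?thesis using assms unfolding sg_alg_carrier by (metis add.left_neutral)
qed

lemma sg_alg_smult_in:
  assumes "a \<in> carrier (sg_alg S)"
  shows "(\<lambda>z. c * a z) \<in> carrier (sg_alg S)"
proof -
  have "{x. c * a x \<noteq> 0} \<subseteq> {x. a x \<noteq> 0}" by auto
  then have "fin_supp (\<lambda>x. c * a x)"
    by (rule finite_subset) (use assms in \<open>simp add: sg_alg_carrier\<close>)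
  then show ?thesis using assms unfolding sg_alg_carrier by auto
qed

lemma sg_alg_zero_in [simp]: "(\<lambda>z. 0) \<in> carrier (sg_alg S)"
  by (simp add: sg_alg_carrier)

lemma sg_alg_induct [consumes 1, case_names zero add smult basis]:
  fixes a :: "'a \<Rightarrow> 'f::field"
  assumes a: "a \<in> carrier (sg_alg S)"
    and z: "P (\<lambda>z. 0)"
    and add: "\<And>a b. a \<in> carrier (sg_alg S) \<Longrightarrow> b \<in> carrier (sg_alg S) \<Longrightarrow> P a \<Longrightarrow> P b \<Longrightarrow> P (\<lambda>z. a z + b z)"
    and smult: "\<And>c a. a \<in> carrier (sg_alg S) \<Longrightarrow> P a \<Longrightarrow> P (\<lambda>z. c * a z)"
    and basis: "\<And>x. x \<in> carrier S \<Longrightarrow> P (basis x)"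
  shows "P a"
proof -
  have "finite X \<Longrightarrow> a \<in> carrier (sg_alg S) \<Longrightarrow> {x. a x \<noteq> 0} \<subseteq> X \<Longrightarrow> P a" for X and a :: "'a \<Rightarrow> 'f"
  proof (induction X arbitrary: a rule: finite_induct)
    case empty
    then have "a = (\<lambda>z. 0)" by auto
    then show ?case using z by simp
  next
    case (insert x X)
    show ?case
    proof (cases "a x = 0")
      case True
      then show ?thesis using insert by auto
    next
      case False
      \<comment> \<open>Removing one support point leaves a vector supported in \<open>X\<close>, to
        which the induction hypothesis applies.\<close>
      let ?b = "a(x := 0)"
      have fb: "{y. ?b y \<noteq> 0} \<subseteq> {y. a y \<noteq> 0}" by auto
      have xS: "x \<in> carrier S" using False insert.prems(1) by (simp add: sg_alg_carrier)
      have b: "?b \<in> carrier (sg_alg S)"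
        using insert.prems(1) finite_subset[OF fb] by (auto simp: sg_alg_carrier)
      have "P ?b" by (rule insert.IH[OF b]) (use insert.prems(2) in auto)
      moreover have "P (\<lambda>z. a x * basis x z)" using smult basis xS by auto
      moreover have "(\<lambda>z. a x * basis x z) \<in> carrier (sg_alg S)"
        by (rule sg_alg_smult_in) (simp add: xS)
      ultimately have "P (\<lambda>z. ?b z + a x * basis x z)" using add b by blast
      moreover have "(\<lambda>z. ?b z + a x * basis x z) = a" by (auto simp: basis_def)
      ultimately show ?thesis by simp
    qed
  qed
  then show ?thesis using a by (auto simp: sg_alg_carrier)
qed

lemma sg_alg_mult_in:
  assumes "monoid S" "a \<in> carrier (sg_alg S)" "b \<in> carrier (sg_alg S)"
  shows "a \<otimes>\<^bsub>sg_alg S\<^esub> b \<in> carrier (sg_alg S)"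
  unfolding sg_alg_mult
  by (intro lin_lift_in[of _ S]) (use assms monoid.m_closed in fastforce)+

lemma sg_alg_smult_mult:
  "(c \<odot>\<^bsub>sg_alg S\<^esub> a) \<otimes>\<^bsub>sg_alg S\<^esub> b = c \<odot>\<^bsub>sg_alg S\<^esub> (a \<otimes>\<^bsub>sg_alg S\<^esub> b)"
  "a \<otimes>\<^bsub>sg_alg S\<^esub> (c \<odot>\<^bsub>sg_alg S\<^esub> b) = c \<odot>\<^bsub>sg_alg S\<^esub> (a \<otimes>\<^bsub>sg_alg S\<^esub> b)"
  by (simp_all add: sg_alg_mult sg_alg_ops lin_lift_smult lin_lift_smult_fun)

text \<open>Both sides are bilinear, so the identity on basis elements is enough. Two inner sums are
  exchanged with \<open>lin_lift_swap\<close> because \<open>f x\<close> is itself a vector.\<close>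

lemma lin_lift_mult:
  assumes S: "monoid S" and a: "a \<in> carrier (sg_alg S)" and b: "b \<in> carrier (sg_alg S)"
    and f: "\<And>x. x \<in> carrier S \<Longrightarrow> f x \<in> carrier (sg_alg T)"
    and hom: "\<And>x y. x \<in> carrier S \<Longrightarrow> y \<in> carrier S \<Longrightarrow> f (x \<otimes>\<^bsub>S\<^esub> y) = f x \<otimes>\<^bsub>sg_alg T\<^esub> f y"
  shows "lin_lift f (a \<otimes>\<^bsub>sg_alg S\<^esub> b) = lin_lift f a \<otimes>\<^bsub>sg_alg T\<^esub> lin_lift f b"
proof -
  note fin = sg_alg_fin[OF a] sg_alg_fin[OF b]
  have aS: "x \<in> carrier S" if "a x \<noteq> 0" for x using a that by (simp add: sg_alg_carrier)
  have bS: "x \<in> carrier S" if "b x \<noteq> 0" for x using b that by (simp add: sg_alg_carrier)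
  have "lin_lift f (a \<otimes>\<^bsub>sg_alg S\<^esub> b) = lin_lift (\<lambda>x. lin_lift (\<lambda>y. f (x \<otimes>\<^bsub>S\<^esub> y)) b) a"
    by (simp add: sg_alg_mult lin_lift_lin_lift fin_supp_lin_lift fin)
  also have "\<dots> = lin_lift (\<lambda>x. f x \<otimes>\<^bsub>sg_alg T\<^esub> lin_lift f b) a"
  proof (rule lin_lift_cong)
    fix x assume x: "a x \<noteq> 0"
    have *: "fin_supp (f y)" if "b y \<noteq> 0" for y using f[OF bS[OF that]] by (simp add: sg_alg_fin)
    have "f x \<otimes>\<^bsub>sg_alg T\<^esub> lin_lift f b = lin_lift (\<lambda>p. lin_lift (\<lambda>y. lin_lift (\<lambda>q. basis (p \<otimes>\<^bsub>T\<^esub> q)) (f y)) b) (f x)"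
      by (simp add: sg_alg_mult lin_lift_lin_lift fin *)
    also have "\<dots> = lin_lift (\<lambda>y. f x \<otimes>\<^bsub>sg_alg T\<^esub> f y) b"
      unfolding sg_alg_mult by (rule lin_lift_swap)
    also have "\<dots> = lin_lift (\<lambda>y. f (x \<otimes>\<^bsub>S\<^esub> y)) b"
      by (rule lin_lift_cong) (use hom aS bS x in auto)
    finally show "lin_lift (\<lambda>y. f (x \<otimes>\<^bsub>S\<^esub> y)) b = f x \<otimes>\<^bsub>sg_alg T\<^esub> lin_lift f b" by simp
  qed
  also have "\<dots> = lin_lift f a \<otimes>\<^bsub>sg_alg T\<^esub> lin_lift f b"
    unfolding sg_alg_mult[where S = T]
    by (rule lin_lift_lin_lift[symmetric]) (use fin f aS sg_alg_fin in blast)+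
  finally show ?thesis .
qed

lemma sg_alg_assoc:
  assumes S: "monoid S"
    and a: "a \<in> carrier (sg_alg S)" and b: "b \<in> carrier (sg_alg S)" and c: "c \<in> carrier (sg_alg S)"
  shows "a \<otimes>\<^bsub>sg_alg S\<^esub> b \<otimes>\<^bsub>sg_alg S\<^esub> c = a \<otimes>\<^bsub>sg_alg S\<^esub> (b \<otimes>\<^bsub>sg_alg S\<^esub> c)"
proof -
  note fin = sg_alg_fin[OF a] sg_alg_fin[OF b] sg_alg_fin[OF c]
  have "a \<otimes>\<^bsub>sg_alg S\<^esub> b \<otimes>\<^bsub>sg_alg S\<^esub> c =
      lin_lift (\<lambda>x. lin_lift (\<lambda>y. lin_lift (\<lambda>w. basis (x \<otimes>\<^bsub>S\<^esub> y \<otimes>\<^bsub>S\<^esub> w)) c) b) a"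
    by (simp add: sg_alg_mult lin_lift_lin_lift fin_supp_lin_lift fin)
  also have "\<dots> = lin_lift (\<lambda>x. lin_lift (\<lambda>y. lin_lift (\<lambda>w. basis (x \<otimes>\<^bsub>S\<^esub> (y \<otimes>\<^bsub>S\<^esub> w))) c) b) a"
    using a b c S by (intro lin_lift_cong) (auto simp: sg_alg_carrier monoid.m_assoc)
  also have "\<dots> = a \<otimes>\<^bsub>sg_alg S\<^esub> (b \<otimes>\<^bsub>sg_alg S\<^esub> c)"
    by (simp add: sg_alg_mult lin_lift_lin_lift fin_supp_lin_lift fin)
  finally show ?thesis .
qed

lemma lin_lift_id [simp]: "fin_supp a \<Longrightarrow> lin_lift basis a = a"
proof
  fix z assume a: "fin_supp a"
  have "lin_lift basis a z = (\<Sum>x | a x \<noteq> 0. if z = x then a x else 0)"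
    by (auto simp: lin_lift_def basis_def intro!: sum.cong)
  then show "lin_lift basis a z = a z" using a by simp
qed

lemma sg_alg_ring:
  assumes S: "monoid S"
  shows "ring (sg_alg S :: ('f::field, 'a \<Rightarrow> 'f) module)"
proof (rule ringI)
  let ?A = "sg_alg S :: ('f, 'a \<Rightarrow> 'f) module"
  interpret monoid S by (rule S)
  show "abelian_group ?A"
  proof (rule abelian_groupI)
    fix x assume "x \<in> carrier ?A"
    then show "\<exists>y\<in>carrier ?A. y \<oplus>\<^bsub>?A\<^esub> x = \<zero>\<^bsub>?A\<^esub>"
      using sg_alg_smult_in[of x S "-1"] by (intro bexI[of _ "\<lambda>z. - x z"]) (simp_all add: sg_alg_ops)
  qed (auto simp: sg_alg_ops sg_alg_add_in algebra_simps)
  show "Group.monoid ?A"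
  proof (rule monoidI)
    fix x assume x: "x \<in> carrier ?A"
    have "\<one>\<^bsub>?A\<^esub> \<otimes>\<^bsub>?A\<^esub> x = lin_lift basis x"
      unfolding sg_alg_ops basis_mult_left
      by (rule lin_lift_cong) (use x in \<open>auto simp: sg_alg_carrier\<close>)
    then show "\<one>\<^bsub>?A\<^esub> \<otimes>\<^bsub>?A\<^esub> x = x" using x by (simp add: sg_alg_fin)
    have "x \<otimes>\<^bsub>?A\<^esub> \<one>\<^bsub>?A\<^esub> = lin_lift basis x"
      unfolding sg_alg_ops basis_mult_right
      by (rule lin_lift_cong) (use x in \<open>auto simp: sg_alg_carrier\<close>)
    then show "x \<otimes>\<^bsub>?A\<^esub> \<one>\<^bsub>?A\<^esub> = x" using x by (simp add: sg_alg_fin)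
  qed (auto simp: sg_alg_ops sg_alg_assoc[OF S] sg_alg_mult_in[OF S])
qed (auto simp: sg_alg_ops sg_alg_mult lin_lift_add lin_lift_add_fun sg_alg_fin)

lemma sg_alg_a_inv:
  assumes "monoid S" "a \<in> carrier (sg_alg S)"
  shows "\<ominus>\<^bsub>sg_alg S\<^esub> a = (\<lambda>z. - a z)"
proof -
  interpret ring "sg_alg S" by (rule sg_alg_ring) fact
  have "(\<lambda>z. - a z) \<in> carrier (sg_alg S)" using sg_alg_smult_in[OF assms(2), of "-1"] by simp
  then show ?thesis using assms(2) by (intro minus_equality) (auto simp: sg_alg_ops)
qed

lemma sg_alg_minus:
  assumes "monoid S" "b \<in> carrier (sg_alg S)"
  shows "a \<ominus>\<^bsub>sg_alg S\<^esub> b = (\<lambda>z. a z - b z)"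
  using assms by (simp add: a_minus_def sg_alg_a_inv sg_alg_ops)

lemma sg_alg_finsum:
  assumes S: "monoid S" and "\<And>i. i \<in> I \<Longrightarrow> f i \<in> carrier (sg_alg S)"
  shows "finsum (sg_alg S) f I = (\<lambda>z. \<Sum>i\<in>I. f i z)"
proof -
  interpret ring "sg_alg S" by (rule sg_alg_ring) fact
  show ?thesis
  proof (cases "finite I")
    case True
    then show ?thesis using assms(2)
      by (induction I rule: finite_induct) (auto simp: sg_alg_ops Pi_def finsum_insert)
  qed (simp add: sg_alg_ops finsum_infinite)
qed

lemma sg_alg_sum_in:
  assumes "\<And>i. i \<in> I \<Longrightarrow> f i \<in> carrier (sg_alg S)"
  shows "(\<lambda>z. \<Sum>i\<in>I. f i z) \<in> carrier (sg_alg S)"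
proof (cases "finite I")
  case True
  then show ?thesis using assms
    by (induction I rule: finite_induct) (auto simp: sg_alg_add_in)
qed simp

lemma lin_lift_sum:
  assumes "\<And>i. i \<in> I \<Longrightarrow> fin_supp (g i)"
  shows "lin_lift f (\<lambda>z. \<Sum>i\<in>I. g i z) = (\<lambda>z. \<Sum>i\<in>I. lin_lift f (g i) z)"
proof (cases "finite I")
  case True
  then show ?thesis using assms
  proof (induction I rule: finite_induct)
    case (insert x F)
    have "{z. (\<Sum>i\<in>F. g i z) \<noteq> 0} \<subseteq> (\<Union>i\<in>F. {z. g i z \<noteq> 0})"
      by (auto elim!: sum.not_neutral_contains_not_neutral)
    then have "fin_supp (\<lambda>z. \<Sum>i\<in>F. g i z)"
      by (rule finite_subset) (use insert in auto)
    then show ?case using insert by (auto simp: lin_lift_add sg_alg_fin)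
  qed simp
qed simp

lemma sg_alg_sum_mult:
  assumes "\<And>i. i \<in> I \<Longrightarrow> fin_supp (f i)"
  shows "(\<lambda>z. \<Sum>i\<in>I. f i z) \<otimes>\<^bsub>sg_alg S\<^esub> b = (\<lambda>z. \<Sum>i\<in>I. (f i \<otimes>\<^bsub>sg_alg S\<^esub> b) z)"
  unfolding sg_alg_mult by (rule lin_lift_sum) (use assms in auto)

lemma sg_alg_mult_sum:
  assumes "\<And>i. i \<in> I \<Longrightarrow> fin_supp (f i)"
  shows "b \<otimes>\<^bsub>sg_alg S\<^esub> (\<lambda>z. \<Sum>i\<in>I. f i z) = (\<lambda>z. \<Sum>i\<in>I. (b \<otimes>\<^bsub>sg_alg S\<^esub> f i) z)"
proof -
  have "lin_lift (\<lambda>y. basis (x \<otimes>\<^bsub>S\<^esub> y)) (\<lambda>z. \<Sum>i\<in>I. f i z) =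
    (\<lambda>z. \<Sum>i\<in>I. lin_lift (\<lambda>y. basis (x \<otimes>\<^bsub>S\<^esub> y)) (f i) z)" for x
    by (rule lin_lift_sum) (use assms in auto)
  then show ?thesis by (simp add: sg_alg_mult lin_lift_sum_fun)
qed

lemma lin_lift_alg_hom:
  assumes "monoid S"
    and "\<And>x. x \<in> carrier S \<Longrightarrow> f x \<in> carrier (sg_alg T)"
    and "\<And>x y. x \<in> carrier S \<Longrightarrow> y \<in> carrier S \<Longrightarrow> f (x \<otimes>\<^bsub>S\<^esub> y) = f x \<otimes>\<^bsub>sg_alg T\<^esub> f y"
    and "f \<one>\<^bsub>S\<^esub> = basis \<one>\<^bsub>T\<^esub>"
  shows "lin_lift f \<in> alg_hom (sg_alg S) (sg_alg T)"
  unfolding alg_hom_def ring_hom_def using assms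
  by (auto simp: lin_lift_in sg_alg_ops lin_lift_add lin_lift_smult sg_alg_fin
      intro!: lin_lift_mult)

section \<open>Generated subalgebras and quotients\<close>

lemma subalg_gen_alg:
  assumes "subalg A B" "X \<subseteq> B"
  shows "subalg A (gen_alg A X)" "X \<subseteq> gen_alg A X" "gen_alg A X \<subseteq> B"
proof -
  show "X \<subseteq> gen_alg A X" "gen_alg A X \<subseteq> B" using assms by (auto simp: gen_alg_def)
  then have "gen_alg A X \<subseteq> carrier A" using assms by (auto simp: subalg_def)
  then show "subalg A (gen_alg A X)" unfolding subalg_def by (auto simp: gen_alg_def subalg_def)
qed

lemma gen_alg_least: "subalg A B \<Longrightarrow> X \<subseteq> B \<Longrightarrow> gen_alg A X \<subseteq> B"
  unfolding gen_alg_def by blast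

lemma alg_homD:
  assumes "\<phi> \<in> alg_hom A B"
  shows "a \<in> carrier A \<Longrightarrow> \<phi> a \<in> carrier B"
    "a \<in> carrier A \<Longrightarrow> b \<in> carrier A \<Longrightarrow> \<phi> (a \<otimes>\<^bsub>A\<^esub> b) = \<phi> a \<otimes>\<^bsub>B\<^esub> \<phi> b"
    "a \<in> carrier A \<Longrightarrow> b \<in> carrier A \<Longrightarrow> \<phi> (a \<oplus>\<^bsub>A\<^esub> b) = \<phi> a \<oplus>\<^bsub>B\<^esub> \<phi> b"
    "a \<in> carrier A \<Longrightarrow> \<phi> (c \<odot>\<^bsub>A\<^esub> a) = c \<odot>\<^bsub>B\<^esub> \<phi> a"
    "\<phi> \<one>\<^bsub>A\<^esub> = \<one>\<^bsub>B\<^esub>"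
  using assms unfolding alg_hom_def ring_hom_def by auto

text \<open>Serves all comparisons of homomorphisms on generators. The domain is \<open>A\<close>
  with carrier \<open>B\<close>, which is how \<open>Hbar\<close> is built from
  \<open>Zseq\<close>.\<close>

lemma subalg_equalizer:
  assumes B: "subalg A B" and f: "f \<in> alg_hom (A\<lparr>carrier := B\<rparr>) C" and g: "g \<in> alg_hom (A\<lparr>carrier := B\<rparr>) C"
  shows "subalg A {a \<in> B. f a = g a}"
proof -
  note hom = alg_homD(2-5)[OF f, simplified] alg_homD(2-5)[OF g, simplified]
  show ?thesis
    unfolding subalg_def
  proof (intro conjI ballI allI)
    show "{a \<in> B. f a = g a} \<subseteq> carrier A" "\<one>\<^bsub>A\<^esub> \<in> {a \<in> B. f a = g a}"
      using B hom(4,8) by (auto simp: subalg_def)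
    show "c \<odot>\<^bsub>A\<^esub> a \<in> {a \<in> B. f a = g a}" if "a \<in> {a \<in> B. f a = g a}" for c a
      using that B hom(3,7) by (auto simp: subalg_def)
    fix a b assume ab: "a \<in> {a \<in> B. f a = g a}" "b \<in> {a \<in> B. f a = g a}"
    then show "a \<oplus>\<^bsub>A\<^esub> b \<in> {a \<in> B. f a = g a}" "a \<otimes>\<^bsub>A\<^esub> b \<in> {a \<in> B. f a = g a}"
      using B hom(1,2,5,6) by (auto simp: subalg_def)
  qed
qed

lemma sg_alg_subalg: "monoid S \<Longrightarrow> subalg (sg_alg S) (carrier (sg_alg S))"
  unfolding subalg_def
  by (auto simp: sg_alg_ops sg_alg_add_in sg_alg_mult_in sg_alg_smult_in monoid.one_closed)

lemma centralizer_subalg: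
  assumes S: "monoid S" and X: "X \<subseteq> carrier (sg_alg S)"
  shows "subalg (sg_alg S) (centralizer_in (sg_alg S) X)"
proof -
  interpret ring "sg_alg S" by (rule sg_alg_ring) fact
  have sm: "c \<odot>\<^bsub>sg_alg S\<^esub> a \<in> carrier (sg_alg S)" if "a \<in> carrier (sg_alg S)" for c a
    using that by (simp add: sg_alg_ops sg_alg_smult_in)
  show ?thesis
    unfolding subalg_def centralizer_in_def
  proof (intro conjI ballI allI subsetI CollectI)
    fix a b x assume a: "a \<in> {a \<in> carrier (sg_alg S). \<forall>x\<in>X. a \<otimes>\<^bsub>sg_alg S\<^esub> x = x \<otimes>\<^bsub>sg_alg S\<^esub> a}"
      and b: "b \<in> {a \<in> carrier (sg_alg S). \<forall>x\<in>X. a \<otimes>\<^bsub>sg_alg S\<^esub> x = x \<otimes>\<^bsub>sg_alg S\<^esub> a}" and x: "x \<in> X"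
    have xc: "x \<in> carrier (sg_alg S)" using x X by auto
    have ca: "a \<in> carrier (sg_alg S)" "b \<in> carrier (sg_alg S)"
      and com: "a \<otimes>\<^bsub>sg_alg S\<^esub> x = x \<otimes>\<^bsub>sg_alg S\<^esub> a" "b \<otimes>\<^bsub>sg_alg S\<^esub> x = x \<otimes>\<^bsub>sg_alg S\<^esub> b"
      using a b x by auto
    show "(a \<oplus>\<^bsub>sg_alg S\<^esub> b) \<otimes>\<^bsub>sg_alg S\<^esub> x = x \<otimes>\<^bsub>sg_alg S\<^esub> (a \<oplus>\<^bsub>sg_alg S\<^esub> b)"
      using ca xc by (simp add: l_distr r_distr com)
    show "a \<otimes>\<^bsub>sg_alg S\<^esub> b \<otimes>\<^bsub>sg_alg S\<^esub> x = x \<otimes>\<^bsub>sg_alg S\<^esub> (a \<otimes>\<^bsub>sg_alg S\<^esub> b)"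
      using ca xc by (simp add: m_assoc com) (simp add: com flip: m_assoc)
  qed (use X in \<open>auto simp: sm sg_alg_smult_mult\<close>)
qed

lemma quot_alg_hom:
  assumes S: "monoid S" and I: "ideal I (sg_alg S)"
  shows "(\<lambda>a. I +>\<^bsub>sg_alg S\<^esub> a) \<in> alg_hom (sg_alg S) (quot_alg (sg_alg S) I)"
    and "carrier (quot_alg (sg_alg S) I) = (\<lambda>a. I +>\<^bsub>sg_alg S\<^esub> a) ` carrier (sg_alg S)"
proof -
  let ?A = "sg_alg S"
  interpret ideal I ?A by (rule I)
  \<comment> \<open>Ideals are closed under ring multiplication; scalars act through the multiples
    of 1.\<close>
  have Ism: "c \<odot>\<^bsub>?A\<^esub> i \<in> I" if i: "i \<in> I" for c i
  proof -
    have iA: "i \<in> carrier ?A" using i by (rule a_Hcarr)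
    have c1: "c \<odot>\<^bsub>?A\<^esub> \<one>\<^bsub>?A\<^esub> \<in> carrier ?A"
      using one_closed by (simp only: sg_alg_ops(4) sg_alg_smult_in)
    have "c \<odot>\<^bsub>?A\<^esub> i = (c \<odot>\<^bsub>?A\<^esub> \<one>\<^bsub>?A\<^esub>) \<otimes>\<^bsub>?A\<^esub> i"
      using iA by (simp add: sg_alg_smult_mult)
    also have "\<dots> \<in> I" by (rule I_l_closed[OF i c1])
    finally show ?thesis .
  qed
  \<comment> \<open>\<open>quot_alg\<close> takes the union over all representatives of a coset; by
    \<open>Ism\<close> every one of them yields the same coset.\<close>
  have sm: "(\<Union>x\<in>I +>\<^bsub>?A\<^esub> a. I +>\<^bsub>?A\<^esub> (c \<odot>\<^bsub>?A\<^esub> x)) = I +>\<^bsub>?A\<^esub> (c \<odot>\<^bsub>?A\<^esub> a)" (is "?L = _") if a: "a \<in> carrier ?A" for a c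
  proof -
    have "I +>\<^bsub>?A\<^esub> (c \<odot>\<^bsub>?A\<^esub> x) = I +>\<^bsub>?A\<^esub> (c \<odot>\<^bsub>?A\<^esub> a)" if x: "x \<in> I +>\<^bsub>?A\<^esub> a" for x
    proof -
      obtain i where i: "i \<in> I" "x = i \<oplus>\<^bsub>?A\<^esub> a" using x by (auto simp: a_r_coset_def')
      have ca: "c \<odot>\<^bsub>?A\<^esub> a \<in> carrier ?A" using a by (simp only: sg_alg_ops(4) sg_alg_smult_in)
      have "c \<odot>\<^bsub>?A\<^esub> x = c \<odot>\<^bsub>?A\<^esub> i \<oplus>\<^bsub>?A\<^esub> c \<odot>\<^bsub>?A\<^esub> a" using i by (simp add: sg_alg_ops algebra_simps)
      then have "c \<odot>\<^bsub>?A\<^esub> x \<in> I +>\<^bsub>?A\<^esub> (c \<odot>\<^bsub>?A\<^esub> a)" using Ism[OF i(1)] by (auto simp: a_r_coset_def')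
      then show ?thesis using ca by (metis a_repr_independence a_subgroup)
    qed
    moreover have "a \<in> I +>\<^bsub>?A\<^esub> a" using a by (simp add: a_rcos_self)
    ultimately show ?thesis by blast
  qed
  show "(\<lambda>a. I +>\<^bsub>?A\<^esub> a) \<in> alg_hom ?A (quot_alg ?A I)"
    using rcos_ring_hom sm
    by (auto simp: alg_hom_def quot_alg_def ring_hom_def)
  show "carrier (quot_alg ?A I) = (\<lambda>a. I +>\<^bsub>?A\<^esub> a) ` carrier ?A"
    by (auto simp: quot_alg_def FactRing_def A_RCOSETS_def')
qed

section \<open>Submonomial matrices\<close>

text \<open>With at most one summand different from \<open>None\<close>, the undefined case of
  \<open>zadd\<close> never arises and the fold returns that summand.\<close>

lemma foldr_zadd_Some_iff:
  assumes "distinct ks" "\<And>k l. k \<in> set ks \<Longrightarrow> l \<in> set ks \<Longrightarrow> f k \<noteq> None \<Longrightarrow> f l \<noteq> None \<Longrightarrow> k = l"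
  shows "foldr zadd (map f ks) None = Some g \<longleftrightarrow> (\<exists>k\<in>set ks. f k = Some g)"
  using assms
proof (induction ks arbitrary: g)
  case (Cons k ks)
  show ?case
  proof (cases "f k")
    case None
    then show ?thesis using Cons by auto
  next
    case (Some a)
    have "f l = None" if "l \<in> set ks" for l
      using Cons.prems(1) Cons.prems(2)[of k l] that Some by fastforce
    moreover have "foldr zadd (map f ks) None = Some h \<longleftrightarrow> (\<exists>l\<in>set ks. f l = Some h)" for h
      by (rule Cons.IH) (use Cons.prems in auto)
    ultimately have "foldr zadd (map f ks) None = None"
      by (cases "foldr zadd (map f ks) None") auto
    then show ?thesis using Some \<open>\<And>l. l \<in> set ks \<Longrightarrow> f l = None\<close> by auto
  qed
qed auto

text \<open>Zero entries need no attention: it suffices that each nonzero entry of one matrix occurs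
  in the other. Together with \<open>mat_mult_Some_iff\<close> this turns matrix identities into
  statements about nonzero entries.\<close>

lemma zmat_eqI:
  assumes "\<And>i j g. A i j = Some g \<Longrightarrow> B i j = Some g" "\<And>i j g. B i j = Some g \<Longrightarrow> A i j = Some g"
  shows "A = (B :: 'g zmat)"
proof (intro ext)
  fix i j show "A i j = B i j"
    using assms[of i j] by (cases "A i j"; cases "B i j") auto
qed

lemma GbarI:
  assumes "\<And>i j g. A i j = Some g \<Longrightarrow> i \<in> {1..n} \<and> j \<in> {1..n} \<and> g \<in> carrier G"
    and "\<And>i j j' g g'. A i j = Some g \<Longrightarrow> A i j' = Some g' \<Longrightarrow> j = j'"
    and "\<And>i i' j g g'. A i j = Some g \<Longrightarrow> A i' j = Some g' \<Longrightarrow> i = i'"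
  shows "A \<in> carrier (Gbar G n)"
proof -
  have "A i j \<in> insert None (Some ` carrier G)" for i j
    using assms(1)[of i j] by (cases "A i j") auto
  then show ?thesis unfolding Gbar_def using assms by (simp, blast)
qed

lemma GbarD:
  assumes "A \<in> carrier (Gbar G n)"
  shows Gbar_rangeD: "A i j = Some g \<Longrightarrow> i \<in> {1..n} \<and> j \<in> {1..n} \<and> g \<in> carrier G"
    and Gbar_rowD: "A i j = Some g \<Longrightarrow> A i j' = Some g' \<Longrightarrow> j = j'"
    and Gbar_colD: "A i j = Some g \<Longrightarrow> A i' j = Some g' \<Longrightarrow> i = i'"
proof -
  have A: "\<forall>i j. A i j \<noteq> None \<longrightarrow> i \<in> {1..n} \<and> j \<in> {1..n}"
    "\<forall>i j. A i j \<in> insert None (Some ` carrier G)"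
    "\<forall>i j j'. A i j \<noteq> None \<and> A i j' \<noteq> None \<longrightarrow> j = j'"
    "\<forall>i i' j. A i j \<noteq> None \<and> A i' j \<noteq> None \<longrightarrow> i = i'"
    using assms by (simp_all add: Gbar_def)
  show "A i j = Some g \<Longrightarrow> i \<in> {1..n} \<and> j \<in> {1..n} \<and> g \<in> carrier G"
    using A(1)[rule_format, of i j] A(2)[rule_format, of i j] by auto
  show "A i j = Some g \<Longrightarrow> A i j' = Some g' \<Longrightarrow> j = j'"
    using A(3)[rule_format, of i j j'] by auto
  show "A i j = Some g \<Longrightarrow> A i' j = Some g' \<Longrightarrow> i = i'"
    using A(4)[rule_format, of i j i'] by auto
qed

lemma mat_carrier_simps [simp]:
  "monoid.mult (Gwr G n) = monoid.mult (Gbar G n)" "one (Gwr G n) = one (Gbar G n)"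
  "monoid.mult (Gbar_tail G m n) = monoid.mult (Gbar G n)" "one (Gbar_tail G m n) = one (Gbar G n)"
  "monoid.mult (Gwr_tail G m n) = monoid.mult (Gbar G n)" "one (Gwr_tail G m n) = one (Gbar G n)"
  by (simp_all add: Gwr_def Gbar_tail_def Gwr_tail_def)

text \<open>Row \<open>i\<close> of \<open>A\<close> contains at most one nonzero entry, so the sum
  over \<open>k\<close> has at most one nonzero term and becomes an existential.\<close>

lemma mat_mult_Some_iff:
  assumes "A \<in> carrier (Gbar G n)" "B \<in> carrier (Gbar G n)"
  shows "(A \<otimes>\<^bsub>Gbar G n\<^esub> B) i j = Some g \<longleftrightarrow>
    (\<exists>k a b. A i k = Some a \<and> B k j = Some b \<and> g = a \<otimes>\<^bsub>G\<^esub> b)"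
proof -
  have zm: "zmul G x y = Some g \<longleftrightarrow> (\<exists>a b. x = Some a \<and> y = Some b \<and> g = a \<otimes>\<^bsub>G\<^esub> b)" for x y g
    by (cases x; cases y) auto
  have "(A \<otimes>\<^bsub>Gbar G n\<^esub> B) i j = Some g \<longleftrightarrow> (\<exists>k\<in>set [1..<Suc n]. zmul G (A i k) (B k j) = Some g)"
    unfolding Gbar_def mat_mul_def monoid.simps
  proof (rule foldr_zadd_Some_iff)
    fix k l assume "zmul G (A i k) (B k j) \<noteq> None" "zmul G (A i l) (B l j) \<noteq> None"
    then show "k = l" using Gbar_rowD[OF assms(1)] zm by (metis not_None_eq)
  qed simp
  also have "\<dots> \<longleftrightarrow> (\<exists>k a b. A i k = Some a \<and> B k j = Some b \<and> g = a \<otimes>\<^bsub>G\<^esub> b)"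
    unfolding zm using Gbar_rangeD[OF assms(1)] by fastforce
  finally show ?thesis .
qed

lemma Gwr_iff:
  "A \<in> carrier (Gwr G n) \<longleftrightarrow> A \<in> carrier (Gbar G n) \<and>
     (\<forall>i\<in>{1..n}. \<exists>j g. A i j = Some g) \<and> (\<forall>j\<in>{1..n}. \<exists>i g. A i j = Some g)"
proof -
  have "(\<exists>!j. A i j \<noteq> None) \<longleftrightarrow> (\<exists>j g. A i j = Some g)"
    "(\<exists>!i'. A i' i \<noteq> None) \<longleftrightarrow> (\<exists>i' g. A i' i = Some g)" if "A \<in> carrier (Gbar G n)" for i
    using Gbar_rowD[OF that, of i] Gbar_colD[OF that, of _ i] by (auto simp: Ex1_def)
  then show ?thesis by (simp add: Gwr_def cong: conj_cong)
qed

lemma Gwr_Gbar: "A \<in> carrier (Gwr G n) \<Longrightarrow> A \<in> carrier (Gbar G n)"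
  by (simp add: Gwr_iff)

lemma Gbar_tail_iff:
  "A \<in> carrier (Gbar_tail G m n) \<longleftrightarrow> A \<in> carrier (Gbar G n) \<and> (\<forall>i\<in>{1..m}. A i i = Some \<one>\<^bsub>G\<^esub>)"
  by (simp add: Gbar_tail_def)

lemma Gwr_tail_iff:
  "A \<in> carrier (Gwr_tail G m n) \<longleftrightarrow> A \<in> carrier (Gwr G n) \<and> (\<forall>i\<in>{1..m}. A i i = Some \<one>\<^bsub>G\<^esub>)"
  by (auto simp: Gwr_tail_def Gbar_tail_iff Gwr_iff)

lemma mat_one_Some_iff: "\<one>\<^bsub>Gbar G n\<^esub> i j = Some g \<longleftrightarrow> i = j \<and> i \<in> {1..n} \<and> g = \<one>\<^bsub>G\<^esub>"
  by (auto simp: Gbar_def diag_def)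

text \<open>This is the inverse in \<open>Gwr\<close> (see \<open>Gwr_inv\<close>). The explicit
  form makes the entries of conjugates computable.\<close>

definition mat_inv :: "('g, 'c) monoid_scheme \<Rightarrow> 'g zmat \<Rightarrow> 'g zmat" where
  "mat_inv G A = (\<lambda>i j. map_option (m_inv G) (A j i))"

text \<open>For distinct \<open>k\<close> and \<open>i\<close> these matrices are the summands of
  \<open>t_elem\<close> times the transposition of \<open>k\<close> and \<open>i\<close> (see
  \<open>tau_eq\<close>). Treating each as one matrix lets conjugation act on them by moving
  positions and changing labels.\<close>

definition tau :: "('g, 'c) monoid_scheme \<Rightarrow> nat \<Rightarrow> nat \<Rightarrow> nat \<Rightarrow> 'g \<Rightarrow> 'g zmat" where
  "tau G n k i h = (\<lambda>a b. if a = k \<and> b = i then Some h else if a = i \<and> b = k then Some (inv\<^bsub>G\<^esub> h)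
     else if a = b \<and> a \<in> {1..n} \<and> a \<noteq> k \<and> a \<noteq> i then Some \<one>\<^bsub>G\<^esub> else None)"

text \<open>The index of the nonzero entry of column \<open>i\<close>; only used for columns that have one.\<close>

definition act :: "'g zmat \<Rightarrow> nat \<Rightarrow> nat" where
  "act A i = (THE j. A j i \<noteq> None)"

lemma act_eq:
  assumes "A \<in> carrier (Gbar G n)" "A j i = Some g"
  shows "act A i = j"
  unfolding act_def using assms Gbar_colD[OF assms(1)] by (intro the_equality) auto

context group
begin

lemma mat_mult_in:
  assumes "A \<in> carrier (Gbar G n)" "B \<in> carrier (Gbar G n)"
  shows "A \<otimes>\<^bsub>Gbar G n\<^esub> B \<in> carrier (Gbar G n)"
proof (rule GbarI)
  note A = GbarD[OF assms(1)] and B = GbarD[OF assms(2)] and AB = mat_mult_Some_iff[OF assms]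
  show "i \<in> {1..n} \<and> j \<in> {1..n} \<and> g \<in> carrier G" if "(A \<otimes>\<^bsub>Gbar G n\<^esub> B) i j = Some g" for i j g
    using that A(1) B(1) unfolding AB by blast
  show "j = j'" if "(A \<otimes>\<^bsub>Gbar G n\<^esub> B) i j = Some g" "(A \<otimes>\<^bsub>Gbar G n\<^esub> B) i j' = Some g'" for i j j' g g'
    using that A(2) B(2) unfolding AB by metis
  show "i = i'" if "(A \<otimes>\<^bsub>Gbar G n\<^esub> B) i j = Some g" "(A \<otimes>\<^bsub>Gbar G n\<^esub> B) i' j = Some g'" for i i' j g g'
    using that A(3) B(3) unfolding AB by metis
qed

lemma monoid_Gbar: "monoid (Gbar G n)"
proof (rule monoidI)
  show one: "\<one>\<^bsub>Gbar G n\<^esub> \<in> carrier (Gbar G n)"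
    by (rule GbarI) (auto simp: mat_one_Some_iff)
  fix x assume x: "x \<in> carrier (Gbar G n)"
  note X = Gbar_rangeD[OF x]
  show "\<one>\<^bsub>Gbar G n\<^esub> \<otimes>\<^bsub>Gbar G n\<^esub> x = x"
    by (rule zmat_eqI; force simp: mat_mult_Some_iff[OF one x] mat_one_Some_iff dest: X)
  show "x \<otimes>\<^bsub>Gbar G n\<^esub> \<one>\<^bsub>Gbar G n\<^esub> = x"
    by (rule zmat_eqI; force simp: mat_mult_Some_iff[OF x one] mat_one_Some_iff dest: X)
  fix y z assume y: "y \<in> carrier (Gbar G n)" and z: "z \<in> carrier (Gbar G n)"
  show "x \<otimes>\<^bsub>Gbar G n\<^esub> y \<otimes>\<^bsub>Gbar G n\<^esub> z = x \<otimes>\<^bsub>Gbar G n\<^esub> (y \<otimes>\<^bsub>Gbar G n\<^esub> z)"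
    by (rule zmat_eqI; clarsimp simp: mat_mult_Some_iff mat_mult_in x y z)
      (metis m_assoc X Gbar_rangeD[OF y] Gbar_rangeD[OF z])+
qed (rule mat_mult_in)

lemma mat_inv_Some_iff:
  assumes "A \<in> carrier (Gbar G n)"
  shows "mat_inv G A i j = Some g \<longleftrightarrow> g \<in> carrier G \<and> A j i = Some (inv g)"
  using Gbar_rangeD[OF assms, of j i] by (auto simp: mat_inv_def)

lemma mat_inv_in:
  assumes "A \<in> carrier (Gwr G n)"
  shows "mat_inv G A \<in> carrier (Gwr G n)"
proof -
  have A: "A \<in> carrier (Gbar G n)" using assms by (rule Gwr_Gbar)
  have "mat_inv G A \<in> carrier (Gbar G n)"
    by (rule GbarI) (auto simp: mat_inv_Some_iff[OF A] dest: Gbar_rangeD[OF A] Gbar_rowD[OF A] Gbar_colD[OF A])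
  moreover have "mat_inv G A j i = Some (inv g)" if "A i j = Some g" for i j g
    using that by (simp add: mat_inv_def)
  ultimately show ?thesis using assms unfolding Gwr_iff by metis
qed

lemma mat_inv_mult:
  assumes "A \<in> carrier (Gwr G n)"
  shows "mat_inv G A \<otimes>\<^bsub>Gbar G n\<^esub> A = \<one>\<^bsub>Gbar G n\<^esub>" "A \<otimes>\<^bsub>Gbar G n\<^esub> mat_inv G A = \<one>\<^bsub>Gbar G n\<^esub>"
proof -
  have A: "A \<in> carrier (Gbar G n)" and B: "mat_inv G A \<in> carrier (Gbar G n)"
    using assms mat_inv_in by (auto intro: Gwr_Gbar)
  have col: "\<exists>i g. A i j = Some g \<and> g \<in> carrier G" and row: "\<exists>i g. A j i = Some g \<and> g \<in> carrier G" if "j \<in> {1..n}" for j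
    using assms that Gbar_rangeD[OF A] unfolding Gwr_iff by metis+
  show "mat_inv G A \<otimes>\<^bsub>Gbar G n\<^esub> A = \<one>\<^bsub>Gbar G n\<^esub>"
  proof (rule zmat_eqI)
    fix i j g assume "(mat_inv G A \<otimes>\<^bsub>Gbar G n\<^esub> A) i j = Some g"
    then obtain k a b where k: "a \<in> carrier G" "A k i = Some (inv a)" "A k j = Some b" "g = a \<otimes> b"
      unfolding mat_mult_Some_iff[OF B A] mat_inv_Some_iff[OF A] by blast
    then have "i = j" using Gbar_rowD[OF A] by blast
    then show "\<one>\<^bsub>Gbar G n\<^esub> i j = Some g" using k Gbar_rangeD[OF A k(2)] by (auto simp: mat_one_Some_iff)
  next
    fix i j g assume "\<one>\<^bsub>Gbar G n\<^esub> i j = Some g"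
    then have ij: "j = i" "i \<in> {1..n}" "g = \<one>" by (auto simp: mat_one_Some_iff)
    then obtain k h where "A k i = Some h" "h \<in> carrier G" using col by blast
    then show "(mat_inv G A \<otimes>\<^bsub>Gbar G n\<^esub> A) i j = Some g"
      unfolding mat_mult_Some_iff[OF B A] mat_inv_Some_iff[OF A] ij
      by (intro exI[of _ k] exI[of _ "inv h"] exI[of _ h]) auto
  qed
  show "A \<otimes>\<^bsub>Gbar G n\<^esub> mat_inv G A = \<one>\<^bsub>Gbar G n\<^esub>"
  proof (rule zmat_eqI)
    fix i j g assume "(A \<otimes>\<^bsub>Gbar G n\<^esub> mat_inv G A) i j = Some g"
    then obtain k a b where k: "A i k = Some a" "b \<in> carrier G" "A j k = Some (inv b)" "g = a \<otimes> b"
      unfolding mat_mult_Some_iff[OF A B] mat_inv_Some_iff[OF A] by blast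
    then have "i = j" using Gbar_colD[OF A] by blast
    then show "\<one>\<^bsub>Gbar G n\<^esub> i j = Some g" using k Gbar_rangeD[OF A k(1)] by (auto simp: mat_one_Some_iff)
  next
    fix i j g assume "\<one>\<^bsub>Gbar G n\<^esub> i j = Some g"
    then have ij: "j = i" "i \<in> {1..n}" "g = \<one>" by (auto simp: mat_one_Some_iff)
    then obtain k h where "A i k = Some h" "h \<in> carrier G" using row by blast
    then show "(A \<otimes>\<^bsub>Gbar G n\<^esub> mat_inv G A) i j = Some g"
      unfolding mat_mult_Some_iff[OF A B] mat_inv_Some_iff[OF A] ij
      by (intro exI[of _ k] exI[of _ h] exI[of _ "inv h"]) auto
  qed
qed

lemma Gwr_mult_in:
  assumes "A \<in> carrier (Gwr G n)" "B \<in> carrier (Gwr G n)"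
  shows "A \<otimes>\<^bsub>Gbar G n\<^esub> B \<in> carrier (Gwr G n)"
proof -
  have A: "A \<in> carrier (Gbar G n)" and B: "B \<in> carrier (Gbar G n)" using assms by (auto intro: Gwr_Gbar)
  have "(\<exists>j g. (A \<otimes>\<^bsub>Gbar G n\<^esub> B) i j = Some g) \<and> (\<exists>j g. (A \<otimes>\<^bsub>Gbar G n\<^esub> B) j i = Some g)"
    if i: "i \<in> {1..n}" for i
  proof -
    obtain k a where a: "A i k = Some a" using assms(1) i unfolding Gwr_iff by blast
    obtain j b where b: "B k j = Some b" using assms(2) Gbar_rangeD[OF A a] unfolding Gwr_iff by blast
    obtain k' b' where b': "B k' i = Some b'" using assms(2) i unfolding Gwr_iff by blast
    obtain j' a' where a': "A j' k' = Some a'" using assms(1) Gbar_rangeD[OF B b'] unfolding Gwr_iff by blast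
    show ?thesis unfolding mat_mult_Some_iff[OF A B] using a b a' b' by blast
  qed
  then show ?thesis using mat_mult_in[OF A B] by (simp add: Gwr_iff)
qed

lemma Gwr_one_in: "\<one>\<^bsub>Gbar G n\<^esub> \<in> carrier (Gwr G n)"
  using monoid.one_closed[OF monoid_Gbar, of n] by (auto simp: Gwr_iff mat_one_Some_iff)

lemma group_Gwr: "group (Gwr G n)"
proof (rule groupI)
  interpret Gb: monoid "Gbar G n" by (rule monoid_Gbar)
  fix x assume x: "x \<in> carrier (Gwr G n)"
  then show "\<exists>y\<in>carrier (Gwr G n). y \<otimes>\<^bsub>Gwr G n\<^esub> x = \<one>\<^bsub>Gwr G n\<^esub>"
    using mat_inv_in[OF x] mat_inv_mult(1)[OF x] by auto
  show "\<one>\<^bsub>Gwr G n\<^esub> \<otimes>\<^bsub>Gwr G n\<^esub> x = x" using x by (simp add: Gwr_Gbar)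
  fix y z assume "y \<in> carrier (Gwr G n)" "z \<in> carrier (Gwr G n)"
  then show "x \<otimes>\<^bsub>Gwr G n\<^esub> y \<otimes>\<^bsub>Gwr G n\<^esub> z = x \<otimes>\<^bsub>Gwr G n\<^esub> (y \<otimes>\<^bsub>Gwr G n\<^esub> z)"
    using x by (simp add: Gwr_Gbar Gb.m_assoc)
qed (auto simp: Gwr_mult_in Gwr_one_in)

lemma Gwr_inv: "A \<in> carrier (Gwr G n) \<Longrightarrow> inv\<^bsub>Gwr G n\<^esub> A = mat_inv G A"
  using group.inv_equality[OF group_Gwr] mat_inv_in mat_inv_mult by auto

lemma tail_mult_in:
  assumes "A \<in> carrier (Gbar_tail G m n)" "B \<in> carrier (Gbar_tail G m n)"
  shows "A \<otimes>\<^bsub>Gbar G n\<^esub> B \<in> carrier (Gbar_tail G m n)"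
proof -
  have A: "A \<in> carrier (Gbar G n)" and B: "B \<in> carrier (Gbar G n)" using assms by (auto simp: Gbar_tail_iff)
  show ?thesis
    using assms mat_mult_in[OF A B]
    by (auto simp: Gbar_tail_iff mat_mult_Some_iff[OF A B] intro!: exI[of _ "\<one>"])
qed

lemma subgroup_Gwr_tail:
  assumes "m \<le> n"
  shows "subgroup (carrier (Gwr_tail G m n)) (Gwr G n)"
proof (rule group.subgroupI[OF group_Gwr])
  show "carrier (Gwr_tail G m n) \<subseteq> carrier (Gwr G n)" by (auto simp: Gwr_tail_iff)
  have "\<one>\<^bsub>Gbar G n\<^esub> \<in> carrier (Gwr_tail G m n)"
    using assms by (auto simp: Gwr_tail_iff Gwr_one_in mat_one_Some_iff)
  then show "carrier (Gwr_tail G m n) \<noteq> {}" by auto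
  fix a assume a: "a \<in> carrier (Gwr_tail G m n)"
  then show "inv\<^bsub>Gwr G n\<^esub> a \<in> carrier (Gwr_tail G m n)"
    by (auto simp: Gwr_tail_iff Gwr_inv mat_inv_in) (simp add: mat_inv_def)
  fix b assume "b \<in> carrier (Gwr_tail G m n)"
  then show "a \<otimes>\<^bsub>Gwr G n\<^esub> b \<in> carrier (Gwr_tail G m n)"
    using a tail_mult_in[of a m n b] by (auto simp: Gwr_tail_def Gwr_mult_in)
qed

lemma act_in:
  assumes "A \<in> carrier (Gwr G n)" "i \<in> {1..n}"
  obtains a where "a \<in> carrier G" "A (act A i) i = Some a" "act A i \<in> {1..n}"
proof -
  have A: "A \<in> carrier (Gbar G n)" using assms by (auto intro: Gwr_Gbar)
  obtain j g where "A j i = Some g" using assms unfolding Gwr_iff by blast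
  then show thesis using that act_eq[OF A] Gbar_rangeD[OF A] by blast
qed

lemma act_inj:
  assumes "A \<in> carrier (Gwr G n)" "i \<in> {1..n}" "j \<in> {1..n}" "act A i = act A j"
  shows "i = j"
  using act_in[OF assms(1,2)] act_in[OF assms(1,3)] Gbar_rowD[OF Gwr_Gbar[OF assms(1)]] assms(4) by metis

lemma act_bij:
  assumes "A \<in> carrier (Gwr G n)"
  shows "bij_betw (act A) {1..n} {1..n}"
proof -
  have "inj_on (act A) {1..n}" using act_inj[OF assms] by (intro inj_onI)
  moreover have "act A ` {1..n} \<subseteq> {1..n}" using act_in[OF assms] by (metis image_subsetI)
  ultimately show ?thesis by (simp add: bij_betw_def endo_inj_surj)
qed

section \<open>Labelled transpositions\<close>

lemma tau_in_Gwr: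
  assumes "k \<in> {1..n}" "i \<in> {1..n}" "k \<noteq> i" "h \<in> carrier G"
  shows "tau G n k i h \<in> carrier (Gwr G n)"
proof -
  have "tau G n k i h \<in> carrier (Gbar G n)"
    by (rule GbarI) (use assms in \<open>auto simp: tau_def split: if_splits\<close>)
  moreover have "\<exists>b g. tau G n k i h a b = Some g" "\<exists>b g. tau G n k i h b a = Some g" if "a \<in> {1..n}" for a
    using that assms by (cases "a = k"; cases "a = i"; force simp: tau_def)+
  ultimately show ?thesis by (simp add: Gwr_iff)
qed

text \<open>Passing \<open>x\<close> through moves the positions \<open>k\<close> and
  \<open>i\<close> to \<open>k'\<close> and \<open>j\<close>, and the label picks up one entry of
  \<open>x\<close> on each side. What enters is an entry of \<open>x\<close> in each of the columns
  \<open>k\<close> and \<open>i\<close>, so singular tail matrices are covered too.\<close>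

lemma tau_commute:
  assumes x: "x \<in> carrier (Gbar G n)" and xk: "x k' k = Some a" and xi: "x j i = Some b"
    and ki: "k \<noteq> i" and h: "h \<in> carrier G"
  shows "x \<otimes>\<^bsub>Gbar G n\<^esub> tau G n k i h = tau G n k' j (a \<otimes> h \<otimes> inv b) \<otimes>\<^bsub>Gbar G n\<^esub> x"
proof -
  note X = GbarD[OF x]
  have r: "k \<in> {1..n}" "k' \<in> {1..n}" "i \<in> {1..n}" "j \<in> {1..n}" "a \<in> carrier G" "b \<in> carrier G"
    using X(1)[OF xk] X(1)[OF xi] by auto
  have jk: "j \<noteq> k'" using X(2)[of k' k a i b] xk xi ki by auto
  have t1: "tau G n k i h \<in> carrier (Gbar G n)" and t2: "tau G n k' j (a \<otimes> h \<otimes> inv b) \<in> carrier (Gbar G n)"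
    using tau_in_Gwr r h ki jk by (auto intro!: Gwr_Gbar)
  have ih: "inv (a \<otimes> h \<otimes> inv b) \<otimes> a = b \<otimes> inv h"
    using r h by (simp add: inv_mult_group m_assoc)
  have ahb: "a \<otimes> h \<otimes> inv b \<otimes> b = a \<otimes> h" using r h by (simp add: m_assoc)
  \<comment> \<open>Both products are brought to the same description by columns: \<open>k\<close>
    and \<open>i\<close> are exchanged with new labels, every other column is that of
    \<open>x\<close>.\<close>
  have L: "(x \<otimes>\<^bsub>Gbar G n\<^esub> tau G n k i h) p q = Some g \<longleftrightarrow>
    (if q = i then p = k' \<and> g = a \<otimes> h else if q = k then p = j \<and> g = b \<otimes> inv h else x p q = Some g)" for p q g
  proof -
    consider "q = i" | "q = k" | "q \<noteq> i" "q \<noteq> k" by blast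
    then show ?thesis
    proof cases
      case 1
      have "x p k = Some c \<longleftrightarrow> p = k' \<and> c = a" for c using xk X(3)[of k' k a p c] by auto
      then show ?thesis unfolding mat_mult_Some_iff[OF x t1] using 1 ki r by (auto simp: tau_def split: if_splits)
    next
      case 2
      have "x p i = Some c \<longleftrightarrow> p = j \<and> c = b" for c using xi X(3)[of j i b p c] by auto
      then show ?thesis unfolding mat_mult_Some_iff[OF x t1] using 2 ki r by (auto simp: tau_def split: if_splits)
    next
      case 3
      then show ?thesis unfolding mat_mult_Some_iff[OF x t1]
        using X(1)[of p q] by (auto simp: tau_def split: if_splits)
    qed
  qed
  have R: "(tau G n k' j (a \<otimes> h \<otimes> inv b) \<otimes>\<^bsub>Gbar G n\<^esub> x) p q = Some g \<longleftrightarrow>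
    (if q = i then p = k' \<and> g = a \<otimes> h else if q = k then p = j \<and> g = b \<otimes> inv h else x p q = Some g)" for p q g
  proof -
    consider "q = i" | "q = k" | "q \<noteq> i" "q \<noteq> k" by blast
    then show ?thesis
    proof cases
      case 1
      have "x l q = Some c \<longleftrightarrow> l = j \<and> c = b" for l c using 1 xi X(3)[of j i b l c] by auto
      then show ?thesis unfolding mat_mult_Some_iff[OF t2 x] using 1 jk ahb by (auto simp: tau_def split: if_splits)
    next
      case 2
      have "x l q = Some c \<longleftrightarrow> l = k' \<and> c = a" for l c using 2 xk X(3)[of k' k a l c] by auto
      then show ?thesis unfolding mat_mult_Some_iff[OF t2 x] using 2 ki jk ih by (auto simp: tau_def split: if_splits)
    next
      case 3
      have ne: "l \<noteq> k' \<and> l \<noteq> j" if "x l q = Some c" for l c using that 3 X(2) xk xi by blast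
      have "tau G n k' j (a \<otimes> h \<otimes> inv b) p l = Some d \<longleftrightarrow> p = l \<and> d = \<one>" if "x l q = Some c" for l c d
        using ne[OF that] X(1)[OF that] by (auto simp: tau_def)
      then have "(\<exists>l d c. tau G n k' j (a \<otimes> h \<otimes> inv b) p l = Some d \<and> x l q = Some c \<and> g = d \<otimes> c) \<longleftrightarrow> x p q = Some g"
        using X(1) by (metis l_one)
      then show ?thesis unfolding mat_mult_Some_iff[OF t2 x] using 3 by auto
    qed
  qed
  show ?thesis by (rule zmat_eqI) (simp_all add: L R)
qed

text \<open>The two labels are mutually inverse, so the matrix is its own
  \<open>mat_inv\<close>.\<close>

lemma tau_sq:
  assumes "k \<in> {1..n}" "i \<in> {1..n}" "k \<noteq> i" "h \<in> carrier G"
  shows "tau G n k i h \<otimes>\<^bsub>Gbar G n\<^esub> tau G n k i h = \<one>\<^bsub>Gbar G n\<^esub>"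
proof -
  have t: "tau G n k i h \<in> carrier (Gwr G n)" using assms by (rule tau_in_Gwr)
  have "mat_inv G (tau G n k i h) = tau G n k i h"
    using assms by (auto simp: mat_inv_def tau_def fun_eq_iff)
  then show ?thesis using mat_inv_mult(1)[OF t] by simp
qed

lemma tau_flip:
  assumes "h \<in> carrier G" "k \<noteq> i"
  shows "tau G n k i h = tau G n i k (inv h)"
  using assms by (auto simp: tau_def fun_eq_iff)

section \<open>Diagonal and permutation matrices\<close>

lemma diag_in:
  assumes "\<And>i a. i \<in> {1..n} \<Longrightarrow> d i = Some a \<Longrightarrow> a \<in> carrier G"
  shows "diag n d \<in> carrier (Gbar G n)"
  by (rule GbarI) (use assms in \<open>auto simp: diag_def split: if_splits\<close>)

lemma diag_Some_iff: "diag n d i j = Some g \<longleftrightarrow> i = j \<and> i \<in> {1..n} \<and> d i = Some g"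
  by (auto simp: diag_def)

lemma diag_mult_left:
  assumes "diag n d \<in> carrier (Gbar G n)" "B \<in> carrier (Gbar G n)"
  shows "diag n d \<otimes>\<^bsub>Gbar G n\<^esub> B = (\<lambda>i j. zmul G (d i) (B i j))"
proof -
  have zm: "zmul G x y = Some g \<longleftrightarrow> (\<exists>a b. x = Some a \<and> y = Some b \<and> g = a \<otimes> b)" for x y g
    by (cases x; cases y) auto
  show ?thesis
    by (rule zmat_eqI)
      (auto simp: mat_mult_Some_iff[OF assms] zm diag_Some_iff dest: Gbar_rangeD[OF assms(2)])
qed

lemma diag_mult_right:
  assumes "diag n d \<in> carrier (Gbar G n)" "B \<in> carrier (Gbar G n)"
  shows "B \<otimes>\<^bsub>Gbar G n\<^esub> diag n d = (\<lambda>i j. zmul G (B i j) (d j))"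
proof -
  have zm: "zmul G x y = Some g \<longleftrightarrow> (\<exists>a b. x = Some a \<and> y = Some b \<and> g = a \<otimes> b)" for x y g
    by (cases x; cases y) auto
  show ?thesis
    by (rule zmat_eqI)
      (use Gbar_rangeD[OF assms(2)] in \<open>force simp: mat_mult_Some_iff[OF assms(2,1)] zm diag_Some_iff\<close>)+
qed

lemma single_in: "h \<in> carrier G \<Longrightarrow> single G n k h \<in> carrier (Gpow G n)"
  by (auto simp: single_def)

lemma Gpow_closed: "g \<in> carrier (Gpow G n) \<Longrightarrow> i \<in> {1..n} \<Longrightarrow> g i \<in> carrier G"
  by (auto simp: PiE_iff)

lemma tuple_mat_in: "g \<in> carrier (Gpow G n) \<Longrightarrow> tuple_mat n g \<in> carrier (Gwr G n)"
  unfolding Gwr_iff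
  by (intro conjI ballI diag_in) (auto simp: PiE_iff diag_def)

lemma tuple_mat_mult:
  assumes "g \<in> carrier (Gpow G n)" "h \<in> carrier (Gpow G n)"
  shows "tuple_mat n g \<otimes>\<^bsub>Gbar G n\<^esub> tuple_mat n h = tuple_mat n (g \<otimes>\<^bsub>Gpow G n\<^esub> h)"
  unfolding diag_mult_left[OF assms[THEN tuple_mat_in, THEN Gwr_Gbar]]
  by (auto simp: diag_def fun_eq_iff)

lemma perm_mat_in:
  assumes "\<sigma> permutes {1..n}"
  shows "perm_mat G n \<sigma> \<in> carrier (Gwr G n)"
proof -
  have "perm_mat G n \<sigma> \<in> carrier (Gbar G n)"
    by (rule GbarI) (use permutes_inj[OF assms] in \<open>auto simp: perm_mat_def inj_def split: if_splits\<close>)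
  moreover have "\<exists>j g. perm_mat G n \<sigma> i j = Some g" "\<exists>j g. perm_mat G n \<sigma> j i = Some g" if i: "i \<in> {1..n}" for i
  proof -
    obtain j where "j \<in> {1..n}" "\<sigma> j = i" using i permutes_image[OF assms] by (metis imageE)
    then have "perm_mat G n \<sigma> i j = Some \<one>" using i by (simp add: perm_mat_def)
    then show "\<exists>j g. perm_mat G n \<sigma> i j = Some g" by blast
    have "perm_mat G n \<sigma> (\<sigma> i) i = Some \<one>" using i permutes_in_image[OF assms] by (simp add: perm_mat_def)
    then show "\<exists>j g. perm_mat G n \<sigma> j i = Some g" by blast
  qed
  ultimately show ?thesis by (simp add: Gwr_iff)
qed

lemma perm_mat_Some_iff:
  "perm_mat G n \<sigma> i j = Some g \<longleftrightarrow> i \<in> {1..n} \<and> j \<in> {1..n} \<and> \<sigma> j = i \<and> g = \<one>"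
  by (auto simp: perm_mat_def)

lemma perm_mat_mult:
  assumes "\<sigma> permutes {1..n}" "\<pi> permutes {1..n}"
  shows "perm_mat G n \<sigma> \<otimes>\<^bsub>Gbar G n\<^esub> perm_mat G n \<pi> = perm_mat G n (\<sigma> \<circ> \<pi>)"
proof -
  have A: "perm_mat G n \<sigma> \<in> carrier (Gbar G n)" and B: "perm_mat G n \<pi> \<in> carrier (Gbar G n)"
    using assms by (auto intro!: Gwr_Gbar perm_mat_in)
  have "\<pi> j \<in> {1..n}" if "j \<in> {1..n}" for j using that permutes_in_image[OF assms(2)] by simp
  then show ?thesis
    by (intro zmat_eqI) (auto simp: mat_mult_Some_iff[OF A B] perm_mat_Some_iff)
qed

lemma transp_mat_in: "k \<in> {1..n} \<Longrightarrow> i \<in> {1..n} \<Longrightarrow> transp_mat G n k i \<in> carrier (Gwr G n)"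
  by (intro perm_mat_in permutes_swap_id)

lemma eps_mat_in: "eps_mat G n k \<in> carrier (Gbar G n)"
  unfolding eps_mat_def by (rule diag_in) (auto split: if_splits)

lemma tau_eq:
  assumes "k \<in> {1..n}" "i \<in> {1..n}" "k \<noteq> i" "h \<in> carrier G"
  shows "tuple_mat n (single G n k h) \<otimes>\<^bsub>Gbar G n\<^esub> tuple_mat n (single G n i (inv h))
    \<otimes>\<^bsub>Gbar G n\<^esub> transp_mat G n k i = tau G n k i h"
proof -
  let ?p = "single G n k h \<otimes>\<^bsub>Gpow G n\<^esub> single G n i (inv h)"
  have s: "single G n k h \<in> carrier (Gpow G n)" "single G n i (inv h) \<in> carrier (Gpow G n)"
    using single_in[OF assms(4)] single_in[OF inv_closed[OF assms(4)]] by blast+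
  have pa: "?p a = (if a = k then h else if a = i then inv h else \<one>)" if "a \<in> {1..n}" for a
    using that assms by (auto simp: single_def)
  have p: "?p \<in> carrier (Gpow G n)"
    using pa assms by (auto simp: PiE_iff)
  have "(tuple_mat n ?p \<otimes>\<^bsub>Gbar G n\<^esub> transp_mat G n k i) a b = tau G n k i h a b" for a b
  proof -
    have "(tuple_mat n ?p \<otimes>\<^bsub>Gbar G n\<^esub> transp_mat G n k i) a b = zmul G (Some (?p a)) (transp_mat G n k i a b)"
      by (simp only: diag_mult_left[OF tuple_mat_in[OF p, THEN Gwr_Gbar] transp_mat_in[OF assms(1,2), THEN Gwr_Gbar]])
    also have "\<dots> = tau G n k i h a b"
    proof (cases "a \<in> {1..n} \<and> b \<in> {1..n} \<and> transpose k i b = a")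
      case True
      then have "zmul G (Some (?p a)) (transp_mat G n k i a b) = Some (?p a \<otimes> \<one>)" by (simp add: perm_mat_def)
      also have "\<dots> = tau G n k i h a b"
        using True assms unfolding pa[OF conjunct1[OF True]] by (auto simp: tau_def transpose_def split: if_splits)
      finally show ?thesis .
    next
      case False
      then have "tau G n k i h a b = None" using assms by (auto simp: tau_def transpose_def split: if_splits)
      then show ?thesis using False by (auto simp: perm_mat_def)
    qed
    finally show ?thesis .
  qed
  then show ?thesis unfolding tuple_mat_mult[OF s] by blast
qed

section \<open>Multiplication by the idempotents \<open>eps_mat\<close>\<close>

lemma eps_mult:
  assumes "x \<in> carrier (Gbar G n)"
  shows "eps_mat G n k \<otimes>\<^bsub>Gbar G n\<^esub> x = (\<lambda>i j. if i = k then None else x i j)"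
    and "x \<otimes>\<^bsub>Gbar G n\<^esub> eps_mat G n k = (\<lambda>i j. if j = k then None else x i j)"
proof -
  have e: "diag n (\<lambda>i. if i = k then None else Some \<one>) \<in> carrier (Gbar G n)"
    using eps_mat_in by (simp add: eps_mat_def)
  have *: "zmul G (x p q) (Some \<one>) = x p q" "zmul G (Some \<one>) (x p q) = x p q" "zmul G (x p q) None = None" for p q
    using Gbar_rangeD[OF assms, of p q] by (cases "x p q"; simp)+
  show "eps_mat G n k \<otimes>\<^bsub>Gbar G n\<^esub> x = (\<lambda>i j. if i = k then None else x i j)"
    unfolding eps_mat_def diag_mult_left[OF e assms(1)] by (auto simp: fun_eq_iff *)
  show "x \<otimes>\<^bsub>Gbar G n\<^esub> eps_mat G n k = (\<lambda>i j. if j = k then None else x i j)"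
    unfolding eps_mat_def diag_mult_right[OF e assms(1)] by (auto simp: fun_eq_iff *)
qed

text \<open>The left side deletes column \<open>i\<close> and the right side row \<open>j\<close>;
  in \<open>x\<close> the only nonzero entry of either is the one at \<open>(j, i)\<close>.\<close>

lemma eps_commute:
  assumes "x \<in> carrier (Gbar G n)" "x j i = Some b"
  shows "x \<otimes>\<^bsub>Gbar G n\<^esub> eps_mat G n i = eps_mat G n j \<otimes>\<^bsub>Gbar G n\<^esub> x"
proof (rule zmat_eqI)
  fix p q g
  note X = Gbar_rowD[OF assms(1), of p q g] Gbar_colD[OF assms(1), of p q g]
  show "(x \<otimes>\<^bsub>Gbar G n\<^esub> eps_mat G n i) p q = Some g \<Longrightarrow> (eps_mat G n j \<otimes>\<^bsub>Gbar G n\<^esub> x) p q = Some g"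
    "(eps_mat G n j \<otimes>\<^bsub>Gbar G n\<^esub> x) p q = Some g \<Longrightarrow> (x \<otimes>\<^bsub>Gbar G n\<^esub> eps_mat G n i) p q = Some g"
    using X[of i b] X(2)[of j b] assms(2) unfolding eps_mult[OF assms(1)] by (auto split: if_splits)
qed

lemma eps_absorb:
  assumes "x \<in> carrier (Gbar G n)"
  shows "(\<And>j. x j i = None) \<Longrightarrow> x \<otimes>\<^bsub>Gbar G n\<^esub> eps_mat G n i = x"
    "(\<And>j. x i j = None) \<Longrightarrow> eps_mat G n i \<otimes>\<^bsub>Gbar G n\<^esub> x = x"
  unfolding eps_mult[OF assms] by (auto simp: fun_eq_iff)

section \<open>Embeddings and corners\<close>

lemma embed_Some_iff:
  "embed_mat G m n A i j = Some g \<longleftrightarrow>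
     (i \<in> {1..m} \<and> j \<in> {1..m} \<and> A i j = Some g) \<or> (i = j \<and> i \<in> {m+1..n} \<and> g = \<one>)"
  by (auto simp: embed_mat_def)

lemma embed_in:
  assumes "A \<in> carrier (Gbar G m)" "m \<le> n"
  shows "embed_mat G m n A \<in> carrier (Gbar G n)"
proof (rule GbarI)
  note A = GbarD[OF assms(1)]
  fix i j g assume 1: "embed_mat G m n A i j = Some g"
  then show "i \<in> {1..n} \<and> j \<in> {1..n} \<and> g \<in> carrier G" using A(1)[of i j g] assms(2) by (auto simp: embed_Some_iff)
  show "j = j'" if "embed_mat G m n A i j' = Some g'" for j' g'
    using 1 that A(2)[of i j g j' g'] by (auto simp: embed_Some_iff)
  show "i = i'" if "embed_mat G m n A i' j = Some g'" for i' g'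
    using 1 that A(3)[of i j g i' g'] by (auto simp: embed_Some_iff)
qed

lemma embed_in_Gwr:
  assumes "A \<in> carrier (Gwr G m)" "m \<le> n"
  shows "embed_mat G m n A \<in> carrier (Gwr G n)"
proof -
  have A: "A \<in> carrier (Gbar G m)" using assms by (auto intro: Gwr_Gbar)
  have "\<exists>j g. embed_mat G m n A i j = Some g" "\<exists>j g. embed_mat G m n A j i = Some g" if "i \<in> {1..n}" for i
  proof -
    have "(\<exists>j g. embed_mat G m n A i j = Some g) \<and> (\<exists>j g. embed_mat G m n A j i = Some g)"
    proof (cases "i \<le> m")
      case True
      then obtain j g j' g' where "A i j = Some g" "A j' i = Some g'"
        using assms(1) \<open>i \<in> {1..n}\<close> unfolding Gwr_iff by (metis atLeastAtMost_iff)
      then show ?thesis using Gbar_rangeD[OF A] unfolding embed_Some_iff by metis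
    next
      case False
      then show ?thesis using that unfolding embed_Some_iff by fastforce
    qed
    then show "\<exists>j g. embed_mat G m n A i j = Some g" "\<exists>j g. embed_mat G m n A j i = Some g" by auto
  qed
  then show ?thesis using embed_in[OF A assms(2)] by (simp add: Gwr_iff)
qed

lemma embed_mult:
  assumes "A \<in> carrier (Gbar G m)" "B \<in> carrier (Gbar G m)" "m \<le> n"
  shows "embed_mat G m n (A \<otimes>\<^bsub>Gbar G m\<^esub> B) = embed_mat G m n A \<otimes>\<^bsub>Gbar G n\<^esub> embed_mat G m n B"
proof -
  note e = embed_in[OF assms(1,3)] embed_in[OF assms(2,3)]
  show ?thesis
    using Gbar_rangeD[OF assms(1)]
    by (intro zmat_eqI) (auto simp: embed_Some_iff mat_mult_Some_iff[OF e] mat_mult_Some_iff[OF assms(1,2)], blast)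
qed

lemma embed_one: "m \<le> n \<Longrightarrow> embed_mat G m n \<one>\<^bsub>Gbar G m\<^esub> = \<one>\<^bsub>Gbar G n\<^esub>"
  by (rule zmat_eqI) (auto simp: embed_Some_iff mat_one_Some_iff)

lemma embed_perm_mat:
  assumes "\<sigma> permutes {1..m}" "m \<le> n"
  shows "embed_mat G m n (perm_mat G m \<sigma>) = perm_mat G n \<sigma>"
proof -
  have "\<sigma> j \<in> {1..m} \<longleftrightarrow> j \<in> {1..m}" "j \<notin> {1..m} \<Longrightarrow> \<sigma> j = j" for j
    using permutes_in_image[OF assms(1)] permutes_not_in[OF assms(1)] by auto
  then have "embed_mat G m n (perm_mat G m \<sigma>) i j = perm_mat G n \<sigma> i j" for i j
    by (cases "j \<in> {1..m}") (use assms(2) in \<open>auto simp: embed_mat_def perm_mat_def\<close>)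
  then show ?thesis by blast
qed

text \<open>A diagonal entry 1 forces the rest of its row and column to vanish, so \<open>x\<close>
  is the identity on the first \<open>m\<close> indices, while the embedded matrix is the identity
  on the others.\<close>

lemma embed_commute_tail:
  assumes A: "A \<in> carrier (Gbar G m)" and "m \<le> n" and x: "x \<in> carrier (Gbar_tail G m n)"
  shows "embed_mat G m n A \<otimes>\<^bsub>Gbar G n\<^esub> x = x \<otimes>\<^bsub>Gbar G n\<^esub> embed_mat G m n A"
proof -
  have x1: "x i i = Some \<one>" if "i \<in> {1..m}" for i
    using x that by (simp add: Gbar_tail_iff)
  have xG: "x \<in> carrier (Gbar G n)" using x by (simp add: Gbar_tail_iff)
  note e = embed_in[OF A \<open>m \<le> n\<close>] and X = GbarD[OF xG] and AA = Gbar_rangeD[OF A]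
  have xs: "x i j = Some g \<longleftrightarrow> j = i \<and> g = \<one>" "x j i = Some g \<longleftrightarrow> j = i \<and> g = \<one>" if "i \<in> {1..m}" for i j g
    using x1[OF that] X(2)[of i i \<one> j g] X(3)[of i i \<one> j g] by auto
  have L: "(embed_mat G m n A \<otimes>\<^bsub>Gbar G n\<^esub> x) i j = Some g \<longleftrightarrow>
      (if i \<in> {1..m} then A i j = Some g else x i j = Some g)" for i j g
  proof (cases "i \<in> {1..m}")
    case True
    then have "embed_mat G m n A i k = Some a \<and> x k j = Some b \<and> g = a \<otimes> b \<longleftrightarrow>
        A i j = Some g \<and> k = j \<and> a = g \<and> b = \<one>" for k a b
      using xs(1)[of k j b] AA[of i k a] by (auto simp: embed_Some_iff)
    then show ?thesis using True unfolding mat_mult_Some_iff[OF e xG] by simp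
  next
    case False
    then have "embed_mat G m n A i k = Some a \<longleftrightarrow> k = i \<and> a = \<one> \<and> i \<in> {m+1..n}" for k a
      by (auto simp: embed_Some_iff)
    then show ?thesis using False X(1)[of i j] unfolding mat_mult_Some_iff[OF e xG] by force
  qed
  have R: "(x \<otimes>\<^bsub>Gbar G n\<^esub> embed_mat G m n A) i j = Some g \<longleftrightarrow>
      (if j \<in> {1..m} then A i j = Some g else x i j = Some g)" for i j g
  proof (cases "j \<in> {1..m}")
    case True
    then have "x i k = Some b \<and> embed_mat G m n A k j = Some a \<and> g = b \<otimes> a \<longleftrightarrow>
        A i j = Some g \<and> k = i \<and> a = g \<and> b = \<one>" for k a b
      using xs(2)[of k i b] AA[of k j a] by (auto simp: embed_Some_iff)
    then show ?thesis using True unfolding mat_mult_Some_iff[OF xG e] by simp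
  next
    case False
    then have "embed_mat G m n A k j = Some a \<longleftrightarrow> k = j \<and> a = \<one> \<and> j \<in> {m+1..n}" for k a
      by (auto simp: embed_Some_iff)
    then show ?thesis using False X(1)[of i j] unfolding mat_mult_Some_iff[OF xG e] by force
  qed
  have "(if i \<in> {1..m} then A i j = Some g else x i j = Some g) \<longleftrightarrow>
     (if j \<in> {1..m} then A i j = Some g else x i j = Some g)" for i j g
    using xs[of i j g] xs[of j i g] AA[of i j g] by auto
  then have "(embed_mat G m n A \<otimes>\<^bsub>Gbar G n\<^esub> x) i j = Some g \<longleftrightarrow> (x \<otimes>\<^bsub>Gbar G n\<^esub> embed_mat G m n A) i j = Some g" for i j g
    unfolding L R .
  then show ?thesis by (intro zmat_eqI) simp_all
qed

lemma corner_Some_iff: "corner k A i j = Some g \<longleftrightarrow> i \<in> {1..k} \<and> j \<in> {1..k} \<and> A i j = Some g"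
  by (auto simp: corner_def)

lemma corner_in: "A \<in> carrier (Gbar G n) \<Longrightarrow> corner k A \<in> carrier (Gbar G k)"
  by (rule GbarI) (auto simp: corner_Some_iff dest: GbarD)

lemma corner_eps:
  assumes "A \<in> carrier (Gbar G n)" "k < n"
  shows "corner k (eps_mat G n n \<otimes>\<^bsub>Gbar G n\<^esub> A) = corner k A"
    "corner k (A \<otimes>\<^bsub>Gbar G n\<^esub> eps_mat G n n) = corner k A"
  using assms(2) unfolding eps_mult[OF assms(1)] corner_def by (auto simp: fun_eq_iff)

text \<open>A product of corners misses the terms of the full product that pass through index
  \<open>n\<close>; these are what the inserted \<open>eps_mat G n n\<close> removes.\<close>

lemma corner_mult:
  assumes A: "A \<in> carrier (Gbar G n)" and B: "B \<in> carrier (Gbar G n)" and n: "1 \<le> n"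
  shows "corner (n - 1) (A \<otimes>\<^bsub>Gbar G n\<^esub> (eps_mat G n n \<otimes>\<^bsub>Gbar G n\<^esub> B))
     = corner (n - 1) A \<otimes>\<^bsub>Gbar G (n - 1)\<^esub> corner (n - 1) B"
proof -
  note eB = mat_mult_in[OF eps_mat_in[of n n] B]
  have e: "(eps_mat G n n \<otimes>\<^bsub>Gbar G n\<^esub> B) i j = Some g \<longleftrightarrow> i \<in> {1..n-1} \<and> B i j = Some g" for i j g
    using Gbar_rangeD[OF B, of i j g] unfolding eps_mult[OF B] by auto
  show ?thesis
    by (rule zmat_eqI)
      (auto simp: corner_Some_iff mat_mult_Some_iff[OF A eB] e mat_mult_Some_iff[OF corner_in[OF A] corner_in[OF B]])
qed

lemma corner_embed:
  assumes "m < n" "A \<in> carrier (Gbar G m)"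
  shows "corner (n - 1) (embed_mat G m n A) = embed_mat G m (n - 1) A"
  using assms by (intro zmat_eqI) (auto simp: corner_Some_iff embed_Some_iff)

end

declare One_nat_def [simp del] carrier_product_group [simp del]

section \<open>The homomorphism from the wreath Hecke algebra\<close>

text \<open>With \<open>I\<close> equal to \<open>{k+1..n}\<close> this is the image of the
  generator \<open>x\<^sub>k\<close> (see \<open>Tsum_eq\<close>). Other sets \<open>I\<close> arise
  because conjugation replaces \<open>I\<close> by its image. Pairs serve as summation index so that
  one bijection can change position and label together.\<close>

definition Tsum :: "('g, 'c) monoid_scheme \<Rightarrow> nat \<Rightarrow> nat \<Rightarrow> nat set \<Rightarrow> 'g zmat \<Rightarrow> 'f::field" where
  "Tsum G n k I = (\<lambda>z. \<Sum>p\<in>I \<times> carrier G. basis (tau G n k (fst p) (snd p)) z)"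

text \<open>With all operations normalised to those of \<open>FGbar\<close>, elements of the
  different algebras can be compared directly.\<close>

lemma FG_simps [simp]:
  "monoid.mult (FGwr G n) = monoid.mult (FGbar G n)" "one (FGwr G n) = one (FGbar G n)"
  "add (FGwr G n) = add (FGbar G n)" "zero (FGwr G n) = zero (FGbar G n)"
  "smult (FGwr G n) = smult (FGbar G n)"
  "monoid.mult (Zwr G m n) = monoid.mult (FGbar G n)" "one (Zwr G m n) = one (FGbar G n)"
  "add (Zwr G m n) = add (FGbar G n)" "zero (Zwr G m n) = zero (FGbar G n)"
  "smult (Zwr G m n) = smult (FGbar G n)"
  "monoid.mult (Zbar G m n) = monoid.mult (FGbar G n)" "one (Zbar G m n) = one (FGbar G n)"
  "add (Zbar G m n) = add (FGbar G n)" "zero (Zbar G m n) = zero (FGbar G n)"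
  "smult (Zbar G m n) = smult (FGbar G n)"
  by (simp_all add: Zwr_def Zbar_def sg_alg_def)

lemma alg_hom_comp:
  assumes "f \<in> alg_hom A B" "g \<in> alg_hom B C"
  shows "(\<lambda>a. g (f a)) \<in> alg_hom A C"
  using alg_homD[OF assms(1)] alg_homD[OF assms(2)] by (auto simp: alg_hom_def ring_hom_def)

lemma sg_alg_carrier_update [simp]: "(sg_alg S)\<lparr>carrier := carrier (sg_alg S)\<rparr> = sg_alg S"
  by (simp add: sg_alg_def)

lemma sg_alg_subset_subalg:
  fixes B :: "('a \<Rightarrow> 'f::field) set"
  assumes "subalg (sg_alg S) B" "\<And>x. x \<in> carrier S \<Longrightarrow> basis x \<in> B"
  shows "carrier (sg_alg S) \<subseteq> B"
proof
  fix a :: "'a \<Rightarrow> 'f" assume "a \<in> carrier (sg_alg S)"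
  then show "a \<in> B"
  proof (induction a rule: sg_alg_induct)
    case zero
    \<comment> \<open>\<open>subalg\<close> does not list the zero vector; it is \<open>0\<close>
      times the unit.\<close>
    have "0 \<odot>\<^bsub>sg_alg S\<^esub> \<one>\<^bsub>sg_alg S\<^esub> \<in> B" using assms(1) by (auto simp: subalg_def)
    then show ?case by (simp add: sg_alg_ops)
  qed (use assms in \<open>auto simp: subalg_def sg_alg_ops\<close>)
qed

section \<open>Homomorphisms from free algebras\<close>

lemma monoid_free_monoid: "monoid (free_monoid X)"
  by (rule monoidI) (auto simp: free_monoid_def)

lemma free_alg_hom_eq:
  fixes a :: "'a list \<Rightarrow> 'f::field"
  assumes F: "F \<in> alg_hom (sg_alg (free_monoid X)) C" and H: "H \<in> alg_hom (sg_alg (free_monoid X)) C"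
    and eq: "\<And>x. x \<in> X \<Longrightarrow> F (basis [x]) = H (basis [x])"
    and a: "a \<in> carrier (sg_alg (free_monoid X))"
  shows "F a = H a"
proof -
  let ?A = "sg_alg (free_monoid X) :: ('f, 'a list \<Rightarrow> 'f) module"
  let ?B = "{a \<in> carrier ?A. F a = H a}"
  have B: "subalg ?A ?B"
    by (rule subalg_equalizer) (use F H sg_alg_subalg[OF monoid_free_monoid] in auto)
  have "basis w \<in> ?B" if "w \<in> carrier (free_monoid X)" for w
    using that
  proof (induction w)
    case Nil
    have "(basis [] :: 'a list \<Rightarrow> 'f) = \<one>\<^bsub>?A\<^esub>" by (simp add: sg_alg_ops free_monoid_def)
    moreover have "\<one>\<^bsub>?A\<^esub> \<in> ?B" using B unfolding subalg_def by blast
    ultimately show ?case by argo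
  next
    case (Cons x w)
    then have x: "x \<in> X" and w: "w \<in> carrier (free_monoid X)" by (auto simp: free_monoid_def)
    have "(basis (x # w) :: 'a list \<Rightarrow> 'f) = basis [x] \<otimes>\<^bsub>?A\<^esub> basis w" by (simp add: basis_mult free_monoid_def)
    moreover have "basis [x] \<in> ?B" using x eq[OF x] by (simp) (simp add: free_monoid_def)
    moreover have "basis [x] \<otimes>\<^bsub>?A\<^esub> basis w \<in> ?B"
      using B Cons.IH[OF w] \<open>basis [x] \<in> ?B\<close> unfolding subalg_def by blast
    ultimately show ?case by argo
  qed
  then show ?thesis using sg_alg_subset_subalg[OF B] a by blast
qed

lemma hecke_free_basis_in:
  "basis [GenG g] \<in> carrier (hecke_free G m) \<longleftrightarrow> g \<in> carrier (Gpow G m)"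
  "basis [GenS k] \<in> carrier (hecke_free G m) \<longleftrightarrow> k \<in> {1..<m}"
  "basis [GenX k] \<in> carrier (hecke_free G m) \<longleftrightarrow> k \<in> {1..m}"
  unfolding hecke_free_def basis_in by (auto simp: free_monoid_def)

lemma ring_hecke_free: "ring (hecke_free G m :: ('f::field, _) module)"
  unfolding hecke_free_def by (intro sg_alg_ring monoid_free_monoid)

context group
begin

lemma monoid_Gwr: "monoid (Gwr G n)"
  using group_Gwr by (simp add: group_def)

lemma Tsum_in:
  assumes "k \<in> {1..n}" "I \<subseteq> {1..n} - {k}"
  shows "(Tsum G n k I :: 'a zmat \<Rightarrow> 'f::field) \<in> carrier (FGwr G n)"
  unfolding Tsum_def using assms by (intro sg_alg_sum_in) (auto intro!: tau_in_Gwr)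

lemma FGwr_FGbar: "a \<in> carrier (FGwr G n) \<Longrightarrow> a \<in> carrier (FGbar G n)"
  by (auto simp: sg_alg_carrier Gwr_Gbar)

lemma Tsum_commute:
  assumes x: "x \<in> carrier (Gwr G n)" and xk: "x k' k = Some a" and I: "I \<subseteq> {1..n} - {k}"
  shows "(basis x :: 'a zmat \<Rightarrow> 'f::field) \<otimes>\<^bsub>FGbar G n\<^esub> Tsum G n k I = Tsum G n k' (act x ` I) \<otimes>\<^bsub>FGbar G n\<^esub> basis x"
proof
  fix z
  have xG: "x \<in> carrier (Gbar G n)" using x by (rule Gwr_Gbar)
  have a: "a \<in> carrier G" using Gbar_rangeD[OF xG xk] by simp
  define lab where "lab i = the (x (act x i) i)" for i
  have "x (act x i) i = Some (lab i) \<and> lab i \<in> carrier G" if "i \<in> I" for i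
  proof -
    have "i \<in> {1..n}" using that I by auto
    then obtain a where "a \<in> carrier G" "x (act x i) i = Some a" using act_in[OF x] by metis
    then show ?thesis by (simp add: lab_def)
  qed
  then have lab: "x (act x i) i = Some (lab i)" "lab i \<in> carrier G" if "i \<in> I" for i
    using that by auto
  \<comment> \<open>\<open>f\<close> is the effect of conjugation by \<open>x\<close> on the pair of
    position and label. It is bijective since \<open>x\<close> permutes positions and, at each
    position, labels are multiplied by fixed group elements on both sides.\<close>
  define f where "f p = (act x (fst p), a \<otimes> snd p \<otimes> inv (lab (fst p)))" for p
  have bij: "bij_betw f (I \<times> carrier G) (act x ` I \<times> carrier G)"
    unfolding bij_betw_def
  proof (intro conjI inj_onI equalityI subsetI)
    fix p q assume p: "p \<in> I \<times> carrier G" and q: "q \<in> I \<times> carrier G" and e: "f p = f q"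
    have "act x (fst p) = act x (fst q)" using e by (simp add: f_def)
    then have 1: "fst p = fst q" using act_inj[OF x] p q I by (metis DiffE SigmaE fst_conv subset_eq)
    then have "a \<otimes> snd p = a \<otimes> snd q" using e lab(2)[of "fst q"] p q a by (auto simp: f_def)
    then show "p = q" using 1 p q a by (auto simp: prod_eq_iff)
  next
    fix q assume "q \<in> f ` (I \<times> carrier G)"
    then obtain i h where i: "i \<in> I" "h \<in> carrier G" "q = f (i, h)" by auto
    then show "q \<in> act x ` I \<times> carrier G" using a lab(2)[OF i(1)] by (auto simp: f_def)
  next
    fix q assume q: "q \<in> act x ` I \<times> carrier G"
    then obtain i h where i: "i \<in> I" "q = (act x i, h)" "h \<in> carrier G" by auto
    \<comment> \<open>The label is found by solving \<open>a h' inv (lab i) = h\<close> for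
      \<open>h'\<close>.\<close>
    have "q = f (i, inv a \<otimes> h \<otimes> lab i)"
      using i a lab(2)[OF i(1)] by (simp add: f_def m_assoc) (simp flip: m_assoc)
    then show "q \<in> f ` (I \<times> carrier G)" using i a lab(2)[OF i(1)] by (intro image_eqI[of _ _ "(i, inv a \<otimes> h \<otimes> lab i)"]) auto
  qed
  have "(basis x \<otimes>\<^bsub>FGbar G n\<^esub> Tsum G n k I) z =
      (\<Sum>p\<in>I \<times> carrier G. basis (x \<otimes>\<^bsub>Gbar G n\<^esub> tau G n k (fst p) (snd p)) z)"
    unfolding Tsum_def by (simp add: sg_alg_mult_sum basis_mult)
  also have "\<dots> = (\<Sum>p\<in>I \<times> carrier G. basis (tau G n k' (fst (f p)) (snd (f p)) \<otimes>\<^bsub>Gbar G n\<^esub> x) z)"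
  proof (rule sum.cong[OF refl])
    fix p assume p: "p \<in> I \<times> carrier G"
    then have "k \<noteq> fst p" using I by auto
    with p show "basis (x \<otimes>\<^bsub>Gbar G n\<^esub> tau G n k (fst p) (snd p)) z =
        basis (tau G n k' (fst (f p)) (snd (f p)) \<otimes>\<^bsub>Gbar G n\<^esub> x) z"
      using tau_commute[OF xG xk lab(1)[of "fst p"], of "snd p"] I by (auto simp: f_def)
  qed
  also have "\<dots> = (\<Sum>p\<in>act x ` I \<times> carrier G. basis (tau G n k' (fst p) (snd p) \<otimes>\<^bsub>Gbar G n\<^esub> x) z)"
    by (rule sum.reindex_bij_betw[OF bij])
  also have "\<dots> = (Tsum G n k' (act x ` I) \<otimes>\<^bsub>FGbar G n\<^esub> basis x) z"
    unfolding Tsum_def by (simp add: sg_alg_sum_mult basis_mult)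
  finally show "(basis x \<otimes>\<^bsub>FGbar G n\<^esub> Tsum G n k I) z = (Tsum G n k' (act x ` I) \<otimes>\<^bsub>FGbar G n\<^esub> basis x) z" .
qed

text \<open>An injective map that fixes \<open>1, ..., k\<close> sends no later index among them, so
  it maps the tail into itself and, the tail being finite, onto itself.\<close>

lemma act_image_tail:
  assumes x: "x \<in> carrier (Gwr G n)" and k: "k \<le> n" and fix1: "\<And>j. j \<in> {1..k} \<Longrightarrow> act x j = j"
  shows "act x ` {k+1..n} = {k+1..n}"
proof (rule endo_inj_surj)
  show "inj_on (act x) {k+1..n}" using act_inj[OF x] by (intro inj_onI) auto
  show "act x ` {k+1..n} \<subseteq> {k+1..n}"
  proof
    fix j assume "j \<in> act x ` {k+1..n}"
    then obtain i where i: "i \<in> {k+1..n}" "j = act x i" by blast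
    then have ij: "i \<in> {1..n}" by simp
    then have j: "j \<in> {1..n}" using act_in[OF x ij] i by metis
    have "j \<notin> {1..k}" using fix1[of j] act_inj[OF x ij j] i by auto
    then show "j \<in> {k+1..n}" using j by auto
  qed
qed simp

text \<open>As l \<le> k, a matrix of this tail group fixes \<open>l\<close> and permutes the
  summation range, so \<open>Tsum_commute\<close> returns the same sum.\<close>

lemma Tsum_commute_tail:
  assumes x: "x \<in> carrier (Gwr_tail G k n)" and k: "l \<in> {1..k}" "k \<le> n"
  shows "(basis x :: 'a zmat \<Rightarrow> 'f::field) \<otimes>\<^bsub>FGbar G n\<^esub> Tsum G n l {l+1..n} = Tsum G n l {l+1..n} \<otimes>\<^bsub>FGbar G n\<^esub> basis x"
proof -
  have xw: "x \<in> carrier (Gwr G n)" and x1: "\<And>i. i \<in> {1..k} \<Longrightarrow> x i i = Some \<one>"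
    using x by (auto simp: Gwr_tail_iff)
  have "act x ` {l+1..n} = {l+1..n}"
    by (rule act_image_tail[OF xw]) (use k x1 act_eq[OF Gwr_Gbar[OF xw]] in auto)
  moreover have "{l+1..n} \<subseteq> {1..n} - {l}" by auto
  ultimately show ?thesis using Tsum_commute[OF xw x1[OF k(1)], of "{l+1..n}"] by simp
qed

lemma t_elem_tau:
  assumes "k \<in> {1..n}" "i \<in> {1..n}" "k \<noteq> i"
  shows "t_elem G n (FGbar G n) (\<lambda>g. basis (tuple_mat n g)) k i \<otimes>\<^bsub>FGbar G n\<^esub> basis (transp_mat G n k i)
    = (\<lambda>z. \<Sum>h\<in>carrier G. basis (tau G n k i h) z :: 'f::field)"
proof -
  have "t_elem G n (FGbar G n :: ('f, _) module) (\<lambda>g. basis (tuple_mat n g)) k i =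
     (\<lambda>z. \<Sum>h\<in>carrier G. basis (tuple_mat n (single G n k h) \<otimes>\<^bsub>Gbar G n\<^esub> tuple_mat n (single G n i (inv h))) z)"
    unfolding t_elem_def basis_mult
    by (intro sg_alg_finsum monoid_Gbar)
      (auto intro!: mat_mult_in Gwr_Gbar[OF tuple_mat_in] single_in)
  then have "t_elem G n (FGbar G n) (\<lambda>g. basis (tuple_mat n g)) k i \<otimes>\<^bsub>FGbar G n\<^esub> (basis (transp_mat G n k i) :: 'a zmat \<Rightarrow> 'f) =
     (\<lambda>z. \<Sum>h\<in>carrier G. basis (tuple_mat n (single G n k h) \<otimes>\<^bsub>Gbar G n\<^esub> tuple_mat n (single G n i (inv h))
        \<otimes>\<^bsub>Gbar G n\<^esub> transp_mat G n k i) z)"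
    by (simp only: sg_alg_sum_mult fin_supp_basis basis_mult)
  then show ?thesis using tau_eq[OF assms] by simp
qed

lemma single_mat_in: "h \<in> carrier G \<Longrightarrow> tuple_mat n (single G n k h) \<in> carrier (Gwr G n)"
  by (intro tuple_mat_in single_in)

lemma t_elem_FGwr:
  "t_elem G n (FGwr G n) (\<lambda>g. basis (tuple_mat n g)) k i = t_elem G n (FGbar G n) (\<lambda>g. basis (tuple_mat n g)) k i"
proof -
  have "tuple_mat n (single G n k h) \<otimes>\<^bsub>Gbar G n\<^esub> tuple_mat n (single G n i (inv h)) \<in> carrier (Gwr G n)"
    if "h \<in> carrier G" for h
    using that by (intro Gwr_mult_in single_mat_in inv_closed)
  then show ?thesis
    unfolding t_elem_def FG_simps basis_mult
    by (subst (1 2) sg_alg_finsum) (auto simp: monoid_Gwr monoid_Gbar Gwr_Gbar)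
qed

lemma Tsum_eq:
  assumes "k \<in> {1..n}"
  shows "(\<Oplus>\<^bsub>FGwr G n\<^esub> i \<in> {k+1..n}.
           t_elem G n (FGwr G n) (\<lambda>g. basis (tuple_mat n g)) k i
             \<otimes>\<^bsub>FGwr G n\<^esub> basis (transp_mat G n k i)) = (Tsum G n k {k+1..n} :: 'a zmat \<Rightarrow> 'f::field)" (is "finsum _ ?f _ = _")
proof -
  have f: "?f i = (\<lambda>z. \<Sum>h\<in>carrier G. basis (tau G n k i h) z)" if "i \<in> {k+1..n}" for i
    using that assms t_elem_tau[of k n i, where 'f = 'f] by (simp add: t_elem_FGwr)
  have "?f i \<in> carrier (FGwr G n)" if "i \<in> {k+1..n}" for i
    unfolding f[OF that] using that assms by (intro sg_alg_sum_in) (auto intro!: tau_in_Gwr)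
  then have "finsum (FGwr G n) ?f {k+1..n} = (\<lambda>z. \<Sum>i\<in>{k+1..n}. ?f i z)"
    by (rule sg_alg_finsum[OF monoid_Gwr])
  also have "\<dots> = (\<lambda>z. \<Sum>i\<in>{k+1..n}. \<Sum>h\<in>carrier G. basis (tau G n k i h) z)"
    by (intro ext sum.cong refl) (simp only: f)
  also have "\<dots> = Tsum G n k {k+1..n}"
    by (simp add: Tsum_def sum.cartesian_product case_prod_unfold)
  finally show ?thesis .
qed

end

section \<open>The relations\<close>

fun hgen_val :: "('g, 'c) monoid_scheme \<Rightarrow> nat \<Rightarrow> nat \<Rightarrow> 'g hgen \<Rightarrow> 'g zmat \<Rightarrow> 'f::field" where
  "hgen_val G m n (GenG g) = basis (embed_mat G m n (tuple_mat m g))"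
| "hgen_val G m n (GenS k) = basis (transp_mat G n k (k+1))"
| "hgen_val G m n (GenX l) = Tsum G n l {l+1..n}"

definition word_val :: "('g, 'c) monoid_scheme \<Rightarrow> nat \<Rightarrow> nat \<Rightarrow> 'g hgen list \<Rightarrow> 'g zmat \<Rightarrow> 'f::field" where
  "word_val G m n w = foldr (\<lambda>x r. hgen_val G m n x \<otimes>\<^bsub>FGbar G n\<^esub> r) w (basis \<one>\<^bsub>Gbar G n\<^esub>)"

definition free_val :: "('g, 'c) monoid_scheme \<Rightarrow> nat \<Rightarrow> nat \<Rightarrow> ('g hgen list \<Rightarrow> 'f) \<Rightarrow> 'g zmat \<Rightarrow> 'f::field" where
  "free_val G m n = lin_lift (word_val G m n)"

abbreviation hgens :: "('g, 'c) monoid_scheme \<Rightarrow> nat \<Rightarrow> 'g hgen set" where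
  "hgens G m \<equiv> GenG ` carrier (Gpow G m) \<union> GenS ` {1..<m} \<union> GenX ` {1..m}"

context group
begin

lemma centralizer_Zwr:
  "m \<le> n \<Longrightarrow> subalg (FGwr G n) (carrier (Zwr G m n) :: ('a zmat \<Rightarrow> 'f::field) set)"
  by (simp add: Zwr_def, rule centralizer_subalg[OF monoid_Gwr]) (auto simp: Gwr_tail_iff)

lemma Zwr_iff: "a \<in> carrier (Zwr G m n) \<longleftrightarrow> a \<in> carrier (FGwr G n) \<and>
   (\<forall>x\<in>carrier (Gwr_tail G m n). a \<otimes>\<^bsub>FGbar G n\<^esub> basis x = basis x \<otimes>\<^bsub>FGbar G n\<^esub> a)"
  by (simp add: Zwr_def centralizer_in_def)

lemma Gwr_tail_Gbar_tail: "x \<in> carrier (Gwr_tail G m n) \<Longrightarrow> x \<in> carrier (Gbar_tail G m n)"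
  by (simp add: Gwr_tail_def)

lemma embed_in_Zwr:
  assumes "A \<in> carrier (Gwr G m)" "m \<le> n"
  shows "(basis (embed_mat G m n A) :: 'a zmat \<Rightarrow> 'f::field) \<in> carrier (Zwr G m n)"
  using embed_in_Gwr[OF assms] embed_commute_tail[OF Gwr_Gbar[OF assms(1)] assms(2)] Gwr_tail_Gbar_tail
  by (auto simp: Zwr_iff basis_mult)

lemma transp_mat_embed:
  "k \<in> {1..<m} \<Longrightarrow> m \<le> n \<Longrightarrow> transp_mat G n k (k+1) = embed_mat G m n (transp_mat G m k (k+1))"
  by (rule embed_perm_mat[symmetric]) (auto intro!: permutes_swap_id)

lemma Tsum_in_Zwr:
  assumes "l \<in> {1..m}" "m \<le> n"
  shows "(Tsum G n l {l+1..n} :: 'a zmat \<Rightarrow> 'f::field) \<in> carrier (Zwr G m n)"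
proof -
  have "{l+1..n} \<subseteq> {1..n} - {l}" "l \<in> {1..n}" using assms by auto
  then show ?thesis using assms Tsum_commute_tail[of _ m n l, where 'f = 'f] Tsum_in[of l n "{l+1..n}", where 'f = 'f] by (auto simp: Zwr_iff)
qed

lemma hgen_val_in:
  assumes "m \<le> n" "x \<in> hgens G m"
  shows "(hgen_val G m n x :: 'a zmat \<Rightarrow> 'f::field) \<in> carrier (Zwr G m n)"
proof -
  consider g where "g \<in> carrier (Gpow G m)" "x = GenG g" | k where "k \<in> {1..<m}" "x = GenS k"
    | k where "k \<in> {1..m}" "x = GenX k" using assms(2) by blast
  then show ?thesis
  proof cases
    case 1
    then show ?thesis using embed_in_Zwr[OF tuple_mat_in assms(1)] by simp
  next
    case 2
    then have "transp_mat G m k (k+1) \<in> carrier (Gwr G m)" by (intro transp_mat_in) auto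
    then show ?thesis unfolding 2(2) hgen_val.simps transp_mat_embed[OF 2(1) assms(1)]
      by (intro embed_in_Zwr assms(1))
  next
    case 3
    then show ?thesis using Tsum_in_Zwr[OF 3(1) assms(1)] by simp
  qed
qed

lemma word_val_in:
  assumes "m \<le> n" "w \<in> carrier (free_monoid (hgens G m))"
  shows "(word_val G m n w :: 'a zmat \<Rightarrow> 'f::field) \<in> carrier (Zwr G m n)"
proof -
  note Z = centralizer_Zwr[OF assms(1), where 'f = 'f]
  have "set w \<subseteq> hgens G m" using assms(2) by (auto simp: free_monoid_def)
  then show ?thesis
  proof (induction w)
    case Nil
    then show ?case using Z by (simp add: word_val_def subalg_def sg_alg_ops)
  next
    case (Cons x w)
    then have "(word_val G m n w :: 'a zmat \<Rightarrow> 'f) \<in> carrier (Zwr G m n)"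
      "(hgen_val G m n x :: 'a zmat \<Rightarrow> 'f) \<in> carrier (Zwr G m n)"
      using hgen_val_in[OF assms(1)] by auto
    then show ?case using Z by (simp add: word_val_def subalg_def)
  qed
qed

text \<open>The target is the full algebra \<open>FGwr\<close>, a semigroup algebra as
  \<open>lin_lift_alg_hom\<close> requires; that the values lie in the centralizer is
  \<open>free_val_in\<close>.\<close>

lemma free_val_hom:
  assumes "m \<le> n"
  shows "free_val G m n \<in> alg_hom (hecke_free G m) (FGwr G n :: ('f::field, _) module)"
  unfolding free_val_def hecke_free_def
proof (rule lin_lift_alg_hom[OF monoid_free_monoid])
  fix x y assume x: "x \<in> carrier (free_monoid (hgens G m))" and y: "y \<in> carrier (free_monoid (hgens G m))"
  let ?F = "FGwr G n :: ('f, 'a zmat \<Rightarrow> 'f) module"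
  have Z: "carrier (Zwr G m n) \<subseteq> carrier ?F" by (auto simp: Zwr_iff)
  have W: "word_val G m n x \<in> carrier ?F" if "set x \<subseteq> hgens G m" for x
  proof -
    have "x \<in> carrier (free_monoid (hgens G m))" using that unfolding free_monoid_def by (simp add: lists_eq_set)
    then show ?thesis using word_val_in[OF assms, of x] Z by blast
  qed
  have V: "hgen_val G m n x \<in> carrier ?F" if "x \<in> hgens G m" for x
    using hgen_val_in[OF assms that] Z by auto
  have xs: "set x \<subseteq> hgens G m" "set y \<subseteq> hgens G m"
    using x y unfolding free_monoid_def by (simp_all add: lists_eq_set)
  show "word_val G m n x \<in> carrier ?F" by (rule W[OF xs(1)])
  interpret ring ?F by (rule sg_alg_ring[OF monoid_Gwr])
  note xs
  then show "word_val G m n (x \<otimes>\<^bsub>free_monoid (hgens G m)\<^esub> y) = word_val G m n x \<otimes>\<^bsub>?F\<^esub> word_val G m n y"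
  proof (induction x)
    case Nil
    then show ?case using l_one[OF W[of y]] by (simp add: word_val_def free_monoid_def sg_alg_ops)
  next
    case (Cons a x)
    have "hgen_val G m n a \<in> carrier ?F" "word_val G m n x \<in> carrier ?F"
      "word_val G m n y \<in> carrier ?F" using Cons.prems W V by auto
    then show ?case using Cons m_assoc by (simp add: word_val_def free_monoid_def)
  qed
qed (simp add: word_val_def free_monoid_def)

lemma free_val_gen:
  assumes "m \<le> n" "x \<in> hgens G m"
  shows "free_val G m n (basis [x]) = (hgen_val G m n x :: 'a zmat \<Rightarrow> 'f::field)"
proof -
  interpret ring "FGwr G n :: ('f, 'a zmat \<Rightarrow> 'f) module" by (rule sg_alg_ring[OF monoid_Gwr])
  have "(hgen_val G m n x :: 'a zmat \<Rightarrow> 'f) \<in> carrier (FGwr G n)"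
    using hgen_val_in[OF assms, where 'f = 'f] by (simp add: Zwr_iff)
  from r_one[OF this] show ?thesis by (simp add: free_val_def word_val_def sg_alg_ops)
qed

lemma free_val_in:
  fixes a :: "'a hgen list \<Rightarrow> 'f::field"
  assumes "m \<le> n" "a \<in> carrier (hecke_free G m)"
  shows "free_val G m n a \<in> carrier (Zwr G m n)"
proof -
  let ?A = "hecke_free G m :: ('f, 'a hgen list \<Rightarrow> 'f) module"
  let ?B = "{a \<in> carrier ?A. free_val G m n a \<in> carrier (Zwr G m n)}"
  note Z = centralizer_Zwr[OF assms(1), where 'f = 'f]
  note F = alg_homD[OF free_val_hom[OF assms(1), where 'f = 'f]]
  have A: "subalg ?A (carrier ?A)"
    unfolding hecke_free_def by (rule sg_alg_subalg[OF monoid_free_monoid])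
  have "subalg ?A ?B"
    unfolding subalg_def
  proof (intro conjI ballI allI)
    show "?B \<subseteq> carrier ?A" by blast
    show "\<one>\<^bsub>?A\<^esub> \<in> ?B" using A Z F(5) by (simp add: subalg_def)
    show "c \<odot>\<^bsub>?A\<^esub> a \<in> ?B" if "a \<in> ?B" for c a
      using that A Z F(4)[of a c] by (simp add: subalg_def)
    fix a b assume ab: "a \<in> ?B" "b \<in> ?B"
    show "a \<oplus>\<^bsub>?A\<^esub> b \<in> ?B" "a \<otimes>\<^bsub>?A\<^esub> b \<in> ?B"
      using ab A Z F(2,3)[of a b] by (simp_all add: subalg_def)
  qed
  then have "carrier ?A \<subseteq> ?B"
    unfolding hecke_free_def
    by (rule sg_alg_subset_subalg) (use word_val_in[OF assms(1)] in \<open>simp add: free_val_def\<close>)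
  then show ?thesis using assms(2) by blast
qed

end

text \<open>The ideal generated by the differences is formed inside the free algebra, so both sides
  of each relation must lie in its carrier.\<close>

lemma hecke_rels_in:
  assumes "(a :: 'g hgen list \<Rightarrow> 'f::field, b) \<in> hecke_rels G m" and G: "group G"
  shows "a \<in> carrier (hecke_free G m) \<and> b \<in> carrier (hecke_free G m)"
proof -
  interpret G: group G by (rule G)
  interpret ring "hecke_free G m :: ('f, 'g hgen list \<Rightarrow> 'f) module" by (rule ring_hecke_free)
  have one: "(\<lambda>i\<in>{1..m}. \<one>\<^bsub>G\<^esub>) \<in> carrier (Gpow G m)" by (auto simp: carrier_product_group)
  have mul: "(\<lambda>i\<in>{1..m}. g i \<otimes>\<^bsub>G\<^esub> h i) \<in> carrier (Gpow G m)"
    if "g \<in> carrier (Gpow G m)" "h \<in> carrier (Gpow G m)" for g h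
    using that by (auto simp: carrier_product_group)
  have act: "tuple_act m (transpose i (i+1)) g \<in> carrier (Gpow G m)"
    if "i \<in> {1..<m}" "g \<in> carrier (Gpow G m)" for i g
    using that by (auto simp: carrier_product_group tuple_act_def PiE_iff transpose_def)
  have t: "t_elem G m (hecke_free G m) gG k l \<in> carrier (hecke_free G m :: ('f, 'g hgen list \<Rightarrow> 'f) module)" for k l
    unfolding t_elem_def
    by (intro finsum_closed Pi_I m_closed) (simp_all add: hecke_free_basis_in G.single_in)
  from assms(1) show ?thesis
    by cases (auto simp: hecke_free_basis_in act t one mul intro!: m_closed a_closed)
qed

lemma tail_subset: "{k+1..n} \<subseteq> {1..n} - {k::nat}"
  by auto

context group
begin

lemma t_elem_hecke_free:
  "t_elem G m (hecke_free G m) gG k l =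
     (\<lambda>z. \<Sum>h\<in>carrier G. (gG (single G m k h) \<otimes>\<^bsub>hecke_free G m\<^esub> gG (single G m l (inv h))) z :: 'f::field)"
proof -
  interpret ring "hecke_free G m :: ('f, 'a hgen list \<Rightarrow> 'f) module" by (rule ring_hecke_free)
  have "gG (single G m k h) \<otimes>\<^bsub>hecke_free G m\<^esub> gG (single G m l (inv h))
     \<in> carrier (hecke_free G m :: ('f, 'a hgen list \<Rightarrow> 'f) module)" if "h \<in> carrier G" for h
    using that by (intro m_closed) (simp_all add: hecke_free_basis_in single_in)
  then show ?thesis
    unfolding t_elem_def hecke_free_def by (intro sg_alg_finsum monoid_free_monoid)
qed

lemma embed_single:
  assumes "k \<in> {1..m}" "m \<le> n"
  shows "embed_mat G m n (tuple_mat m (single G m k h)) = tuple_mat n (single G n k h)"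
  using assms by (auto simp: embed_mat_def diag_def single_def fun_eq_iff)

text \<open>Since the transposition squares to 1, the diagonal matrix with \<open>h\<close> at
  \<open>k\<close> and \<open>inv h\<close> at \<open>l\<close> equals \<open>tau\<close> times the
  transposition. This is the shape of the correction term in \<open>transp_Tsum\<close>.\<close>

lemma free_val_t_elem:
  assumes "k \<in> {1..m}" "l \<in> {1..m}" "k \<noteq> l" "m \<le> n"
  shows "free_val G m n (t_elem G m (hecke_free G m) gG k l) =
    (\<lambda>z. \<Sum>h\<in>carrier G. basis (tau G n k l h \<otimes>\<^bsub>Gbar G n\<^esub> transp_mat G n k l) z :: 'f::field)"
proof -
  interpret Gb: monoid "Gbar G n" by (rule monoid_Gbar)
  have kl: "k \<in> {1..n}" "l \<in> {1..n}" using assms by auto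
  note F = alg_homD[OF free_val_hom[OF assms(4), where 'f = 'f]]
  have "transpose k l \<circ> transpose k l = id" by (auto simp: fun_eq_iff transpose_def)
  then have tt: "transp_mat G n k l \<otimes>\<^bsub>Gbar G n\<^esub> transp_mat G n k l = \<one>\<^bsub>Gbar G n\<^esub>"
    using kl by (subst perm_mat_mult) (auto intro!: permutes_swap_id zmat_eqI simp: perm_mat_Some_iff mat_one_Some_iff)
  have g: "GenG (single G m i h) \<in> hgens G m" if "h \<in> carrier G" for i h
    using single_in[OF that] by auto
  have "free_val G m n (t_elem G m (hecke_free G m) gG k l) =
    (\<lambda>z. \<Sum>h\<in>carrier G. free_val G m n (gG (single G m k h) \<otimes>\<^bsub>hecke_free G m\<^esub> gG (single G m l (inv h))) z :: 'f)"
    unfolding t_elem_hecke_free free_val_def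
    by (rule lin_lift_sum) (simp add: hecke_free_def basis_mult)
  also have "\<dots> = (\<lambda>z. \<Sum>h\<in>carrier G. basis (tau G n k l h \<otimes>\<^bsub>Gbar G n\<^esub> transp_mat G n k l) z)"
  proof (intro ext sum.cong refl)
    fix z h assume h: "h \<in> carrier G"
    then have "free_val G m n (gG (single G m k h) \<otimes>\<^bsub>hecke_free G m\<^esub> gG (single G m l (inv h))) =
       (basis (tuple_mat n (single G n k h) \<otimes>\<^bsub>Gbar G n\<^esub> tuple_mat n (single G n l (inv h))) :: 'a zmat \<Rightarrow> 'f)"
      by (simp add: F(2) hecke_free_basis_in single_in free_val_gen[OF assms(4) g] embed_single[OF assms(1,4)]
        embed_single[OF assms(2,4)] basis_mult)
    also have "tuple_mat n (single G n k h) \<otimes>\<^bsub>Gbar G n\<^esub> tuple_mat n (single G n l (inv h)) =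
       tau G n k l h \<otimes>\<^bsub>Gbar G n\<^esub> transp_mat G n k l"
      unfolding tau_eq[OF kl assms(3) h, symmetric] using h kl tt
      by (simp add: Gb.m_assoc Gwr_Gbar single_mat_in transp_mat_in mat_mult_in)
    finally show "free_val G m n (gG (single G m k h) \<otimes>\<^bsub>hecke_free G m\<^esub> gG (single G m l (inv h))) z =
       (basis (tau G n k l h \<otimes>\<^bsub>Gbar G n\<^esub> transp_mat G n k l) z :: 'f)" by simp
  qed
  finally show ?thesis .
qed

lemma perm_mat_tuple:
  assumes "\<sigma> permutes {1..m}" "g \<in> carrier (Gpow G m)"
  shows "perm_mat G m \<sigma> \<otimes>\<^bsub>Gbar G m\<^esub> tuple_mat m g = tuple_mat m (tuple_act m \<sigma> g) \<otimes>\<^bsub>Gbar G m\<^esub> perm_mat G m \<sigma>"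
proof -
  have inv: "inv_into UNIV \<sigma> (\<sigma> j) = j" for j using permutes_inj[OF assms(1)] by (rule inv_f_f)
  have g: "g i \<in> carrier G" if "i \<in> {1..m}" for i using Gpow_closed[OF assms(2) that] .
  have ta: "tuple_act m \<sigma> g \<in> carrier (Gpow G m)"
    using g permutes_in_image[OF permutes_inv[OF assms(1)]] by (auto simp: carrier_product_group tuple_act_def)
  note in1 = Gwr_Gbar[OF perm_mat_in[OF assms(1)]] Gwr_Gbar[OF tuple_mat_in[OF assms(2)]]
    Gwr_Gbar[OF tuple_mat_in[OF ta]]
  have "zmul G (perm_mat G m \<sigma> i j) (Some (g j)) = zmul G (Some (tuple_act m \<sigma> g i)) (perm_mat G m \<sigma> i j)" for i j
    using g inv by (auto simp: perm_mat_def tuple_act_def)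
  then show ?thesis
    unfolding diag_mult_left[OF in1(3,1)] diag_mult_right[OF in1(2,1)] by simp
qed

lemma Tsum_insert:
  assumes "i \<notin> I" "finite I"
  shows "Tsum G n k (insert i I) = (\<lambda>z. Tsum G n k {i} z + Tsum G n k I z :: 'f::field)"
proof -
  have "Tsum G n k J = (\<lambda>z. \<Sum>i\<in>J. \<Sum>h\<in>carrier G. basis (tau G n k i h) z :: 'f)" for J
    by (simp add: Tsum_def sum.cartesian_product case_prod_unfold)
  then show ?thesis using assms by simp
qed

lemma act_transp:
  assumes "k \<in> {1..n}" "i \<in> {1..n}" "j \<in> {1..n}"
  shows "transp_mat G n k i (transpose k i j) j = Some \<one>" "act (transp_mat G n k i) j = transpose k i j"
proof -
  have "transpose k i j \<in> {1..n}" using assms by (auto simp: transpose_def)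
  then show "transp_mat G n k i (transpose k i j) j = Some \<one>" using assms by (simp add: perm_mat_def)
  then show "act (transp_mat G n k i) j = transpose k i j"
    by (rule act_eq[OF Gwr_Gbar[OF transp_mat_in[OF assms(1,2)]]])
qed

text \<open>Conjugation by the transposition moves \<open>k\<close> to \<open>k+1\<close> and the
  range \<open>{k+1..n}\<close> to \<open>{k, k+2, ..., n}\<close>. The surplus index
  \<open>k\<close> is the source of the summand \<open>t_elem\<close> in the relation
  \<open>S_X\<close>.\<close>

lemma transp_Tsum:
  assumes k: "k \<in> {1..<n}"
  shows "basis (transp_mat G n k (k+1)) \<otimes>\<^bsub>FGbar G n\<^esub> Tsum G n k {k+1..n} =
    (\<lambda>z. (Tsum G n (k+1) {k+1+1..n} \<otimes>\<^bsub>FGbar G n\<^esub> basis (transp_mat G n k (k+1))) z +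
      (\<Sum>h\<in>carrier G. basis (tau G n k (k+1) h \<otimes>\<^bsub>Gbar G n\<^esub> transp_mat G n k (k+1)) z :: 'f::field))"
proof -
  let ?s = "transp_mat G n k (k+1)"
  interpret R: ring "FGbar G n :: ('f, 'a zmat \<Rightarrow> 'f) module" by (rule sg_alg_ring[OF monoid_Gbar])
  have kn: "k \<in> {1..n}" "k+1 \<in> {1..n}" using k by auto
  note s = transp_mat_in[OF kn]
  have "act ?s ` {k+1..n} = transpose k (k+1) ` {k+1..n}"
    using act_transp(2)[OF kn] k by (intro image_cong) auto
  also have "\<dots> = insert k {k+1+1..n}"
  proof
    show "transpose k (k+1) ` {k+1..n} \<subseteq> insert k {k+1+1..n}" by (auto simp: transpose_def)
    show "insert k {k+1+1..n} \<subseteq> transpose k (k+1) ` {k+1..n}"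
    proof
      fix j assume "j \<in> insert k {k+1+1..n}"
      then show "j \<in> transpose k (k+1) ` {k+1..n}"
        using k by (intro image_eqI[of _ _ "transpose k (k+1) j"]) (auto simp: transpose_def)
    qed
  qed
  finally have im: "act ?s ` {k+1..n} = insert k {k+1+1..n}" .
  have "?s (k+1) k = Some \<one>" using act_transp(1)[OF kn kn(1)] by simp
  then have "basis ?s \<otimes>\<^bsub>FGbar G n\<^esub> Tsum G n k {k+1..n} =
      Tsum G n (k+1) (insert k {k+1+1..n}) \<otimes>\<^bsub>FGbar G n\<^esub> (basis ?s :: 'a zmat \<Rightarrow> 'f)"
    using Tsum_commute[OF s _ tail_subset, of "k+1" k \<one>] im by simp
  also have "Tsum G n (k+1) (insert k {k+1+1..n}) =
      (Tsum G n (k+1) {k} \<oplus>\<^bsub>FGbar G n\<^esub> Tsum G n (k+1) {k+1+1..n} :: 'a zmat \<Rightarrow> 'f)"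
    unfolding sg_alg_ops by (rule Tsum_insert) auto
  also have "(Tsum G n (k+1) {k} \<oplus>\<^bsub>FGbar G n\<^esub> Tsum G n (k+1) {k+1+1..n}) \<otimes>\<^bsub>FGbar G n\<^esub> basis ?s =
     Tsum G n (k+1) {k} \<otimes>\<^bsub>FGbar G n\<^esub> basis ?s \<oplus>\<^bsub>FGbar G n\<^esub> Tsum G n (k+1) {k+1+1..n} \<otimes>\<^bsub>FGbar G n\<^esub> (basis ?s :: 'a zmat \<Rightarrow> 'f)"
    using k by (intro R.l_distr FGwr_FGbar Tsum_in) (auto intro!: Gwr_Gbar transp_mat_in)
  also have "Tsum G n (k+1) {k} \<otimes>\<^bsub>FGbar G n\<^esub> basis ?s =
     (\<lambda>z. \<Sum>h\<in>carrier G. basis (tau G n (k+1) k h \<otimes>\<^bsub>Gbar G n\<^esub> ?s) z :: 'f)"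
    by (simp add: Tsum_def sg_alg_sum_mult basis_mult flip: sum.cartesian_product[of "\<lambda>i h. basis (tau G n (k+1) i h \<otimes>\<^bsub>Gbar G n\<^esub> ?s) _", unfolded case_prod_unfold])
  \<comment> \<open>By \<open>tau_flip\<close>, exchanging the two positions inverts the label, and
    inversion permutes \<open>G\<close>.\<close>
  also have "\<dots> = (\<lambda>z. \<Sum>h\<in>carrier G. basis (tau G n k (k+1) h \<otimes>\<^bsub>Gbar G n\<^esub> ?s) z)"
  proof
    fix z
    show "(\<Sum>h\<in>carrier G. basis (tau G n (k+1) k h \<otimes>\<^bsub>Gbar G n\<^esub> ?s) z :: 'f) = (\<Sum>h\<in>carrier G. basis (tau G n k (k+1) h \<otimes>\<^bsub>Gbar G n\<^esub> ?s) z)"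
      by (rule sum.reindex_bij_witness[of _ "m_inv G" "m_inv G"]) (auto simp: tau_flip[of _ "k+1" k])
  qed
  finally show ?thesis by (simp add: sg_alg_ops add.commute)
qed

text \<open>Every labelled transposition occurring in the sum for \<open>l\<close> fixes
  \<open>1, ..., k\<close>, hence lies in the tail group, whose elements commute with the sum for
  \<open>k\<close>.\<close>

lemma Tsum_Tsum_commute:
  assumes kl: "1 \<le> k" "k < l" "l \<le> n"
  shows "(Tsum G n k {k+1..n} :: 'a zmat \<Rightarrow> 'f::field) \<otimes>\<^bsub>FGbar G n\<^esub> Tsum G n l {l+1..n} =
     Tsum G n l {l+1..n} \<otimes>\<^bsub>FGbar G n\<^esub> Tsum G n k {k+1..n}"
proof -
  let ?X = "Tsum G n k {k+1..n} :: 'a zmat \<Rightarrow> 'f"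
  have c: "basis (tau G n l i h) \<otimes>\<^bsub>FGbar G n\<^esub> ?X = ?X \<otimes>\<^bsub>FGbar G n\<^esub> basis (tau G n l i h)"
    if "i \<in> {l+1..n}" "h \<in> carrier G" for i h
  proof (rule Tsum_commute_tail)
    show "tau G n l i h \<in> carrier (Gwr_tail G k n)"
      unfolding Gwr_tail_iff using that kl
      by (intro conjI tau_in_Gwr) (auto simp: tau_def)
  qed (use kl in auto)
  show ?thesis
    unfolding Tsum_def[of G n l]
    by (subst sg_alg_mult_sum, simp, subst sg_alg_sum_mult, simp, intro ext sum.cong refl)
      (use c in auto)
qed

lemma free_val_rel:
  fixes a b :: "'a hgen list \<Rightarrow> 'f::field"
  assumes "(a, b) \<in> hecke_rels G m" and mn: "m \<le> n"
  shows "free_val G m n a = (free_val G m n b :: 'a zmat \<Rightarrow> 'f)"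
proof -
  let ?F = "free_val G m n :: ('a hgen list \<Rightarrow> 'f) \<Rightarrow> 'a zmat \<Rightarrow> 'f"
  interpret H: ring "hecke_free G m :: ('f, 'a hgen list \<Rightarrow> 'f) module" by (rule ring_hecke_free)
  note F = alg_homD[OF free_val_hom[OF mn, where 'f = 'f], simplified]
  have Gg: "?F (gG g) = basis (embed_mat G m n (tuple_mat m g))" and Gin: "gG g \<in> carrier (hecke_free G m :: ('f, 'a hgen list \<Rightarrow> 'f) module)"
    if "g \<in> carrier (Gpow G m)" for g
    using free_val_gen[OF mn, of "GenG g"] that by (auto simp: hecke_free_basis_in)
  have Sg: "?F (gS k) = basis (transp_mat G n k (k+1))" and Sin: "gS k \<in> carrier (hecke_free G m :: ('f, 'a hgen list \<Rightarrow> 'f) module)"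
    if "k \<in> {1..<m}" for k
    using free_val_gen[OF mn, of "GenS k"] that by (auto simp: hecke_free_basis_in)
  have Xg: "?F (gX k) = Tsum G n k {k+1..n}" and Xin: "gX k \<in> carrier (hecke_free G m :: ('f, 'a hgen list \<Rightarrow> 'f) module)"
    if "k \<in> {1..m}" for k
    using free_val_gen[OF mn, of "GenX k"] that by (auto simp: hecke_free_basis_in)
  have pm: "transpose k (k+1) permutes {1..n}" if "k \<in> {1..<m}" for k
    using that mn by (intro permutes_swap_id) auto
  note emb = embed_mult[OF Gwr_Gbar[OF tuple_mat_in] Gwr_Gbar[OF tuple_mat_in] mn, symmetric]
  from assms(1) show ?thesis
  proof cases
    case G_one
    have "\<one>\<^bsub>Gpow G m\<^esub> \<in> carrier (Gpow G m)" by (auto simp: carrier_product_group)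
    moreover have "tuple_mat m \<one>\<^bsub>Gpow G m\<^esub> = \<one>\<^bsub>Gbar G m\<^esub>"
      by (auto simp: Gbar_def diag_def fun_eq_iff)
    ultimately show ?thesis unfolding G_one using Gg mn by (simp add: F(5) embed_one sg_alg_ops)
  next
    case (G_mult g h)
    have "g \<otimes>\<^bsub>Gpow G m\<^esub> h \<in> carrier (Gpow G m)" using G_mult(3,4) by (auto simp: carrier_product_group)
    then show ?thesis unfolding G_mult(1,2) using G_mult(3,4) Gg Gin
      by (simp add: F(2) basis_mult emb tuple_mat_mult)
  next
    case (S_square i)
    have "transpose i (i+1) \<circ> transpose i (i+1) = id" by (auto simp: fun_eq_iff transpose_def)
    moreover have "perm_mat G n id = \<one>\<^bsub>Gbar G n\<^esub>"
      by (rule zmat_eqI) (auto simp: perm_mat_Some_iff mat_one_Some_iff)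
    ultimately show ?thesis unfolding S_square(1,2) using S_square(3) Sg Sin
      by (simp add: F(2,5) basis_mult perm_mat_mult pm sg_alg_ops)
  next
    case (S_far i j)
    have "transpose i (i+1) \<circ> transpose j (j+1) = transpose j (j+1) \<circ> transpose i (i+1)"
      using S_far(5) by (auto simp: fun_eq_iff transpose_def)
    then show ?thesis unfolding S_far(1,2) using S_far(3,4) Sg Sin
      by (simp add: F(2) basis_mult perm_mat_mult pm)
  next
    case (S_braid i)
    have eq: "transpose i (i+1) \<circ> transpose (i+1) (i+1+1) \<circ> transpose i (i+1) =
       transpose (i+1) (i+1+1) \<circ> transpose i (i+1) \<circ> transpose (i+1) (i+1+1)"
      by (auto simp: fun_eq_iff transpose_def)
    have perm_comp: "\<sigma> \<circ> \<pi> permutes {1..n}" if "\<sigma> permutes {1..n}" "\<pi> permutes {1..n}" for \<sigma> \<pi>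
      using permutes_compose[OF that(2,1)] .
    show ?thesis unfolding S_braid(1,2) using S_braid(3,4) Sg Sin
      by (simp add: F(2) basis_mult perm_mat_mult pm perm_comp eq H.m_closed)
  next
    case (S_G i g)
    have p: "transpose i (i+1) permutes {1..m}" using S_G(3) by (intro permutes_swap_id) auto
    have ta: "tuple_act m (transpose i (i+1)) g \<in> carrier (Gpow G m)"
      using hecke_rels_in[OF assms(1) group_axioms] S_G by (auto simp: carrier_product_group tuple_act_def PiE_iff transpose_def)
    \<comment> \<open>The calculation takes place in order \<open>m\<close>, where
      \<open>tuple_act\<close> lives, and is carried to order \<open>n\<close> by the
      embedding.\<close>
    show ?thesis unfolding S_G(1,2) using S_G(3,4) ta Sg Sin Gg Gin
      by (simp add: F(2) basis_mult transp_mat_embed[OF _ mn, of i, simplified] mn perm_mat_tuple[OF p]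
        perm_mat_in[OF p] Gwr_Gbar tuple_mat_in flip: embed_mult)
  next
    case (G_X g k)
    let ?x = "embed_mat G m n (tuple_mat m g)"
    have x: "?x \<in> carrier (Gwr G n)" by (intro embed_in_Gwr tuple_mat_in G_X(3) mn)
    obtain l where l: "?x j j = Some (l j)" if "j \<in> {1..n}" for j
      by (rule that[of "\<lambda>j. if j \<in> {1..m} then g j else \<one>"]) (auto simp: embed_mat_def diag_def)
    \<comment> \<open>A diagonal matrix moves no position, so it commutes with the sum over all
      labels.\<close>
    have "act ?x j = j" if "j \<in> {1..n}" for j using act_eq[OF Gwr_Gbar[OF x] l[OF that]] .
    then have "act ?x ` {k+1..n} = {k+1..n}" by auto
    moreover have "k \<in> {1..n}" using G_X(4) mn by auto
    moreover have "{k+1..n} \<subseteq> {1..n} - {k}" by auto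
    ultimately have "basis ?x \<otimes>\<^bsub>FGbar G n\<^esub> Tsum G n k {k+1..n} = Tsum G n k {k+1..n} \<otimes>\<^bsub>FGbar G n\<^esub> (basis ?x :: _ \<Rightarrow> 'f)"
      using Tsum_commute[OF x l, of k "{k+1..n}"] by simp
    then show ?thesis unfolding G_X(1,2) using G_X(3,4) by (simp add: F(2) Gg Gin Xg Xin)
  next
    case (S_X k)
    have km: "k \<in> {1..m}" "k+1 \<in> {1..m}" "k \<in> {1..<n}" using S_X(3) mn by auto
    have t: "t_elem G m (hecke_free G m) gG k (k+1) \<in> carrier (hecke_free G m :: ('f, 'a hgen list \<Rightarrow> 'f) module)"
      unfolding t_elem_def
      by (intro H.finsum_closed Pi_I H.m_closed) (simp_all add: hecke_free_basis_in single_in)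
    have "?F a = basis (transp_mat G n k (k+1)) \<otimes>\<^bsub>FGbar G n\<^esub> Tsum G n k {k+1..n}"
      unfolding S_X(1) using S_X(3) km by (simp add: F(2) Sg Sin Xg Xin)
    moreover have "?F b = (\<lambda>z. (Tsum G n (k+1) {k+1+1..n} \<otimes>\<^bsub>FGbar G n\<^esub> basis (transp_mat G n k (k+1))) z +
      (\<Sum>h\<in>carrier G. basis (tau G n k (k+1) h \<otimes>\<^bsub>Gbar G n\<^esub> transp_mat G n k (k+1)) z))"
      unfolding S_X(2) using S_X(3) km mn
      by (simp add: F(2,3) Sg Sin Xg Xin t H.m_closed free_val_t_elem sg_alg_ops)
    ultimately show ?thesis by (simp only: transp_Tsum[OF km(3)])
  next
    case (S_X_far k l)
    have kn: "k \<in> {1..n}" "k+1 \<in> {1..n}" "l \<in> {1..n}" using S_X_far mn by auto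
    let ?s = "transp_mat G n k (k+1)"
    have "act ?s ` {l+1..n} = transpose k (k+1) ` {l+1..n}"
      using act_transp(2)[OF kn(1,2)] by (intro image_cong) auto
    \<comment> \<open>As \<open>l\<close> differs from \<open>k\<close>, the range contains both of
      \<open>k\<close> and \<open>k+1\<close> or neither, so the transposition preserves it.\<close>
    also have "\<dots> = {l+1..n}"
    proof (rule endo_inj_surj)
      show "inj_on (transpose k (k+1)) {l+1..n}" by (rule inj_on_subset[OF inj_transpose]) auto
      show "transpose k (k+1) ` {l+1..n} \<subseteq> {l+1..n}" using S_X_far(5,6) kn by (auto simp: transpose_def)
    qed simp
    finally have im: "act ?s ` {l+1..n} = {l+1..n}" .
    have "?s l l = Some \<one>" using act_transp(1)[OF kn] S_X_far(5,6) by (simp add: transpose_def)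
    then have "basis ?s \<otimes>\<^bsub>FGbar G n\<^esub> Tsum G n l {l+1..n} = Tsum G n l {l+1..n} \<otimes>\<^bsub>FGbar G n\<^esub> (basis ?s :: _ \<Rightarrow> 'f)"
      using Tsum_commute[OF transp_mat_in[OF kn(1,2)] _ tail_subset, of l l \<one>] im by simp
    then show ?thesis unfolding S_X_far(1,2) using S_X_far(3,4) by (simp add: F(2) Sg Sin Xg Xin)
  next
    case (X_X k l)
    have "Tsum G n k {k+1..n} \<otimes>\<^bsub>FGbar G n\<^esub> Tsum G n l {l+1..n} =
      (Tsum G n l {l+1..n} \<otimes>\<^bsub>FGbar G n\<^esub> Tsum G n k {k+1..n} :: _ \<Rightarrow> 'f)"
      using X_X(3,4) mn Tsum_Tsum_commute[of k l n, where 'f = 'f] Tsum_Tsum_commute[of l k n, where 'f = 'f]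
      by (cases k l rule: linorder_cases) auto
    then show ?thesis unfolding X_X(1,2) using X_X(3,4) by (simp add: F(2) Xg Xin)
  qed
qed

section \<open>The quotient by the relations and the map \<Psi>\<close>

lemma hecke_ideal:
  "ideal (hecke_ideal G m) (hecke_free G m :: ('f::field, 'a hgen list \<Rightarrow> 'f) module)"
proof -
  interpret ring "hecke_free G m :: ('f, 'a hgen list \<Rightarrow> 'f) module" by (rule ring_hecke_free)
  show ?thesis
    unfolding hecke_ideal_def
    by (rule genideal_ideal) (auto dest!: hecke_rels_in[OF _ group_axioms])
qed

lemma hecke_proj:
  "(\<lambda>a. hecke_ideal G m +>\<^bsub>hecke_free G m\<^esub> a) \<in>
     alg_hom (hecke_free G m) (hecke G m :: ('f::field, ('a hgen list \<Rightarrow> 'f) set) module)"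
  "carrier (hecke G m :: ('f, ('a hgen list \<Rightarrow> 'f) set) module) =
     (\<lambda>a. hecke_ideal G m +>\<^bsub>hecke_free G m\<^esub> a) ` carrier (hecke_free G m)"
  using quot_alg_hom[OF monoid_free_monoid hecke_ideal[unfolded hecke_free_def]]
  unfolding hecke_def hecke_free_def by auto

text \<open>The kernel of a ring homomorphism is an ideal, and by \<open>free_val_rel\<close> it
  contains the generating differences.\<close>

lemma free_val_ideal:
  assumes "m \<le> n" "a \<in> hecke_ideal G m"
  shows "free_val G m n a = (\<lambda>z. 0 :: 'f::field)"
proof -
  let ?A = "hecke_free G m :: ('f, 'a hgen list \<Rightarrow> 'f) module"
  let ?F = "FGwr G n :: ('f, 'a zmat \<Rightarrow> 'f) module"
  interpret A: ring ?A by (rule ring_hecke_free)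
  interpret F: ring ?F by (rule sg_alg_ring[OF monoid_Gwr])
  note hom = free_val_hom[OF assms(1), where 'f = 'f]
  interpret ring_hom_ring ?A ?F "free_val G m n"
    by (intro ring_hom_ringI2 A.ring_axioms F.ring_axioms) (use hom in \<open>simp add: alg_hom_def\<close>)
  have "hecke_ideal G m \<subseteq> a_kernel ?A ?F (free_val G m n)"
    unfolding hecke_ideal_def
  proof (rule A.genideal_minimal[OF kernel_is_ideal], rule subsetI)
    fix c assume "c \<in> {a \<ominus>\<^bsub>?A\<^esub> b | a b. (a, b) \<in> hecke_rels G m}"
    then obtain a b where ab: "c = a \<ominus>\<^bsub>?A\<^esub> b" "(a, b) \<in> hecke_rels G m" by blast
    note in' = hecke_rels_in[OF ab(2) group_axioms]
    have "free_val G m n c = free_val G m n a \<ominus>\<^bsub>?F\<^esub> free_val G m n b"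
      using in' by (simp add: ab(1) a_minus_def)
    also have "\<dots> = \<zero>\<^bsub>?F\<^esub>"
      unfolding free_val_rel[OF ab(2) assms(1)] a_minus_def using in' by (intro F.r_neg hom_closed) simp
    finally have "free_val G m n c = \<zero>\<^bsub>?F\<^esub>" .
    moreover have "c \<in> carrier ?A" unfolding ab(1) using in' by blast
    ultimately show "c \<in> a_kernel ?A ?F (free_val G m n)" unfolding a_kernel_def' by blast
  qed
  then have "free_val G m n a = \<zero>\<^bsub>?F\<^esub>" using assms(2) unfolding a_kernel_def' by blast
  then show ?thesis by (simp only: sg_alg_ops)
qed

text \<open>Any representative gives the same value by \<open>Psi_map_proj\<close>. Restricting to
  the carrier makes the map extensional, so that it can be the unique one in
  \<open>ex1_Psi\<close>.\<close>

definition Psi_map :: "nat \<Rightarrow> nat \<Rightarrow> ('a hgen list \<Rightarrow> 'f::field) set \<Rightarrow> 'a zmat \<Rightarrow> 'f" where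
  "Psi_map m n = (\<lambda>X \<in> carrier (hecke G m :: ('f, _) module). free_val G m n (SOME a. a \<in> X))"

lemma Psi_map_proj:
  fixes a :: "'a hgen list \<Rightarrow> 'f::field"
  assumes "m \<le> n" "a \<in> carrier (hecke_free G m)"
  shows "Psi_map m n (hecke_ideal G m +>\<^bsub>hecke_free G m\<^esub> a) = free_val G m n a"
proof -
  let ?A = "hecke_free G m :: ('f, 'a hgen list \<Rightarrow> 'f) module"
  let ?X = "hecke_ideal G m +>\<^bsub>?A\<^esub> a"
  interpret ideal "hecke_ideal G m" ?A by (rule hecke_ideal)
  note F = alg_homD[OF free_val_hom[OF assms(1), where 'f = 'f]]
  have "a \<in> ?X" using assms(2) by (simp add: a_rcos_self)
  then have "(SOME c. c \<in> ?X) \<in> ?X" by (rule someI[of "\<lambda>c. c \<in> ?X"])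
  then obtain i where i: "i \<in> hecke_ideal G m" "(SOME c. c \<in> ?X) = i \<oplus>\<^bsub>?A\<^esub> a"
    by (auto simp: a_r_coset_def')
  have "free_val G m n (SOME c. c \<in> ?X) = free_val G m n a"
    using F(3)[OF a_Hcarr[OF i(1)] assms(2)] i free_val_ideal[OF assms(1) i(1)] by (simp add: sg_alg_ops)
  moreover have "?X \<in> carrier (hecke G m)" using hecke_proj(2) assms(2) by blast
  ultimately show ?thesis by (simp add: Psi_map_def)
qed

lemma Psi_map_hom:
  assumes "m \<le> n"
  shows "Psi_map m n \<in> alg_hom (hecke G m) (Zwr G m n :: ('f::field, _) module)"
proof -
  let ?p = "\<lambda>a :: 'a hgen list \<Rightarrow> 'f. hecke_ideal G m +>\<^bsub>hecke_free G m\<^esub> a"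
  let ?H = "hecke G m :: ('f, ('a hgen list \<Rightarrow> 'f) set) module"
  let ?A = "hecke_free G m :: ('f, 'a hgen list \<Rightarrow> 'f) module"
  note F = alg_homD[OF free_val_hom[OF assms, where 'f = 'f], simplified]
  note P = alg_homD[OF hecke_proj(1)[of m, where 'f = 'f]]
  have A: "subalg ?A (carrier ?A)"
    unfolding hecke_free_def by (rule sg_alg_subalg[OF monoid_free_monoid])
  have X: "\<exists>a \<in> carrier ?A. X = ?p a" if "X \<in> carrier ?H" for X
    using that hecke_proj(2)[of m, where 'f = 'f] by blast
  note S = Psi_map_proj[OF assms, where 'f = 'f]
  have "Psi_map m n \<in> ring_hom ?H (Zwr G m n)"
  proof (rule ring_hom_memI)
    fix X assume "X \<in> carrier ?H"
    then obtain a where a: "a \<in> carrier ?A" "X = ?p a" using X by blast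
    show "Psi_map m n X \<in> carrier (Zwr G m n)" using a S free_val_in[OF assms] by simp
    fix Y assume "Y \<in> carrier ?H"
    then obtain b where b: "b \<in> carrier ?A" "Y = ?p b" using X by blast
    have ab: "a \<otimes>\<^bsub>?A\<^esub> b \<in> carrier ?A" "a \<oplus>\<^bsub>?A\<^esub> b \<in> carrier ?A" using A a b by (auto simp: subalg_def)
    show "Psi_map m n (X \<otimes>\<^bsub>?H\<^esub> Y) = Psi_map m n X \<otimes>\<^bsub>Zwr G m n\<^esub> Psi_map m n Y"
      unfolding a(2) b(2) P(2)[OF a(1) b(1), symmetric] S[OF ab(1)] S[OF a(1)] S[OF b(1)] F(2)[OF a(1) b(1)] by simp
    show "Psi_map m n (X \<oplus>\<^bsub>?H\<^esub> Y) = Psi_map m n X \<oplus>\<^bsub>Zwr G m n\<^esub> Psi_map m n Y"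
      unfolding a(2) b(2) P(3)[OF a(1) b(1), symmetric] S[OF ab(2)] S[OF a(1)] S[OF b(1)] F(3)[OF a(1) b(1)] by simp
  next
    have one: "\<one>\<^bsub>?A\<^esub> \<in> carrier ?A" using A by (simp add: subalg_def)
    show "Psi_map m n \<one>\<^bsub>?H\<^esub> = \<one>\<^bsub>Zwr G m n\<^esub>"
      unfolding P(5)[symmetric] S[OF one] F(5) by simp
  qed
  moreover have "Psi_map m n (c \<odot>\<^bsub>?H\<^esub> X) = c \<odot>\<^bsub>Zwr G m n\<^esub> Psi_map m n X" if XH: "X \<in> carrier ?H" for c X
  proof -
    obtain a where a: "a \<in> carrier ?A" "X = ?p a" using X[OF XH] by blast
    have ca: "c \<odot>\<^bsub>?A\<^esub> a \<in> carrier ?A" using A a by (simp add: subalg_def)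
    show ?thesis
      unfolding a(2) P(4)[OF a(1), symmetric] S[OF ca] S[OF a(1)] F(4)[OF a(1)] by simp
  qed
  ultimately show ?thesis by (simp add: alg_hom_def)
qed

text \<open>With \<open>Tsum_eq\<close>, the three families of generators fall under one condition,
  so that uniqueness and the generation argument can treat them alike.\<close>

lemma is_Psi_iff:
  assumes "m \<le> n"
  shows "is_Psi G m n \<Psi> \<longleftrightarrow> \<Psi> \<in> alg_hom (hecke G m) (Zwr G m n :: ('f::field, _) module) \<and>
    (\<forall>x\<in>hgens G m. \<Psi> (hecke_gen G m x) = hgen_val G m n x)"
proof -
  have "(\<forall>l\<in>{1..m}. \<Psi> (hecke_gen G m (GenX l)) =
        (\<Oplus>\<^bsub>FGwr G n\<^esub> i \<in> {l+1..n}.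
           t_elem G n (FGwr G n) (\<lambda>g. basis (tuple_mat n g)) l i
             \<otimes>\<^bsub>FGwr G n\<^esub> basis (transp_mat G n l i))) \<longleftrightarrow>
     (\<forall>l\<in>{1..m}. \<Psi> (hecke_gen G m (GenX l)) = (Tsum G n l {l+1..n} :: 'a zmat \<Rightarrow> 'f))"
    by (intro ball_cong refl, subst Tsum_eq) (use assms in auto)
  then show ?thesis unfolding is_Psi_def by (auto simp: ball_Un)
qed

lemma is_Psi_Psi_map:
  assumes "m \<le> n"
  shows "is_Psi G m n (Psi_map m n :: ('a hgen list \<Rightarrow> 'f::field) set \<Rightarrow> _)"
  unfolding is_Psi_iff[OF assms]
proof (intro conjI ballI Psi_map_hom assms)
  fix x assume x: "x \<in> hgens G m"
  then have "basis [x] \<in> carrier (hecke_free G m :: ('f, 'a hgen list \<Rightarrow> 'f) module)"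
    by (auto simp: hecke_free_basis_in)
  from Psi_map_proj[OF assms this]
  show "Psi_map m n (hecke_gen G m x) = (hgen_val G m n x :: 'a zmat \<Rightarrow> 'f)"
    by (simp add: hecke_gen_def free_val_gen[OF assms x])
qed

lemma hecke_hom_eq:
  fixes C :: "('f::field, 'v, 'w) module_scheme"
  assumes "F \<in> alg_hom (hecke G m) C" "H \<in> alg_hom (hecke G m) C"
    and eq: "\<And>x. x \<in> hgens G m \<Longrightarrow> F (hecke_gen G m x) = H (hecke_gen G m x)"
    and X: "X \<in> carrier (hecke G m)"
  shows "F X = H X"
proof -
  let ?p = "\<lambda>a :: 'a hgen list \<Rightarrow> 'f. hecke_ideal G m +>\<^bsub>hecke_free G m\<^esub> a"
  obtain a where a: "a \<in> carrier (hecke_free G m)" "X = ?p a" using X hecke_proj(2) by blast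
  have "(\<lambda>a. F (?p a)) \<in> alg_hom (hecke_free G m) C" "(\<lambda>a. H (?p a)) \<in> alg_hom (hecke_free G m) C"
    using alg_hom_comp[OF hecke_proj(1)] assms(1,2) by blast+
  then have "F (?p a) = H (?p a)"
    unfolding hecke_free_def
    by (rule free_alg_hom_eq) (use eq a in \<open>auto simp: hecke_gen_def hecke_free_def\<close>)
  then show ?thesis using a by simp
qed

lemma ex1_Psi:
  assumes "m \<le> n"
  shows "\<exists>!\<Psi> :: ('a hgen list \<Rightarrow> 'f::field) set \<Rightarrow> 'a zmat \<Rightarrow> 'f.
        \<Psi> \<in> extensional (carrier (hecke G m :: ('f, _) module)) \<and> is_Psi G m n \<Psi>"
proof (rule ex1I[of _ "Psi_map m n"])
  show "Psi_map m n \<in> extensional (carrier (hecke G m :: ('f, _) module)) \<and>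
     is_Psi G m n (Psi_map m n :: ('a hgen list \<Rightarrow> 'f) set \<Rightarrow> 'a zmat \<Rightarrow> 'f)"
    using is_Psi_Psi_map[OF assms] by (auto simp: Psi_map_def)
  fix \<Psi> :: "('a hgen list \<Rightarrow> 'f) set \<Rightarrow> 'a zmat \<Rightarrow> 'f"
  assume P: "\<Psi> \<in> extensional (carrier (hecke G m :: ('f, _) module)) \<and> is_Psi G m n \<Psi>"
  show "\<Psi> = Psi_map m n"
  proof (rule extensionalityI[of _ "carrier (hecke G m)"])
    fix X :: "('a hgen list \<Rightarrow> 'f) set" assume X: "X \<in> carrier (hecke G m)"
    show "\<Psi> X = Psi_map m n X"
      by (rule hecke_hom_eq[of \<Psi> m "Zwr G m n" "Psi_map m n", OF _ _ _ X])
        (use P is_Psi_Psi_map[OF assms, where 'f = 'f] in \<open>auto simp: is_Psi_iff[OF assms]\<close>)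
  qed (use P in \<open>auto simp: Psi_map_def\<close>)
qed

end

section \<open>Generators of the monomial groups\<close>

context group
begin

lemma finite_Gbar:
  assumes "finite (carrier G)"
  shows "finite (carrier (Gbar G n))"
proof (rule inj_on_finite)
  let ?r = "\<lambda>A :: 'a zmat. \<lambda>p\<in>{1..n} \<times> {1..n}. A (fst p) (snd p)"
  show "?r ` carrier (Gbar G n) \<subseteq> ({1..n} \<times> {1..n}) \<rightarrow>\<^sub>E insert None (Some ` carrier G)"
  proof (rule image_subsetI)
    fix A assume "A \<in> carrier (Gbar G n)"
    then have "A i j \<in> insert None (Some ` carrier G)" for i j by (simp add: Gbar_def)
    then show "?r A \<in> ({1..n} \<times> {1..n}) \<rightarrow>\<^sub>E insert None (Some ` carrier G)" by (intro restrict_PiE_iff[THEN iffD2] ballI)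
  qed
  show "inj_on ?r (carrier (Gbar G n))"
  proof (rule inj_onI)
    fix A B assume A: "A \<in> carrier (Gbar G n)" and B: "B \<in> carrier (Gbar G n)" and e: "?r A = ?r B"
    have e': "A i j = B i j" if "i \<in> {1..n}" "j \<in> {1..n}" for i j
      using fun_cong[OF e, of "(i, j)"] that by simp
    show "A = B"
      by (rule zmat_eqI) (use e' Gbar_rangeD[OF A] Gbar_rangeD[OF B] in metis)+
  qed
qed (use assms in \<open>auto intro!: finite_PiE\<close>)

text \<open>The transposition of \<open>a\<close> and \<open>c+1\<close> is the conjugate of that of
  \<open>a\<close> and \<open>c\<close> by the adjacent one of \<open>c\<close> and
  \<open>c+1\<close>.\<close>

lemma transp_mat_generate:
  assumes one: "\<one>\<^bsub>Gbar G m\<^esub> \<in> M"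
    and mult: "\<And>A B. A \<in> M \<Longrightarrow> B \<in> M \<Longrightarrow> A \<otimes>\<^bsub>Gbar G m\<^esub> B \<in> M"
    and transp: "\<And>k. k \<in> {1..<m} \<Longrightarrow> transp_mat G m k (k+1) \<in> M"
    and ab: "1 \<le> a" "a < b" "b \<le> m"
  shows "transp_mat G m a b \<in> M"
  using ab(2,3)
proof (induction b rule: less_induct)
  case (less b)
  show ?case
  proof (cases "b = a + 1")
    case True
    then show ?thesis using transp[of a] ab(1) less.prems by auto
  next
    case False
    define c where "c = b - 1"
    have c: "b = c + 1" "a < c" using False less.prems by (auto simp: c_def)
    have p: "transpose a c permutes {1..m}" "transpose c (c+1) permutes {1..m}"
      using ab(1) c less.prems by (auto intro!: permutes_swap_id)
    have "transpose c (c+1) \<circ> transpose a c \<circ> transpose c (c+1) = transpose a (c+1)"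
      using c(2) by (auto simp: fun_eq_iff transpose_def)
    then have "transp_mat G m a b = transp_mat G m c (c+1) \<otimes>\<^bsub>Gbar G m\<^esub> transp_mat G m a c \<otimes>\<^bsub>Gbar G m\<^esub> transp_mat G m c (c+1)"
      using p by (simp add: perm_mat_mult permutes_compose c(1))
    moreover have "transp_mat G m a c \<in> M" using less.IH[of c] c less.prems by simp
    moreover have "transp_mat G m c (c+1) \<in> M" using transp[of c] c ab(1) less.prems by simp
    ultimately show ?thesis using mult by simp
  qed
qed

lemma perm_mat_id: "perm_mat G m id = \<one>\<^bsub>Gbar G m\<^esub>"
  by (rule zmat_eqI) (auto simp: perm_mat_Some_iff mat_one_Some_iff)

text \<open>A monomial matrix is a diagonal one times a permutation matrix, and a permutation is a
  product of transpositions. Phrased for an arbitrary set closed under products, this acts as an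
  induction principle.\<close>

lemma Gwr_generate:
  assumes one: "\<one>\<^bsub>Gbar G m\<^esub> \<in> M"
    and mult: "\<And>A B. A \<in> M \<Longrightarrow> B \<in> M \<Longrightarrow> A \<otimes>\<^bsub>Gbar G m\<^esub> B \<in> M"
    and transp: "\<And>k. k \<in> {1..<m} \<Longrightarrow> transp_mat G m k (k+1) \<in> M"
    and tuple: "\<And>g. g \<in> carrier (Gpow G m) \<Longrightarrow> tuple_mat m g \<in> M"
    and A: "A \<in> carrier (Gwr G m)"
  shows "A \<in> M"
proof -
  have transp': "transp_mat G m a b \<in> M" if "a \<in> {1..m}" "b \<in> {1..m}" for a b
  proof (cases a b rule: linorder_cases)
    case less
    then show ?thesis using transp_mat_generate[of m M a b] one mult transp that by simp
  next
    case equal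
    then have "transpose a b = id" by (auto simp: fun_eq_iff)
    then show ?thesis using one by (simp add: perm_mat_id)
  next
    case greater
    then show ?thesis using transp_mat_generate[of m M b a] one mult transp that
      by (simp add: transpose_commute)
  qed
  have perm: "perm_mat G m \<sigma> \<in> M" if "\<sigma> permutes {1..m}" for \<sigma>
  proof (rule permutes_induct[OF that])
    show "perm_mat G m id \<in> M" using one perm_mat_id by simp
    fix a b p assume ab: "a \<in> {1..m}" "b \<in> {1..m}" "perm_mat G m p \<in> M" "p permutes {1..m}"
    have "perm_mat G m (transpose a b \<circ> p) = transp_mat G m a b \<otimes>\<^bsub>Gbar G m\<^esub> perm_mat G m p"
      using ab by (intro perm_mat_mult[symmetric] permutes_swap_id)
    then show "perm_mat G m (transpose a b \<circ> p) \<in> M" using mult transp' ab by simp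
  qed simp
  have AG: "A \<in> carrier (Gbar G m)" using A by (rule Gwr_Gbar)
  \<comment> \<open>Extended by the identity, as \<open>permutes\<close> demands;
    \<open>act A\<close> has a meaning only on columns with a nonzero entry.\<close>
  define \<sigma> where "\<sigma> i = (if i \<in> {1..m} then act A i else i)" for i
  have "bij_betw \<sigma> {1..m} {1..m}"
    using act_bij[OF A] by (subst bij_betw_cong[of _ _ "act A"]) (auto simp: \<sigma>_def)
  then have \<sigma>: "\<sigma> permutes {1..m}" by (rule bij_imp_permutes) (auto simp: \<sigma>_def)
  have inv\<sigma>: "inv_into UNIV \<sigma> i \<in> {1..m}" "\<sigma> (inv_into UNIV \<sigma> i) = i" if "i \<in> {1..m}" for i
    using that permutes_in_image[OF permutes_inv[OF \<sigma>]] permutes_inverses(1)[OF \<sigma>] by auto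
  \<comment> \<open>The entry of row \<open>i\<close>, read off at the column that \<sigma> sends to
    \<open>i\<close>.\<close>
  define g where "g = (\<lambda>i\<in>{1..m}. the (A i (inv_into UNIV \<sigma> i)))"
  have g: "A i (inv_into UNIV \<sigma> i) = Some (g i) \<and> g i \<in> carrier G" if i: "i \<in> {1..m}" for i
  proof -
    obtain a where "a \<in> carrier G" "A (act A (inv_into UNIV \<sigma> i)) (inv_into UNIV \<sigma> i) = Some a"
      using act_in[OF A inv\<sigma>(1)[OF i]] by metis
    moreover have "act A (inv_into UNIV \<sigma> i) = i"
      using inv\<sigma>[OF i] by (simp add: \<sigma>_def)
    ultimately show ?thesis using i by (simp add: g_def)
  qed
  have gG: "g \<in> carrier (Gpow G m)"
    using g by (auto simp: carrier_product_group PiE_iff g_def)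
  have "A = tuple_mat m g \<otimes>\<^bsub>Gbar G m\<^esub> perm_mat G m \<sigma>"
    unfolding diag_mult_left[OF Gwr_Gbar[OF tuple_mat_in[OF gG]] Gwr_Gbar[OF perm_mat_in[OF \<sigma>]]]
  proof (intro ext)
    fix i j
    show "A i j = zmul G (Some (g i)) (perm_mat G m \<sigma> i j)"
    proof (cases "i \<in> {1..m} \<and> j \<in> {1..m} \<and> \<sigma> j = i")
      case True
      then have "inv_into UNIV \<sigma> i = j" using permutes_inverses(2)[OF \<sigma>] by auto
      then show ?thesis using True g[of i] by (simp add: perm_mat_def)
    next
      case False
      have "A i j = None"
      proof (rule ccontr)
        assume "A i j \<noteq> None"
        then obtain a where "A i j = Some a" by blast
        then show False using False act_eq[OF AG] Gbar_rangeD[OF AG] by (metis \<sigma>_def)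
      qed
      then show ?thesis using False by (auto simp: perm_mat_def)
    qed
  qed
  then show ?thesis using mult tuple[OF gG] perm[OF \<sigma>] by simp
qed

text \<open>Induction on the number of zero columns. A zero column \<open>q\<close> comes with a
  zero row \<open>p\<close>; writing 1 at \<open>(p, q)\<close> gives a matrix with one zero column
  less, from which multiplication by \<open>eps_mat G m q\<close> recovers \<open>A\<close>.\<close>

lemma Gbar_generate:
  assumes one: "\<one>\<^bsub>Gbar G m\<^esub> \<in> M"
    and mult: "\<And>A B. A \<in> M \<Longrightarrow> B \<in> M \<Longrightarrow> A \<otimes>\<^bsub>Gbar G m\<^esub> B \<in> M"
    and transp: "\<And>k. k \<in> {1..<m} \<Longrightarrow> transp_mat G m k (k+1) \<in> M"
    and tuple: "\<And>g. g \<in> carrier (Gpow G m) \<Longrightarrow> tuple_mat m g \<in> M"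
    and eps: "\<And>k. k \<in> {1..m} \<Longrightarrow> eps_mat G m k \<in> M"
    and A: "A \<in> carrier (Gbar G m)"
  shows "A \<in> M"
  using A
proof (induction "card {j \<in> {1..m}. \<forall>i. A i j = None}" arbitrary: A)
  case (0 A)
  then have E: "{j \<in> {1..m}. \<forall>i. A i j = None} = {}" by simp
  have col: "\<exists>i g. A i j = Some g" if "j \<in> {1..m}" for j
  proof -
    have "\<not> (\<forall>i. A i j = None)" using E that by blast
    then show ?thesis by force
  qed
  \<comment> \<open>Without a zero column the rows are exhausted by counting, so no row vanishes
    either and \<open>A\<close> is monomial.\<close>
  have "act A ` {1..m} = {1..m}"
  proof (rule endo_inj_surj)
    show "act A ` {1..m} \<subseteq> {1..m}"
    proof (rule image_subsetI)
      fix j assume "j \<in> {1..m}"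
      then obtain i g where "A i j = Some g" using col by blast
      then show "act A j \<in> {1..m}" using act_eq[OF 0(2)] Gbar_rangeD[OF 0(2)] by blast
    qed
    show "inj_on (act A) {1..m}"
    proof (rule inj_onI)
      fix j j' assume jj: "j \<in> {1..m}" "j' \<in> {1..m}" "act A j = act A j'"
      obtain i g where i: "A i j = Some g" using col jj(1) by blast
      obtain i' g' where i': "A i' j' = Some g'" using col jj(2) by blast
      have "i = i'" using jj(3) act_eq[OF 0(2) i] act_eq[OF 0(2) i'] by simp
      then show "j = j'" using Gbar_rowD[OF 0(2)] i i' by blast
    qed
  qed simp
  then have "\<exists>j g. A i j = Some g" if iI: "i \<in> {1..m}" for i
  proof -
    obtain j where j: "j \<in> {1..m}" "i = act A j" using iI \<open>act A ` {1..m} = {1..m}\<close> by blast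
    then obtain i' g where "A i' j = Some g" using col by blast
    then show ?thesis using act_eq[OF 0(2)] j(2) by blast
  qed
  then have "A \<in> carrier (Gwr G m)" using 0(2) col by (auto simp: Gwr_iff)
  then show ?case using Gwr_generate[of m M A] one mult transp tuple by blast
next
  case (Suc c A)
  let ?Z = "\<lambda>A. {j \<in> {1..m}. \<forall>i. A i j = None}"
  have "card (?Z A) \<noteq> 0" using Suc(2) by linarith
  then have "?Z A \<noteq> {}" by (rule contrapos_nn) (simp only: card.empty)
  then obtain q where q: "q \<in> ?Z A" by blast
  \<comment> \<open>If no row vanished, sending each row to the column of its entry would be an
    injection of \<open>{1..m}\<close> into itself, hence onto, and column \<open>q\<close> would
    have an entry.\<close>
  have "\<exists>p\<in>{1..m}. \<forall>j. A p j = None"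
  proof (rule ccontr)
    assume "\<not> ?thesis"
    then have "\<forall>p\<in>{1..m}. \<exists>j g. A p j = Some g" by force
    then obtain f g where f: "A p (f p) = Some (g p)" if "p \<in> {1..m}" for p by metis
    have "inj_on f {1..m}"
    proof (rule inj_onI)
      fix p p' assume "p \<in> {1..m}" "p' \<in> {1..m}" "f p = f p'"
      then show "p = p'" using f[of p] f[of p'] Gbar_colD[OF Suc(3), of p "f p" _ p'] by simp
    qed
    moreover have "f ` {1..m} \<subseteq> {1..m}" using f Gbar_rangeD[OF Suc(3)] by blast
    ultimately have "f ` {1..m} = {1..m}" by (simp add: endo_inj_surj)
    moreover have "q \<in> {1..m}" using q by simp
    ultimately have "q \<in> f ` {1..m}" by simp
    then obtain p where "p \<in> {1..m}" "q = f p" by (rule imageE)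
    then show False using f[of p] q by simp
  qed
  then obtain p where p: "p \<in> {1..m}" "\<And>j. A p j = None" by blast
  let ?B = "\<lambda>i j. if i = p \<and> j = q then Some \<one> else A i j"
  have B: "?B \<in> carrier (Gbar G m)"
  proof (rule GbarI)
    show "i \<in> {1..m} \<and> j \<in> {1..m} \<and> g \<in> carrier G" if "?B i j = Some g" for i j g
      using that p q Gbar_rangeD[OF Suc(3)] by (auto split: if_splits)
    show "j = j'" if "?B i j = Some g" "?B i j' = Some g'" for i j j' g g'
      using that p q Gbar_rowD[OF Suc(3)] by (auto split: if_splits)
    show "i = i'" if "?B i j = Some g" "?B i' j = Some g'" for i i' j g g'
      using that p q Gbar_colD[OF Suc(3)] by (auto split: if_splits)
  qed
  have "?Z A = insert q (?Z ?B)" using q by auto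
  moreover have "q \<notin> ?Z ?B" by auto
  ultimately have "card (?Z ?B) = c" using Suc(2) by (simp add: card_insert_if)
  then have "?B \<in> M" using Suc(1)[of ?B] B by simp
  then have "?B \<otimes>\<^bsub>Gbar G m\<^esub> eps_mat G m q \<in> M" using mult eps[of q] q by blast
  moreover have "A = ?B \<otimes>\<^bsub>Gbar G m\<^esub> eps_mat G m q"
    unfolding eps_mult[OF B] using q by (auto simp: fun_eq_iff)
  ultimately show ?case by argo
qed

end

section \<open>Conjugation by the tail subgroup\<close>

definition mat_conj :: "('g, 'c) monoid_scheme \<Rightarrow> nat \<Rightarrow> 'g zmat \<Rightarrow> 'g zmat \<Rightarrow> 'g zmat" where
  "mat_conj G n x A = x \<otimes>\<^bsub>Gbar G n\<^esub> A \<otimes>\<^bsub>Gbar G n\<^esub> mat_inv G x"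

definition tail_deg :: "('g, 'c) monoid_scheme \<Rightarrow> nat \<Rightarrow> nat \<Rightarrow> 'g zmat \<Rightarrow> nat" where
  "tail_deg G m n A = card {j \<in> {m+1..n}. A j j \<noteq> Some \<one>\<^bsub>G\<^esub>}"

definition orbit :: "('g, 'c) monoid_scheme \<Rightarrow> nat \<Rightarrow> nat \<Rightarrow> 'g zmat \<Rightarrow> 'g zmat set" where
  "orbit G m n A = (\<lambda>x. mat_conj G n x A) ` carrier (Gwr_tail G m n)"

definition osum :: "('g, 'c) monoid_scheme \<Rightarrow> nat \<Rightarrow> nat \<Rightarrow> 'g zmat \<Rightarrow> 'g zmat \<Rightarrow> 'f::field" where
  "osum G m n A = (\<lambda>z. if z \<in> orbit G m n A then 1 else 0)"

context group
begin

lemma mat_conj_in: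
  assumes "x \<in> carrier (Gwr G n)" "A \<in> carrier (Gwr G n)"
  shows "mat_conj G n x A \<in> carrier (Gwr G n)"
  unfolding mat_conj_def by (intro Gwr_mult_in mat_inv_in assms)

lemma mat_conj_mult:
  assumes "x \<in> carrier (Gwr G n)" "y \<in> carrier (Gwr G n)" "A \<in> carrier (Gwr G n)"
  shows "mat_conj G n (x \<otimes>\<^bsub>Gbar G n\<^esub> y) A = mat_conj G n x (mat_conj G n y A)"
proof -
  interpret W: group "Gwr G n" by (rule group_Gwr)
  have "mat_inv G (x \<otimes>\<^bsub>Gbar G n\<^esub> y) = mat_inv G y \<otimes>\<^bsub>Gbar G n\<^esub> mat_inv G x"
    using W.inv_mult_group[of x y] assms by (simp add: Gwr_inv Gwr_mult_in)
  then show ?thesis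
    using W.m_assoc assms by (simp add: mat_conj_def Gwr_mult_in mat_inv_in)
qed

lemma mat_conj_hom:
  assumes "x \<in> carrier (Gwr G n)" "A \<in> carrier (Gwr G n)" "B \<in> carrier (Gwr G n)"
  shows "mat_conj G n x (A \<otimes>\<^bsub>Gbar G n\<^esub> B) = mat_conj G n x A \<otimes>\<^bsub>Gbar G n\<^esub> mat_conj G n x B"
proof -
  interpret W: group "Gwr G n" by (rule group_Gwr)
  have "mat_inv G x \<otimes>\<^bsub>Gbar G n\<^esub> (x \<otimes>\<^bsub>Gbar G n\<^esub> C) = C" if "C \<in> carrier (Gwr G n)" for C
    using W.m_assoc[of "mat_inv G x" x C] W.l_one[of C] assms that mat_inv_in[OF assms(1)] mat_inv_mult(1)[OF assms(1)] by simp
  then show ?thesis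
    using W.m_assoc assms by (simp add: mat_conj_def Gwr_mult_in mat_inv_in)
qed

lemma mat_conj_eqI:
  assumes "x \<in> carrier (Gwr G n)" "A \<in> carrier (Gwr G n)" "B \<in> carrier (Gwr G n)"
    and "x \<otimes>\<^bsub>Gbar G n\<^esub> A = B \<otimes>\<^bsub>Gbar G n\<^esub> x"
  shows "mat_conj G n x A = B"
proof -
  interpret W: group "Gwr G n" by (rule group_Gwr)
  show ?thesis
    using W.m_assoc[of B x "mat_inv G x"] W.r_one[of B] assms mat_inv_in[OF assms(1)] mat_inv_mult(2)[OF assms(1)]
    by (simp add: mat_conj_def)
qed

lemma mat_conj_one:
  assumes "A \<in> carrier (Gwr G n)"
  shows "mat_conj G n \<one>\<^bsub>Gbar G n\<^esub> A = A"
proof -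
  interpret W: group "Gwr G n" by (rule group_Gwr)
  show ?thesis using W.l_one[of A] W.r_one[of A] assms by (intro mat_conj_eqI) (auto simp: Gwr_one_in)
qed

lemma mat_conj_inv:
  assumes "x \<in> carrier (Gwr G n)" "A \<in> carrier (Gwr G n)"
  shows "mat_conj G n (mat_inv G x) (mat_conj G n x A) = A"
    "mat_conj G n x (mat_conj G n (mat_inv G x) A) = A"
  using assms mat_inv_in[OF assms(1)] mat_inv_mult[OF assms(1)]
  by (simp_all add: mat_conj_one flip: mat_conj_mult)

lemma mat_conj_entry:
  assumes x: "x \<in> carrier (Gwr G n)" and A: "A \<in> carrier (Gbar G n)"
    and xi: "x i' i = Some a" and xj: "x j' j = Some b"
  shows "mat_conj G n x A i' j' = map_option (\<lambda>g. a \<otimes> g \<otimes> inv b) (A i j)"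
proof -
  have xG: "x \<in> carrier (Gbar G n)" using x by (rule Gwr_Gbar)
  have iG: "mat_inv G x \<in> carrier (Gbar G n)" using mat_inv_in[OF x] by (rule Gwr_Gbar)
  have xA: "x \<otimes>\<^bsub>Gbar G n\<^esub> A \<in> carrier (Gbar G n)" using xG A by (rule mat_mult_in)
  have b: "b \<in> carrier G" using Gbar_rangeD[OF xG xj] by simp
  have 1: "x i' p = Some c \<longleftrightarrow> p = i \<and> c = a" for p c
    using xi Gbar_rowD[OF xG, of i' i a p c] by auto
  have 2: "mat_inv G x q j' = Some c \<longleftrightarrow> q = j \<and> c = inv b" for q c
    using xj b Gbar_rowD[OF xG, of j' j b q "inv c"] by (auto simp: mat_inv_Some_iff[OF xG])
  have "mat_conj G n x A i' j' = Some g \<longleftrightarrow> map_option (\<lambda>g. a \<otimes> g \<otimes> inv b) (A i j) = Some g" for g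
    unfolding mat_conj_def mat_mult_Some_iff[OF xA iG] mat_mult_Some_iff[OF xG A] 1 2 by auto
  then show ?thesis by (metis not_Some_eq)
qed

end

locale tail_conj = group G for G (structure) +
  fixes m n :: nat
  assumes fin: "finite (carrier G)" and mn: "m \<le> n"
begin

abbreviation mm (infixl "\<cdot>" 70) where "x \<cdot> y \<equiv> x \<otimes>\<^bsub>Gbar G n\<^esub> y"
abbreviation W where "W \<equiv> carrier (Gwr G n)"
abbreviation H where "H \<equiv> carrier (Gwr_tail G m n)"
abbreviation cj where "cj \<equiv> mat_conj G n"

lemma H_W: "x \<in> H \<Longrightarrow> x \<in> W" by (simp add: Gwr_tail_iff)

lemma H_diag: "x \<in> H \<Longrightarrow> i \<in> {1..m} \<Longrightarrow> x i i = Some \<one>" by (simp add: Gwr_tail_iff)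

lemma H_mult: "x \<in> H \<Longrightarrow> y \<in> H \<Longrightarrow> x \<cdot> y \<in> H"
  using subgroup.m_closed[OF subgroup_Gwr_tail[OF mn]] by simp

lemma H_inv: "x \<in> H \<Longrightarrow> mat_inv G x \<in> H"
  using subgroup.m_inv_closed[OF subgroup_Gwr_tail[OF mn], of x] by (simp add: Gwr_inv H_W)

lemma H_one: "\<one>\<^bsub>Gbar G n\<^esub> \<in> H"
  using subgroup.one_closed[OF subgroup_Gwr_tail[OF mn]] by simp

lemma H_act:
  assumes "x \<in> H"
  shows "j \<in> {1..m} \<Longrightarrow> act x j = j" "act x ` {m+1..n} = {m+1..n}"
proof -
  note xW = H_W[OF assms]
  show 1: "act x j = j" if "j \<in> {1..m}" for j
    using act_eq[OF Gwr_Gbar[OF xW] H_diag[OF assms that]] .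
  show "act x ` {m+1..n} = {m+1..n}" by (rule act_image_tail[OF xW mn 1])
qed

lemma finite_W: "finite W"
  by (rule finite_subset[OF _ finite_Gbar[OF fin, of n]]) (auto intro: Gwr_Gbar)

lemma orbit_self: "A \<in> W \<Longrightarrow> A \<in> orbit G m n A"
  unfolding orbit_def by (rule image_eqI[of _ _ "\<one>\<^bsub>Gbar G n\<^esub>"]) (simp_all add: mat_conj_one H_one)

lemma orbit_W: "A \<in> W \<Longrightarrow> B \<in> orbit G m n A \<Longrightarrow> B \<in> W"
  unfolding orbit_def by (auto intro: mat_conj_in H_W)

lemma orbit_conj:
  assumes "A \<in> W" "B \<in> orbit G m n A" "x \<in> H"
  shows "cj x B \<in> orbit G m n A"
proof -
  obtain y where y: "y \<in> H" "B = cj y A" using assms(2) by (auto simp: orbit_def)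
  then have "cj x B = cj (x \<cdot> y) A" using assms by (simp add: mat_conj_mult H_W)
  then show ?thesis using H_mult[OF assms(3) y(1)] by (auto simp: orbit_def)
qed

lemma orbit_conj_iff:
  assumes "A \<in> W" "B \<in> W" "x \<in> H"
  shows "cj x B \<in> orbit G m n A \<longleftrightarrow> B \<in> orbit G m n A"
  using orbit_conj[OF assms(1) _ assms(3), of B] orbit_conj[OF assms(1) _ H_inv[OF assms(3)], of "cj x B"]
    mat_conj_inv(1)[OF H_W[OF assms(3)] assms(2)] by auto

lemma finite_orbit: "A \<in> W \<Longrightarrow> finite (orbit G m n A)"
  using finite_subset[OF _ finite_W] orbit_W by blast

text \<open>Comparing the coefficients of \<open>a x\<close> and \<open>x a\<close> at
  \<open>x A\<close> shows that \<open>a\<close> takes the same value at \<open>A\<close> and at its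
  conjugate by \<open>x\<close>: centralizing the tail group means being constant on its
  orbits.\<close>

lemma Zwr_iff_invariant:
  "a \<in> carrier (Zwr G m n) \<longleftrightarrow> (\<forall>z. a z \<noteq> 0 \<longrightarrow> z \<in> W) \<and> (\<forall>x\<in>H. \<forall>A\<in>W. a (cj x A) = (a A :: 'f::field))"
proof -
  interpret W: group "Gwr G n" by (rule group_Gwr)
  have carr: "a \<in> carrier (FGwr G n) \<longleftrightarrow> (\<forall>z. a z \<noteq> 0 \<longrightarrow> z \<in> W)"
    using finite_subset[OF _ finite_W, of "{z. a z \<noteq> 0}"] by (auto simp: sg_alg_carrier)
  have r: "(a \<otimes>\<^bsub>FGbar G n\<^esub> basis x) (A \<cdot> x) = a A" and l: "(basis x \<otimes>\<^bsub>FGbar G n\<^esub> a) (x \<cdot> A) = a A"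
    if a: "\<forall>z. a z \<noteq> 0 \<longrightarrow> z \<in> W" and x: "x \<in> W" and A: "A \<in> W" for x A
  proof -
    have f: "fin_supp a" using a finite_subset[OF _ finite_W, of "{z. a z \<noteq> 0}"] by auto
    have "(a \<otimes>\<^bsub>FGbar G n\<^esub> basis x) (A \<cdot> x) = (\<Sum>y | a y \<noteq> 0. if y = A then a y else 0)"
      unfolding basis_mult_right lin_lift_def using a x A W.right_cancel[of x A]
      by (intro sum.cong) (auto simp: basis_def)
    then show "(a \<otimes>\<^bsub>FGbar G n\<^esub> basis x) (A \<cdot> x) = a A" using f by simp
    have "(basis x \<otimes>\<^bsub>FGbar G n\<^esub> a) (x \<cdot> A) = (\<Sum>y | a y \<noteq> 0. if y = A then a y else 0)"
      unfolding basis_mult_left lin_lift_def using a x A W.Units_l_cancel[of x A]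
      by (intro sum.cong) (auto simp: basis_def)
    then show "(basis x \<otimes>\<^bsub>FGbar G n\<^esub> a) (x \<cdot> A) = a A" using f by simp
  qed
  have cjx: "cj x A \<cdot> x = x \<cdot> A" if "x \<in> W" "A \<in> W" for x A
    using W.m_assoc[of "x \<cdot> A" "mat_inv G x" x] W.r_one[of "x \<cdot> A"] that mat_inv_in[of x n] mat_inv_mult(1)[of x n]
    by (simp add: mat_conj_def Gwr_mult_in)
  show ?thesis
  proof (intro iffI conjI ballI)
    assume a: "a \<in> carrier (Zwr G m n)"
    then have a': "\<forall>z. a z \<noteq> 0 \<longrightarrow> z \<in> W" by (simp add: Zwr_iff carr)
    then show "\<forall>z. a z \<noteq> 0 \<longrightarrow> z \<in> W" .
    fix x A assume x: "x \<in> H" and A: "A \<in> W"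
    have "a (cj x A) = (a \<otimes>\<^bsub>FGbar G n\<^esub> basis x) (x \<cdot> A)"
      using r[OF a' H_W[OF x] mat_conj_in[OF H_W[OF x] A]] cjx[OF H_W[OF x] A] by simp
    also have "\<dots> = (basis x \<otimes>\<^bsub>FGbar G n\<^esub> a) (x \<cdot> A)" using a x by (simp add: Zwr_iff)
    also have "\<dots> = a A" using l[OF a' H_W[OF x] A] .
    finally show "a (cj x A) = a A" .
  next
    assume "(\<forall>z. a z \<noteq> 0 \<longrightarrow> z \<in> W) \<and> (\<forall>x\<in>H. \<forall>A\<in>W. a (cj x A) = a A)"
    then have a': "\<forall>z. a z \<noteq> 0 \<longrightarrow> z \<in> W" and inv: "\<And>x A. x \<in> H \<Longrightarrow> A \<in> W \<Longrightarrow> a (cj x A) = a A" by auto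
    have "a \<otimes>\<^bsub>FGbar G n\<^esub> basis x = basis x \<otimes>\<^bsub>FGbar G n\<^esub> a" if x: "x \<in> H" for x
    proof
      fix z
      have ac: "a \<in> carrier (FGwr G n)" using a' carr by blast
      have bx: "basis x \<in> carrier (FGwr G n :: ('f, _) module)" using H_W[OF x] by simp
      have "a \<otimes>\<^bsub>FGwr G n\<^esub> basis x \<in> carrier (FGwr G n)" "basis x \<otimes>\<^bsub>FGwr G n\<^esub> a \<in> carrier (FGwr G n)"
        by (intro sg_alg_mult_in monoid_Gwr ac bx)+
      then have *: "(a \<otimes>\<^bsub>FGbar G n\<^esub> basis x) z = 0" "(basis x \<otimes>\<^bsub>FGbar G n\<^esub> a) z = 0" if "z \<notin> W"
        using that by (auto simp: sg_alg_carrier)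
      show "(a \<otimes>\<^bsub>FGbar G n\<^esub> basis x) z = (basis x \<otimes>\<^bsub>FGbar G n\<^esub> a) z"
      proof (cases "z \<in> W")
        case True
        define A where "A = mat_inv G x \<cdot> z"
        have A: "A \<in> W" using True H_W[OF x] mat_inv_in by (simp add: A_def Gwr_mult_in)
        have z: "z = x \<cdot> A"
          using W.m_assoc[of x "mat_inv G x" z] W.l_one[of z] True H_W[OF x] mat_inv_in[of x n] mat_inv_mult(2)[of x n]
          by (simp add: A_def)
        have "(a \<otimes>\<^bsub>FGbar G n\<^esub> basis x) z = a (cj x A)"
          using r[OF a' H_W[OF x] mat_conj_in[OF H_W[OF x] A]] cjx[OF H_W[OF x] A] z by simp
        then show ?thesis using l[OF a' H_W[OF x] A] inv[OF x A] z by simp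
      qed (simp add: *)
    qed
    then show "a \<in> carrier (Zwr G m n)" using a' carr by (simp add: Zwr_iff)
  qed
qed

lemma osum_in: "A \<in> W \<Longrightarrow> (osum G m n A :: 'a zmat \<Rightarrow> 'f::field) \<in> carrier (Zwr G m n)"
  unfolding Zwr_iff_invariant by (auto simp: osum_def orbit_conj_iff orbit_W)

lemma osum_eq_sum:
  assumes "A \<in> W"
  shows "osum G m n A = (\<lambda>z. \<Sum>B\<in>orbit G m n A. basis B z :: 'f::field)"
proof
  fix z show "osum G m n A z = (\<Sum>B\<in>orbit G m n A. basis B z :: 'f)"
    using finite_orbit[OF assms] by (simp add: osum_def basis_def)
qed

end

section \<open>Generation of the centralizer\<close>

context tail_conj
begin

text \<open>Conjugation carries the diagonal entry at \<open>i\<close> to position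
  \<open>act x i\<close> and conjugates it in \<open>G\<close>, where 1 is conjugate only to itself;
  and \<open>act x\<close> permutes the counted range.\<close>

lemma tail_deg_conj:
  assumes x: "x \<in> H" and A: "A \<in> W"
  shows "tail_deg G m n (cj x A) = tail_deg G m n A"
proof -
  have xW: "x \<in> W" using x by (rule H_W)
  have AG: "A \<in> carrier (Gbar G n)" using A by (rule Gwr_Gbar)
  have entry: "cj x A (act x i) (act x i) = Some \<one> \<longleftrightarrow> A i i = Some \<one>" if i: "i \<in> {1..n}" for i
  proof -
    obtain a where a: "a \<in> carrier G" "x (act x i) i = Some a" using act_in[OF xW i] by metis
    have "a \<otimes> g \<otimes> inv a = \<one> \<longleftrightarrow> g = \<one>" if g: "g \<in> carrier G" for g
    proof
      assume e: "a \<otimes> g \<otimes> inv a = \<one>"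
      have "a \<otimes> g = a \<otimes> g \<otimes> inv a \<otimes> a" using a(1) g by (simp add: m_assoc)
      then have "a \<otimes> g = a" using a(1) e by simp
      then show "g = \<one>" using l_cancel_one a(1) g by blast
    qed (use a(1) in simp)
    then show ?thesis
      unfolding mat_conj_entry[OF xW AG a(2) a(2)] using Gbar_rangeD[OF AG, of i i] by (cases "A i i") auto
  qed
  have "{j \<in> {m+1..n}. cj x A j j \<noteq> Some \<one>} = act x ` {j \<in> {m+1..n}. A j j \<noteq> Some \<one>}"
  proof (intro equalityI subsetI)
    fix j assume j: "j \<in> {j \<in> {m+1..n}. cj x A j j \<noteq> Some \<one>}"
    then have "j \<in> act x ` {m+1..n}" using H_act(2)[OF x] by simp
    then obtain i where i: "i \<in> {m+1..n}" "j = act x i" by (rule imageE)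
    then show "j \<in> act x ` {j \<in> {m+1..n}. A j j \<noteq> Some \<one>}" using j entry[of i] by auto
  next
    fix j assume "j \<in> act x ` {j \<in> {m+1..n}. A j j \<noteq> Some \<one>}"
    then obtain i where i: "i \<in> {m+1..n}" "j = act x i" "A i i \<noteq> Some \<one>" by auto
    have "act x i \<in> {m+1..n}" using H_act(2)[OF x] i(1) by blast
    then show "j \<in> {j \<in> {m+1..n}. cj x A j j \<noteq> Some \<one>}" using i entry[of i] by auto
  qed
  moreover have "inj_on (act x) {j \<in> {m+1..n}. A j j \<noteq> Some \<one>}"
    using act_inj[OF xW] by (intro inj_onI) auto
  ultimately show ?thesis by (simp add: tail_deg_def card_image)
qed

lemma mult_tau_entry:
  assumes B: "B \<in> carrier (Gbar G n)" and ki: "k \<in> {1..n}" "i \<in> {1..n}" "k \<noteq> i" and h: "h \<in> carrier G"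
  shows "j \<noteq> k \<Longrightarrow> j \<noteq> i \<Longrightarrow> (B \<cdot> tau G n k i h) p j = B p j"
    and "(B \<cdot> tau G n k i h) p k = map_option (\<lambda>g. g \<otimes> inv h) (B p i)"
    and "(B \<cdot> tau G n k i h) p i = map_option (\<lambda>g. g \<otimes> h) (B p k)"
proof -
  have t: "tau G n k i h \<in> carrier (Gbar G n)" using tau_in_Gwr[OF ki h] by (rule Gwr_Gbar)
  have eqI: "x = y" if "\<And>g. x = Some g \<longleftrightarrow> y = Some g" for x y :: "'a option"
    using that by (metis not_Some_eq)
  show "(B \<cdot> tau G n k i h) p j = B p j" if j: "j \<noteq> k" "j \<noteq> i"
  proof (rule eqI)
    fix g
    have "tau G n k i h q j = Some c \<longleftrightarrow> q = j \<and> j \<in> {1..n} \<and> c = \<one>" for q c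
      using j by (auto simp: tau_def)
    then show "(B \<cdot> tau G n k i h) p j = Some g \<longleftrightarrow> B p j = Some g"
      unfolding mat_mult_Some_iff[OF B t] using Gbar_rangeD[OF B, of p j] by auto
  qed
  show "(B \<cdot> tau G n k i h) p k = map_option (\<lambda>g. g \<otimes> inv h) (B p i)"
  proof (rule eqI)
    fix g
    have "tau G n k i h q k = Some c \<longleftrightarrow> q = i \<and> c = inv h" for q c
      using ki by (auto simp: tau_def)
    then show "(B \<cdot> tau G n k i h) p k = Some g \<longleftrightarrow> map_option (\<lambda>g. g \<otimes> inv h) (B p i) = Some g"
      unfolding mat_mult_Some_iff[OF B t] by auto
  qed
  show "(B \<cdot> tau G n k i h) p i = map_option (\<lambda>g. g \<otimes> h) (B p k)"
  proof (rule eqI)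
    fix g
    have "tau G n k i h q i = Some c \<longleftrightarrow> q = k \<and> c = h" for q c
      using ki by (auto simp: tau_def)
    then show "(B \<cdot> tau G n k i h) p i = Some g \<longleftrightarrow> map_option (\<lambda>g. g \<otimes> h) (B p k) = Some g"
      unfolding mat_mult_Some_iff[OF B t] by auto
  qed
qed

text \<open>Only the columns \<open>k\<close> and \<open>i\<close> change, and \<open>k\<close> is
  not counted because k \<le> m. Thus \<open>i\<close> is the one index that can be added, and it is
  new only if it lies in the tail and \<open>B\<close> has diagonal entry 1 there.\<close>

lemma tail_deg_mult_tau:
  assumes B: "B \<in> W" and k: "k \<in> {1..m}" and i: "i \<in> {k+1..n}" and h: "h \<in> carrier G"
  shows "tail_deg G m n (B \<cdot> tau G n k i h) \<le> tail_deg G m n B + 1"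
    and "i \<le> m \<or> B i i \<noteq> Some \<one> \<Longrightarrow> tail_deg G m n (B \<cdot> tau G n k i h) \<le> tail_deg G m n B"
proof -
  let ?S = "\<lambda>A. {j \<in> {m+1..n}. A j j \<noteq> Some \<one>}"
  have "k \<in> {1..n}" "i \<in> {1..n}" "k \<noteq> i" using k i mn by auto
  note e = mult_tau_entry(1)[OF Gwr_Gbar[OF B] this h]
  have sub: "?S (B \<cdot> tau G n k i h) \<subseteq> insert i (?S B)"
    using e k by auto
  have "card (?S (B \<cdot> tau G n k i h)) \<le> card (insert i (?S B))"
    by (rule card_mono[OF _ sub]) simp
  also have "\<dots> \<le> card (?S B) + 1" using card_insert_le_m1[of "card (?S B) + 1" "?S B" i] by (simp add: card_insert_if)
  finally show "tail_deg G m n (B \<cdot> tau G n k i h) \<le> tail_deg G m n B + 1" by (simp add: tail_deg_def)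
  assume i': "i \<le> m \<or> B i i \<noteq> Some \<one>"
  have "?S (B \<cdot> tau G n k i h) \<subseteq> ?S B" using sub i' i by auto
  then show "tail_deg G m n (B \<cdot> tau G n k i h) \<le> tail_deg G m n B"
    unfolding tail_deg_def by (intro card_mono) auto
qed

lemma conj_tau:
  assumes x: "x \<in> H" and k: "k \<in> {1..m}" and i: "i \<in> {m+1..n}" and h: "h \<in> carrier G"
  shows "\<exists>h1\<in>carrier G. cj x (tau G n k i h) = tau G n k (act x i) h1" "act x i \<in> {m+1..n}"
proof -
  have xW: "x \<in> W" using x by (rule H_W)
  show ai: "act x i \<in> {m+1..n}" using H_act(2)[OF x] i by blast
  have in1: "i \<in> {1..n}" "k \<in> {1..n}" "k \<noteq> i" using i k mn by auto
  obtain b where b: "b \<in> carrier G" "x (act x i) i = Some b" using act_in[OF xW in1(1)] by metis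
  have "x \<cdot> tau G n k i h = tau G n k (act x i) (\<one> \<otimes> h \<otimes> inv b) \<cdot> x"
    by (rule tau_commute[OF Gwr_Gbar[OF xW] H_diag[OF x k] b(2) in1(3) h])
  moreover have "k \<noteq> act x i" "act x i \<in> {1..n}" using ai k by auto
  ultimately have "cj x (tau G n k i h) = tau G n k (act x i) (\<one> \<otimes> h \<otimes> inv b)"
    using xW in1 h b(1) by (intro mat_conj_eqI tau_in_Gwr) auto
  then show "\<exists>h1\<in>carrier G. cj x (tau G n k i h) = tau G n k (act x i) h1"
    using h b(1) by (intro bexI[of _ "\<one> \<otimes> h \<otimes> inv b"]) auto
qed

text \<open>Where \<open>B\<close> has diagonal entry 1, its row and column contain nothing else.
  Hence a tail matrix that relabels \<open>i\<close>, or exchanges \<open>i\<close> with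
  \<open>j\<close>, commutes with \<open>B\<close>, and it can be chosen to produce any desired
  position and label of the transposition. This makes the top part of the product in
  \<open>osum_mult_Tsum\<close> a single orbit.\<close>

lemma tau_transitive:
  assumes B: "B \<in> W" and k: "k \<in> {1..m}"
    and i: "i \<in> {m+1..n}" "B i i = Some \<one>" and j: "j \<in> {m+1..n}" "B j j = Some \<one>"
    and h: "h \<in> carrier G" and h': "h' \<in> carrier G"
  shows "\<exists>y\<in>H. cj y B = B \<and> cj y (tau G n k i h) = tau G n k j h'"
proof -
  have BG: "B \<in> carrier (Gbar G n)" using B by (rule Gwr_Gbar)
  have r: "k \<in> {1..n}" "i \<in> {1..n}" "j \<in> {1..n}" "k \<noteq> i" "k \<noteq> j" using k i j mn by auto
  have *: "cj y (tau G n k i h) = tau G n k j h'"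
    if y: "y \<in> H" "y j i = Some b" and b: "h \<otimes> inv b = h'" for y b
  proof (rule mat_conj_eqI)
    have "y \<cdot> tau G n k i h = tau G n k j (\<one> \<otimes> h \<otimes> inv b) \<cdot> y"
      by (rule tau_commute[OF Gwr_Gbar[OF H_W[OF y(1)]] H_diag[OF y(1) k] y(2) r(4) h])
    then show "y \<cdot> tau G n k i h = tau G n k j h' \<cdot> y" using b h by simp
  qed (use H_W[OF y(1)] r h h' in \<open>auto intro!: tau_in_Gwr\<close>)
  show ?thesis
  proof (cases "i = j")
    case True
    \<comment> \<open>Conjugation by the diagonal matrix with \<open>c\<close> at \<open>i\<close>
      turns the label \<open>h\<close> into \<open>h inv c\<close>; this \<open>c\<close> makes it
      \<open>h'\<close>.\<close>
    define c where "c = inv h' \<otimes> h"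
    have c: "c \<in> carrier G" "h \<otimes> inv c = h'" using h h' by (simp_all add: c_def inv_mult_group flip: m_assoc)
    let ?y = "tuple_mat n (single G n i c)"
    have yW: "?y \<in> W" by (rule single_mat_in[OF c(1)])
    have "?y p p = Some \<one>" if "p \<in> {1..m}" for p
      using that i mn by (auto simp: diag_def single_def)
    then have yH: "?y \<in> H" using yW by (simp add: Gwr_tail_iff)
    have yi: "?y j i = Some c" using True r by (simp add: diag_def single_def)
    have "zmul G (Some (single G n i c p)) (B p q) = zmul G (B p q) (Some (single G n i c q))" for p q
    proof (cases "B p q")
      case (Some g)
      note R = Gbar_rangeD[OF BG Some]
      \<comment> \<open>Row and column \<open>i\<close> of \<open>B\<close> contain only the
        diagonal entry 1, which commutes with \<open>c\<close>.\<close>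
      have "p = i \<longleftrightarrow> q = i"
        using Some i(2) Gbar_rowD[OF BG, of i i \<one> q g] Gbar_colD[OF BG, of i i \<one> p g] by auto
      moreover have "g = \<one>" if "p = i" "q = i" using that i(2) Some by simp
      ultimately show ?thesis using Some R c(1) by (auto simp: single_def)
    qed simp
    then have "?y \<cdot> B = B \<cdot> ?y"
      unfolding diag_mult_left[OF Gwr_Gbar[OF yW] BG] diag_mult_right[OF Gwr_Gbar[OF yW] BG] by simp
    then have "cj ?y B = B" using yW B by (intro mat_conj_eqI)
    then show ?thesis using *[OF yH yi c(2)] yH by blast
  next
    case False
    \<comment> \<open>The entry of \<open>?y\<close> at \<open>(j, i)\<close> is
      \<open>inv c\<close>, so conjugation turns the label \<open>h\<close> into \<open>h c\<close>,
      which is \<open>h'\<close>.\<close>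
    define c where "c = inv h \<otimes> h'"
    have c: "c \<in> carrier G" "h \<otimes> inv (inv c) = h'" using h h' by (simp_all add: c_def flip: m_assoc)
    let ?y = "tau G n i j c"
    have yW: "?y \<in> W" using r False c by (intro tau_in_Gwr)
    have yH: "?y \<in> H" using yW i j mn by (auto simp: Gwr_tail_iff tau_def)
    have yi: "?y j i = Some (inv c)" using False by (simp add: tau_def)
    have "B \<cdot> ?y = ?y \<cdot> B" using tau_commute[OF BG i(2) j(2) False c(1)] c(1) by simp
    then have "cj ?y B = B" using yW B by (intro mat_conj_eqI) auto
    then show ?thesis using *[OF yH yi c(2)] yH by blast
  qed
qed

text \<open>Splitting off the labelled transposition that sends \<open>k\<close> into the tail lowers the tail
  degree by one, and multiplying back by \<open>x\<^sub>k\<close> recovers the orbit sum up to lower tail degree.\<close>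

lemma osum_mult_Tsum:
  assumes g: "\<gamma> \<in> W" and k: "k \<in> {1..m}" and gik: "\<gamma> i0 k = Some a" and i0: "i0 \<in> {m+1..n}"
  obtains \<gamma>' where "\<gamma>' \<in> W" "tail_deg G m n \<gamma> = tail_deg G m n \<gamma>' + 1"
    "\<And>\<delta>. (osum G m n \<gamma>' \<otimes>\<^bsub>FGbar G n\<^esub> Tsum G n k {k+1..n}) \<delta> \<noteq> (osum G m n \<gamma> \<delta> :: 'f::field) \<Longrightarrow>
        tail_deg G m n \<delta> < tail_deg G m n \<gamma>"
proof -
  interpret W: group "Gwr G n" by (rule group_Gwr)
  have gG: "\<gamma> \<in> carrier (Gbar G n)" using g by (rule Gwr_Gbar)
  have a: "a \<in> carrier G" using Gbar_rangeD[OF gG gik] by simp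
  have r: "k \<in> {1..n}" "i0 \<in> {1..n}" "k \<noteq> i0" using k i0 mn by auto
  \<comment> \<open>The label \<open>inv a\<close> turns the entry \<open>a\<close> of \<gamma> at
    \<open>(i0, k)\<close> into the diagonal entry 1 of \<gamma>' at \<open>i0\<close>, which is
    what lowers the tail degree.\<close>
  let ?t = "tau G n k i0 (inv a)"
  have tW: "?t \<in> W" using r a by (intro tau_in_Gwr) auto
  define \<gamma>' where "\<gamma>' = \<gamma> \<cdot> ?t"
  have g'W: "\<gamma>' \<in> W" unfolding \<gamma>'_def by (intro Gwr_mult_in g tW)
  have gg': "\<gamma> = \<gamma>' \<cdot> ?t"
    using W.m_assoc[of \<gamma> ?t ?t] W.r_one[of \<gamma>] g tW tau_sq[OF r, of "inv a"] a by (simp add: \<gamma>'_def)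
  note e = mult_tau_entry[OF gG r inv_closed[OF a]]
  have g'i: "\<gamma>' i0 i0 = Some \<one>" unfolding \<gamma>'_def e(3) gik using a by simp
  have gi: "\<gamma> i0 i0 \<noteq> Some \<one>" using Gbar_rowD[OF gG gik, of i0] r by auto
  have deg: "tail_deg G m n \<gamma> = tail_deg G m n \<gamma>' + 1"
  proof -
    have "{j \<in> {m+1..n}. \<gamma> j j \<noteq> Some \<one>} = insert i0 {j \<in> {m+1..n}. \<gamma>' j j \<noteq> Some \<one>}"
    proof (rule Set.set_eqI)
      fix j
      show "j \<in> {j \<in> {m+1..n}. \<gamma> j j \<noteq> Some \<one>} \<longleftrightarrow> j \<in> insert i0 {j \<in> {m+1..n}. \<gamma>' j j \<noteq> Some \<one>}"
        using gi i0 e(1)[of j j] k by (cases "j = i0"; cases "j = k") (auto simp: \<gamma>'_def)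
    qed
    moreover have "i0 \<notin> {j \<in> {m+1..n}. \<gamma>' j j \<noteq> Some \<one>}" using g'i by simp
    ultimately show ?thesis by (simp add: tail_deg_def)
  qed
  let ?O = "orbit G m n \<gamma>'" and ?I = "{k+1..n} \<times> carrier G"
  let ?f = "\<lambda>q. fst q \<cdot> tau G n k (fst (snd q)) (snd (snd q))"
  have OW: "B \<in> W" if "B \<in> ?O" for B using orbit_W[OF g'W that] .
  have Odeg: "tail_deg G m n B = tail_deg G m n \<gamma>'" if "B \<in> ?O" for B
    using that g'W by (auto simp: orbit_def tail_deg_conj)
  \<comment> \<open>A term reaching the degree of \<gamma> must gain one over \<open>B\<close>,
    which forces \<open>i\<close> into the tail with diagonal entry 1. Conjugating \<open>B\<close>
    back to \<gamma>' and then adjusting the transposition within the stabilizer of \<gamma>' turns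
    the term into \<gamma>.\<close>
  have key: "i \<in> {m+1..n} \<and> B i i = Some \<one> \<and> B \<cdot> tau G n k i h \<in> orbit G m n \<gamma>"
    if B: "B \<in> ?O" and i: "i \<in> {k+1..n}" and h: "h \<in> carrier G"
      and d: "tail_deg G m n \<gamma> \<le> tail_deg G m n (B \<cdot> tau G n k i h)" for B i h
  proof -
    have BW: "B \<in> W" using OW[OF B] .
    have "\<not> (i \<le> m \<or> B i i \<noteq> Some \<one>)"
      using tail_deg_mult_tau(2)[OF BW k i h] d Odeg[OF B] deg by linarith
    then have im: "i \<in> {m+1..n}" and Bi: "B i i = Some \<one>" using i by auto
    obtain x where x: "x \<in> H" "B = cj x \<gamma>'" using B by (auto simp: orbit_def)
    let ?x = "mat_inv G x"
    have x': "?x \<in> H" "?x \<in> W" using H_inv[OF x(1)] H_W by auto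
    have g'B: "\<gamma>' = cj ?x B" using mat_conj_inv(1)[OF H_W[OF x(1)] g'W] x(2) by simp
    obtain h1 where h1: "h1 \<in> carrier G" "cj ?x (tau G n k i h) = tau G n k (act ?x i) h1"
      using conj_tau(1)[OF x'(1) k im h] by blast
    have i1: "act ?x i \<in> {m+1..n}" using conj_tau(2)[OF x'(1) k im h] .
    have iN: "i \<in> {1..n}" "k \<noteq> i" using im k by auto
    obtain b where b: "b \<in> carrier G" "?x (act ?x i) i = Some b" using act_in[OF x'(2) iN(1)] by metis
    have g'1: "\<gamma>' (act ?x i) (act ?x i) = Some \<one>"
      unfolding g'B mat_conj_entry[OF x'(2) Gwr_Gbar[OF BW] b(2) b(2)] Bi using b(1) by simp
    have tW': "tau G n k i h \<in> W" using r iN h by (intro tau_in_Gwr)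
    have 1: "cj ?x (B \<cdot> tau G n k i h) = \<gamma>' \<cdot> tau G n k (act ?x i) h1"
      using mat_conj_hom[OF x'(2) BW tW'] g'B h1(2) by simp
    \<comment> \<open>Conjugation by \<open>?x\<close> has returned \<open>B\<close> to \<gamma>';
      now an element fixing \<gamma>' moves the remaining transposition to
      \<open>?t\<close>.\<close>
    obtain y where y: "y \<in> H" "cj y \<gamma>' = \<gamma>'" "cj y (tau G n k (act ?x i) h1) = ?t"
      using tau_transitive[OF g'W k i1 g'1 i0 g'i h1(1) inv_closed[OF a]] by blast
    have "act ?x i \<in> {1..n}" "k \<noteq> act ?x i" using i1 k by auto
    then have t1W: "tau G n k (act ?x i) h1 \<in> W" using r h1(1) by (intro tau_in_Gwr)
    have "cj y (cj ?x (B \<cdot> tau G n k i h)) = \<gamma>"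
      unfolding 1 mat_conj_hom[OF H_W[OF y(1)] g'W t1W] y(2,3) gg'[symmetric] ..
    then have "cj y (cj ?x (B \<cdot> tau G n k i h)) \<in> orbit G m n \<gamma>" using orbit_self[OF g] by simp
    moreover have BtW: "B \<cdot> tau G n k i h \<in> W" by (intro Gwr_mult_in BW tW')
    ultimately have "B \<cdot> tau G n k i h \<in> orbit G m n \<gamma>"
      using orbit_conj_iff[OF g mat_conj_in[OF x'(2) BtW] y(1)] orbit_conj_iff[OF g BtW x'(1)] by simp
    then show ?thesis using im Bi by blast
  qed
  \<comment> \<open>Conjugating the factorization of \<gamma> into \<gamma>' and \<open>?t\<close>
    expresses every element of its orbit as a term of the product.\<close>
  have ex: "\<exists>q\<in>?O \<times> ?I. ?f q = \<delta>" if d: "\<delta> \<in> orbit G m n \<gamma>" for \<delta>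
  proof -
    obtain x where x: "x \<in> H" "\<delta> = cj x \<gamma>" using d by (auto simp: orbit_def)
    obtain h where h: "h \<in> carrier G" "cj x ?t = tau G n k (act x i0) h"
      using conj_tau(1)[OF x(1) k i0 inv_closed[OF a]] by blast
    have "\<delta> = cj x \<gamma>' \<cdot> cj x ?t"
      using mat_conj_hom[OF H_W[OF x(1)] g'W tW] gg' x(2) by simp
    moreover have "cj x \<gamma>' \<in> ?O" using x(1) by (simp add: orbit_def)
    moreover have "act x i0 \<in> {k+1..n}" using conj_tau(2)[OF x(1) k i0 inv_closed[OF a]] k by auto
    ultimately show ?thesis using h by (intro bexI[of _ "(cj x \<gamma>', act x i0, h)"]) auto
  qed
  \<comment> \<open>The nonzero entry in column \<open>k\<close> of \<delta> is \<open>inv h\<close>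
    in row \<open>i\<close>, so \<delta> determines \<open>i\<close> and \<open>h\<close>, and then
    \<open>B\<close> by cancellation. This is why each coefficient is exactly 1.\<close>
  have uniq: "q = q'" if q: "q \<in> ?O \<times> ?I" "q' \<in> ?O \<times> ?I" "?f q = \<delta>" "?f q' = \<delta>"
    and d: "tail_deg G m n \<gamma> \<le> tail_deg G m n \<delta>" for q q' \<delta>
  proof -
    obtain B i h where 1: "q = (B, i, h)" by (metis surj_pair)
    obtain B' i' h' where 2: "q' = (B', i', h')" by (metis surj_pair)
    have in1: "B \<in> ?O" "i \<in> {k+1..n}" "h \<in> carrier G" and in2: "B' \<in> ?O" "i' \<in> {k+1..n}" "h' \<in> carrier G"
      and d1: "\<delta> = B \<cdot> tau G n k i h" and d2: "\<delta> = B' \<cdot> tau G n k i' h'"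
      using q 1 2 by auto
    have K1: "i \<in> {m+1..n}" "B i i = Some \<one>" using key[OF in1] d d1 by auto
    have K2: "i' \<in> {m+1..n}" "B' i' i' = Some \<one>" using key[OF in2] d d2 by auto
    have ri: "i \<in> {1..n}" "k \<noteq> i" and ri': "i' \<in> {1..n}" "k \<noteq> i'" using K1 K2 k by auto
    have BW: "B \<in> W" "B' \<in> W" using OW in1 in2 by auto
    have e1: "\<delta> i k = Some (inv h)"
      unfolding d1 mult_tau_entry(2)[OF Gwr_Gbar[OF BW(1)] r(1) ri in1(3)] K1(2) using in1(3) by simp
    have e2: "\<delta> i' k = Some (inv h')"
      unfolding d2 mult_tau_entry(2)[OF Gwr_Gbar[OF BW(2)] r(1) ri' in2(3)] K2(2) using in2(3) by simp
    have dG: "\<delta> \<in> carrier (Gbar G n)"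
      unfolding d1 using BW(1) r(1) ri in1(3) by (intro Gwr_Gbar Gwr_mult_in tau_in_Gwr)
    have ii: "i = i'" using Gbar_colD[OF dG e1 e2] .
    then have "inv h = inv h'" using e1 e2 by simp
    then have hh: "h = h'" using in1(3) in2(3) by (metis inv_inv)
    have tW': "tau G n k i h \<in> W" using r(1) ri in1(3) by (intro tau_in_Gwr)
    have "B = B'" using d1 d2 ii hh W.right_cancel[of "tau G n k i h" B B'] tW' BW by simp
    then show ?thesis using 1 2 ii hh by simp
  qed
  have expand: "osum G m n \<gamma>' \<otimes>\<^bsub>FGbar G n\<^esub> Tsum G n k {k+1..n} = (\<lambda>z. \<Sum>q\<in>?O \<times> ?I. basis (?f q) z :: 'f)"
  proof -
    have "osum G m n \<gamma>' \<otimes>\<^bsub>FGbar G n\<^esub> Tsum G n k {k+1..n} =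
        (\<lambda>z. \<Sum>B\<in>?O. \<Sum>p\<in>?I. (basis (B \<cdot> tau G n k (fst p) (snd p))) z :: 'f)"
      unfolding osum_eq_sum[OF g'W] Tsum_def
      by (subst sg_alg_sum_mult, simp, subst sg_alg_mult_sum, simp) (simp add: basis_mult)
    also have "\<dots> = (\<lambda>z. \<Sum>q\<in>?O \<times> ?I. basis (?f q) z)"
      by (simp add: sum.cartesian_product case_prod_unfold)
    finally show ?thesis .
  qed
  have finOI: "finite (?O \<times> ?I)" using finite_orbit[OF g'W] fin by simp
  show thesis
  proof (rule that[OF g'W deg])
    fix \<delta>
    assume ne: "(osum G m n \<gamma>' \<otimes>\<^bsub>FGbar G n\<^esub> Tsum G n k {k+1..n}) \<delta> \<noteq> (osum G m n \<gamma> \<delta> :: 'f)"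
    show "tail_deg G m n \<delta> < tail_deg G m n \<gamma>"
    proof (rule ccontr)
      assume "\<not> ?thesis"
      then have d: "tail_deg G m n \<gamma> \<le> tail_deg G m n \<delta>" by simp
      \<comment> \<open>The coefficient at \<delta> counts factorizations: exactly one inside the
        orbit of \<gamma> by \<open>ex\<close> and \<open>uniq\<close>, none outside by
        \<open>key\<close>.\<close>
      have "(\<Sum>q\<in>?O \<times> ?I. basis (?f q) \<delta>) = (osum G m n \<gamma> \<delta> :: 'f)"
      proof (cases "\<delta> \<in> orbit G m n \<gamma>")
        case True
        obtain q0 where q0: "q0 \<in> ?O \<times> ?I" "?f q0 = \<delta>" using ex[OF True] by blast
        have "(\<Sum>q\<in>?O \<times> ?I. basis (?f q) \<delta>) = (\<Sum>q\<in>?O \<times> ?I. if q = q0 then 1 else 0 :: 'f)"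
        proof (rule sum.cong[OF refl])
          fix q assume "q \<in> ?O \<times> ?I"
          then have "?f q = \<delta> \<longleftrightarrow> q = q0" using uniq[OF _ q0(1) _ q0(2) d] q0(2) by blast
          then show "basis (?f q) \<delta> = (if q = q0 then 1 else 0 :: 'f)" by (auto simp: basis_def)
        qed
        also have "\<dots> = 1" using finOI q0(1) by (simp only: sum.delta) simp
        finally show ?thesis using True by (simp add: osum_def)
      next
        case False
        have "basis (?f q) \<delta> = (0 :: 'f)" if "q \<in> ?O \<times> ?I" for q
        proof -
          obtain B i h where 1: "q = (B, i, h)" by (metis surj_pair)
          have "?f q \<noteq> \<delta>" using key[of B i h] that d False 1 by auto
          then show ?thesis by (auto simp: basis_def)
        qed
        then show ?thesis using False by (simp add: osum_def)
      qed
      then show False using ne unfolding expand by simp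
    qed
  qed
qed

text \<open>The embedded corner of \<gamma> commutes with the tail group, so conjugation acts on the
  other factor alone, and left multiplication by it carries the orbit of \<open>c\<close> onto that
  of \<gamma>.\<close>

lemma osum_head_tail:
  assumes g: "\<gamma> \<in> W" and head: "\<And>j. j \<in> {1..m} \<Longrightarrow> act \<gamma> j \<in> {1..m}"
  obtains A c where "A \<in> carrier (Gwr G m)" "c \<in> H"
    "osum G m n \<gamma> = (basis (embed_mat G m n A) \<otimes>\<^bsub>FGbar G n\<^esub> osum G m n c :: 'a zmat \<Rightarrow> 'f::field)"
proof -
  interpret W: group "Gwr G n" by (rule group_Gwr)
  have gG: "\<gamma> \<in> carrier (Gbar G n)" using g by (rule Gwr_Gbar)
  define A where "A = corner m \<gamma>"
  have AG: "A \<in> carrier (Gbar G m)" unfolding A_def by (rule corner_in[OF gG])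
  have col: "\<exists>b. \<gamma> (act \<gamma> j) j = Some b \<and> b \<in> carrier G" if j: "j \<in> {1..m}" for j
  proof -
    have "j \<in> {1..n}" using j mn by auto
    then show ?thesis using act_in[OF g] by metis
  qed
  have "act \<gamma> ` {1..m} = {1..m}"
  proof (rule endo_inj_surj)
    show "act \<gamma> ` {1..m} \<subseteq> {1..m}" using head by blast
    show "inj_on (act \<gamma>) {1..m}" using act_inj[OF g] mn by (intro inj_onI) auto
  qed simp
  then have row: "\<exists>j\<in>{1..m}. i = act \<gamma> j" if "i \<in> {1..m}" for i using that by blast
  have "\<exists>j b. A i j = Some b" if i: "i \<in> {1..m}" for i
  proof -
    obtain j where j: "j \<in> {1..m}" "i = act \<gamma> j" using row[OF i] by blast
    obtain b where "\<gamma> (act \<gamma> j) j = Some b" using col[OF j(1)] by blast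
    then have "A i j = Some b" using i j by (simp add: A_def corner_Some_iff)
    then show ?thesis by blast
  qed
  moreover have "\<exists>i b. A i j = Some b" if j: "j \<in> {1..m}" for j
  proof -
    obtain b where "\<gamma> (act \<gamma> j) j = Some b" using col[OF j] by blast
    then have "A (act \<gamma> j) j = Some b" using j head[OF j] by (simp add: A_def corner_Some_iff)
    then show ?thesis by blast
  qed
  ultimately have A: "A \<in> carrier (Gwr G m)" using AG by (simp add: Gwr_iff)
  let ?w = "embed_mat G m n A"
  have wW: "?w \<in> W" by (rule embed_in_Gwr[OF A mn])
  have iW: "mat_inv G ?w \<in> W" by (rule mat_inv_in[OF wW])
  define c where "c = mat_inv G ?w \<cdot> \<gamma>"
  have cW: "c \<in> W" unfolding c_def by (intro Gwr_mult_in iW g)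
  have wc: "\<gamma> = ?w \<cdot> c"
    using W.m_assoc[of ?w "mat_inv G ?w" \<gamma>] W.l_one[of \<gamma>] wW iW g mat_inv_mult(2)[OF wW] by (simp add: c_def)
  \<comment> \<open>The columns \<open>j\<close> of \<gamma> and of \<open>?w\<close> have the same
    entry \<open>b\<close>, so the product with the inverse has \<open>inv b\<close> times
    \<open>b\<close> here.\<close>
  have "c j j = Some \<one>" if j: "j \<in> {1..m}" for j
  proof -
    obtain b where b: "\<gamma> (act \<gamma> j) j = Some b" "b \<in> carrier G" using col[OF j] by blast
    have "?w (act \<gamma> j) j = Some b" using b j head[OF j] by (simp add: embed_Some_iff A_def corner_Some_iff)
    then have "mat_inv G ?w j (act \<gamma> j) = Some (inv b)" by (simp add: mat_inv_def)
    then show ?thesis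
      unfolding c_def mat_mult_Some_iff[OF Gwr_Gbar[OF iW] gG]
      using b by (intro exI[of _ "act \<gamma> j"] exI[of _ "inv b"] exI[of _ b]) simp
  qed
  then have cH: "c \<in> H" using cW by (simp add: Gwr_tail_iff)
  have com: "cj x ?w = ?w" if x: "x \<in> H" for x
    using embed_commute_tail[OF AG mn Gwr_tail_Gbar_tail[OF x]] by (intro mat_conj_eqI H_W[OF x] wW) simp
  have orb: "orbit G m n \<gamma> = (\<lambda>B. ?w \<cdot> B) ` orbit G m n c"
    unfolding orbit_def image_image
  proof (rule image_cong[OF refl])
    fix x assume x: "x \<in> H"
    show "cj x \<gamma> = ?w \<cdot> cj x c"
      using mat_conj_hom[OF H_W[OF x] wW cW] wc com[OF x] by simp
  qed
  have "osum G m n \<gamma> = (basis ?w \<otimes>\<^bsub>FGbar G n\<^esub> osum G m n c :: 'a zmat \<Rightarrow> 'f)"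
  proof -
    have inj: "inj_on (\<lambda>B. ?w \<cdot> B) (orbit G m n c)"
      using W.Units_l_cancel[of ?w] orbit_W[OF cW] wW by (intro inj_onI) auto
    have "osum G m n \<gamma> = (\<lambda>z. \<Sum>B\<in>orbit G m n c. basis (?w \<cdot> B) z :: 'f)"
      unfolding osum_eq_sum[OF g] orb by (simp add: sum.reindex[OF inj])
    also have "\<dots> = basis ?w \<otimes>\<^bsub>FGbar G n\<^esub> osum G m n c"
      unfolding osum_eq_sum[OF cW] by (simp add: sg_alg_mult_sum basis_mult)
    finally show ?thesis .
  qed
  then show thesis using that[OF A cH] by blast
qed

section \<open>Class sums and the centre of the tail algebra\<close>

lemma monoid_tail: "monoid (Gwr_tail G m n)"
proof -
  interpret W: group "Gwr G n" by (rule group_Gwr)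
  show ?thesis
    by (rule monoidI) (auto simp: H_mult H_one H_W W.m_assoc[simplified] W.l_one[simplified] W.r_one[simplified])
qed

lemma tail_alg_simps [simp]:
  "monoid.mult (sg_alg (Gwr_tail G m n)) = monoid.mult (FGbar G n)"
  "add (sg_alg (Gwr_tail G m n)) = add (FGbar G n)"
  "smult (sg_alg (Gwr_tail G m n)) = smult (FGbar G n)"
  "one (sg_alg (Gwr_tail G m n)) = one (FGbar G n)"
  by (simp_all add: sg_alg_def)

text \<open>For \<open>c\<close> in the tail group the orbit is its conjugacy class there. The
  elements commuting with the class sum form a subalgebra containing every basis vector, hence
  everything.\<close>

lemma osum_in_center:
  assumes c: "c \<in> H"
  shows "(osum G m n c :: 'a zmat \<Rightarrow> 'f::field) \<in> center_of (sg_alg (Gwr_tail G m n))"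
proof -
  let ?T = "sg_alg (Gwr_tail G m n) :: ('f, 'a zmat \<Rightarrow> 'f) module"
  have "orbit G m n c \<subseteq> H"
    unfolding orbit_def mat_conj_def using c by (auto intro!: H_mult H_inv)
  then have o: "osum G m n c \<in> carrier ?T"
    unfolding osum_eq_sum[OF H_W[OF c]] by (intro sg_alg_sum_in) auto
  have "subalg ?T (centralizer_in ?T {osum G m n c})"
    by (rule centralizer_subalg[OF monoid_tail]) (use o in simp)
  then have "carrier ?T \<subseteq> centralizer_in ?T {osum G m n c}"
  proof (rule sg_alg_subset_subalg)
    fix x assume "x \<in> H"
    then show "basis x \<in> centralizer_in ?T {osum G m n c}"
      using osum_in[OF H_W[OF c], where 'f = 'f] by (simp add: centralizer_in_def Zwr_iff)
  qed
  then show ?thesis using o by (auto simp: center_of_def centralizer_in_def)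
qed

lemma center_tail_in_Zwr:
  "center_of (sg_alg (Gwr_tail G m n)) \<subseteq> carrier (Zwr G m n :: ('f::field, _) module)"
proof
  let ?T = "sg_alg (Gwr_tail G m n) :: ('f, 'a zmat \<Rightarrow> 'f) module"
  fix a assume a: "a \<in> center_of ?T"
  then have "a \<in> carrier ?T" by (simp add: center_of_def centralizer_in_def)
  then have "a \<in> carrier (FGwr G n)" by (auto simp: sg_alg_carrier H_W)
  moreover have "a \<otimes>\<^bsub>FGbar G n\<^esub> basis x = basis x \<otimes>\<^bsub>FGbar G n\<^esub> a" if "x \<in> H" for x
    using a that by (simp add: center_of_def centralizer_in_def)
  ultimately show "a \<in> carrier (Zwr G m n)" by (simp add: Zwr_iff)
qed

text \<open>An invariant vector is constant on orbits, so subtracting a multiple of an orbit sum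
  clears a whole orbit from the support. The bound \<open>d\<close> lets the lemma serve within the
  induction on the tail degree and, with a bound exceeding all degrees, at its end.\<close>

lemma span_osum:
  fixes a :: "'a zmat \<Rightarrow> 'f::field"
  assumes B: "subalg (Zwr G m n) B"
    and O: "\<And>\<gamma>. \<gamma> \<in> W \<Longrightarrow> tail_deg G m n \<gamma> < d \<Longrightarrow> osum G m n \<gamma> \<in> B"
    and a: "a \<in> carrier (Zwr G m n)" and d: "\<And>\<gamma>. a \<gamma> \<noteq> 0 \<Longrightarrow> tail_deg G m n \<gamma> < d"
  shows "a \<in> B"
  using a d
proof (induction "card {\<gamma>. a \<gamma> \<noteq> 0}" arbitrary: a rule: less_induct)
  case (less a)
  have Z: "subalg (FGwr G n) (carrier (Zwr G m n) :: ('a zmat \<Rightarrow> 'f) set)" by (rule centralizer_Zwr[OF mn])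
  have sm: "(\<lambda>z. c * b z) \<in> B" if "b \<in> B" for c b
    using B that by (auto simp: subalg_def sg_alg_ops)
  have ad: "(\<lambda>z. b z + c z) \<in> B" if "b \<in> B" "c \<in> B" for b c
    using B that by (auto simp: subalg_def sg_alg_ops)
  note inv = less.prems(1)[unfolded Zwr_iff_invariant]
  show ?case
  proof (cases "\<exists>\<gamma>. a \<gamma> \<noteq> 0")
    case False
    then have "a = (\<lambda>z. 0 * (\<one>\<^bsub>Zwr G m n\<^esub> :: 'a zmat \<Rightarrow> 'f) z)" by auto
    moreover have "(\<one>\<^bsub>Zwr G m n\<^esub> :: 'a zmat \<Rightarrow> 'f) \<in> B" using B by (simp add: subalg_def)
    ultimately show ?thesis using sm by metis
  next
    case True
    then obtain \<gamma> where g: "a \<gamma> \<noteq> 0" by blast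
    have gW: "\<gamma> \<in> W" using inv g by blast
    define b where "b z = a z + (- a \<gamma>) * osum G m n \<gamma> z" for z
    have aO: "a \<delta> = a \<gamma>" if "\<delta> \<in> orbit G m n \<gamma>" for \<delta>
      using that inv gW by (auto simp: orbit_def)
    have b0: "b z = (if z \<in> orbit G m n \<gamma> then 0 else a z)" for z
      using aO by (simp add: b_def osum_def)
    have "b \<in> carrier (Zwr G m n)"
      using osum_in[OF gW, where 'f = 'f] less.prems(1) Z
      unfolding b_def by (auto simp: subalg_def sg_alg_ops simp del: mult_minus_left)
    moreover have "{z. b z \<noteq> 0} \<subset> {z. a z \<noteq> 0}"
      using g orbit_self[OF gW] by (auto simp: b0)
    moreover have "finite {z. a z \<noteq> 0}" using less.prems(1) by (simp add: Zwr_iff sg_alg_carrier)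
    moreover have "b \<delta> \<noteq> 0 \<Longrightarrow> tail_deg G m n \<delta> < d" for \<delta>
      using less.prems(2)[of \<delta>] by (auto simp: b0 split: if_splits)
    ultimately have "b \<in> B" using less.hyps[of b] by (simp add: psubset_card_mono)
    moreover have "(\<lambda>z. a \<gamma> * osum G m n \<gamma> z) \<in> B"
      by (intro sm O gW less.prems(2) g)
    ultimately have "(\<lambda>z. b z + a \<gamma> * osum G m n \<gamma> z) \<in> B" by (rule ad)
    then show ?thesis by (simp add: b_def)
  qed
qed

lemma Zwr_generate:
  fixes B :: "('a zmat \<Rightarrow> 'f::field) set"
  assumes B: "subalg (Zwr G m n) B"
    and cen: "center_of (sg_alg (Gwr_tail G m n)) \<subseteq> B"
    and emb: "\<And>A. A \<in> carrier (Gwr G m) \<Longrightarrow> basis (embed_mat G m n A) \<in> B"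
    and X: "\<And>l. l \<in> {1..m} \<Longrightarrow> Tsum G n l {l+1..n} \<in> B"
  shows "carrier (Zwr G m n) \<subseteq> B"
proof -
  have Z: "subalg (FGwr G n) (carrier (Zwr G m n) :: ('a zmat \<Rightarrow> 'f) set)" by (rule centralizer_Zwr[OF mn])
  have BZ: "B \<subseteq> carrier (Zwr G m n)" using B by (simp add: subalg_def)
  have mult: "b \<otimes>\<^bsub>FGbar G n\<^esub> c \<in> B" and ad: "(\<lambda>z. b z + c z) \<in> B" if "b \<in> B" "c \<in> B" for b c
    using B that by (auto simp: subalg_def sg_alg_ops)
  have Zad: "(\<lambda>z. b z + c z) \<in> carrier (Zwr G m n)"
    if "b \<in> carrier (Zwr G m n)" "c \<in> carrier (Zwr G m n)" for b c :: "'a zmat \<Rightarrow> 'f"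
    using Z that by (auto simp: subalg_def sg_alg_ops)
  have Zsm: "(\<lambda>z. r * b z) \<in> carrier (Zwr G m n)"
    if "b \<in> carrier (Zwr G m n)" for b :: "'a zmat \<Rightarrow> 'f" and r
    using Z that by (auto simp: subalg_def sg_alg_ops)
  have O: "osum G m n \<gamma> \<in> B" if gW: "\<gamma> \<in> W" for \<gamma>
    using gW
  proof (induction "tail_deg G m n \<gamma>" arbitrary: \<gamma> rule: less_induct)
    case (less \<gamma>)
    show ?case
    proof (cases "\<forall>j\<in>{1..m}. act \<gamma> j \<in> {1..m}")
      case True
      obtain A c where "A \<in> carrier (Gwr G m)" "c \<in> H"
        "osum G m n \<gamma> = (basis (embed_mat G m n A) \<otimes>\<^bsub>FGbar G n\<^esub> osum G m n c :: 'a zmat \<Rightarrow> 'f)"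
        using osum_head_tail[OF less.prems, where 'f = 'f] True by blast
      then show ?thesis using mult emb osum_in_center[of c, where 'f = 'f] cen by (metis subsetD)
    next
      case False
      then obtain k where k: "k \<in> {1..m}" "act \<gamma> k \<notin> {1..m}" by blast
      have kn: "k \<in> {1..n}" using k mn by auto
      obtain a where a: "\<gamma> (act \<gamma> k) k = Some a" "act \<gamma> k \<in> {1..n}" using act_in[OF less.prems kn] by metis
      have i: "act \<gamma> k \<in> {m+1..n}" using a k by auto
      obtain \<gamma>' where g': "\<gamma>' \<in> W" "tail_deg G m n \<gamma> = tail_deg G m n \<gamma>' + 1"
        and low: "\<And>\<delta>. (osum G m n \<gamma>' \<otimes>\<^bsub>FGbar G n\<^esub> Tsum G n k {k+1..n}) \<delta> \<noteq> (osum G m n \<gamma> \<delta> :: 'f) \<Longrightarrow>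
          tail_deg G m n \<delta> < tail_deg G m n \<gamma>"
        using osum_mult_Tsum[OF less.prems k(1) a(1) i, where 'f = 'f] by blast
      define p where "p = (osum G m n \<gamma>' \<otimes>\<^bsub>FGbar G n\<^esub> Tsum G n k {k+1..n} :: 'a zmat \<Rightarrow> 'f)"
      have pB: "p \<in> B" unfolding p_def using g' by (intro mult X k(1) less.hyps) auto
      \<comment> \<open>Multiplication is triangular: the difference is invariant and supported in
        smaller tail degree, so \<open>span_osum\<close> reduces it to the induction
        hypothesis.\<close>
      have "(\<lambda>z. osum G m n \<gamma> z + (- 1) * p z) \<in> B"
      proof (rule span_osum[OF B, of "tail_deg G m n \<gamma>"])
        show "(\<lambda>z. osum G m n \<gamma> z + (- 1) * p z) \<in> carrier (Zwr G m n)"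
        proof -
          have "p \<in> carrier (Zwr G m n)" using pB BZ by blast
          then show ?thesis by (intro Zad Zsm osum_in less.prems)
        qed
        show "tail_deg G m n \<delta> < tail_deg G m n \<gamma>" if "osum G m n \<gamma> \<delta> + (- 1) * p \<delta> \<noteq> 0" for \<delta>
          using that by (intro low) (auto simp: p_def)
      qed (use less.hyps in blast)
      from ad[OF this pB] show ?thesis by simp
    qed
  qed
  show ?thesis
  proof
    fix a :: "'a zmat \<Rightarrow> 'f" assume a: "a \<in> carrier (Zwr G m n)"
    show "a \<in> B"
    \<comment> \<open>There are \<open>n - m\<close> tail indices, so every tail degree is below
      this bound.\<close>
    proof (rule span_osum[OF B _ a, of "Suc (n - m)"])
      show "tail_deg G m n \<gamma> < Suc (n - m)" for \<gamma> :: "'a zmat"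
      proof -
        have "card {j \<in> {m+1..n}. \<gamma> j j \<noteq> Some \<one>} \<le> card {m+1..n}" by (rule card_mono) auto
        then show ?thesis by (simp add: tail_deg_def)
      qed
    qed (rule O)
  qed
qed

lemma Zwr_eq_gen_alg:
  fixes \<Psi> :: "('a hgen list \<Rightarrow> 'f::field) set \<Rightarrow> 'a zmat \<Rightarrow> 'f"
  assumes P: "is_Psi G m n \<Psi>"
  shows "carrier (Zwr G m n) =
    gen_alg (Zwr G m n) (center_of (sg_alg (Gwr_tail G m n)) \<union> \<Psi> ` carrier (hecke G m))"
    (is "_ = gen_alg ?Z ?X")
proof
  have P': "\<Psi> \<in> alg_hom (hecke G m) ?Z" "\<And>x. x \<in> hgens G m \<Longrightarrow> \<Psi> (hecke_gen G m x) = hgen_val G m n x"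
    using P unfolding is_Psi_iff[OF mn] by blast+
  have Z: "subalg ?Z (carrier ?Z)"
    using centralizer_Zwr[OF mn, where 'f = 'f] by (simp add: subalg_def)
  have X: "?X \<subseteq> carrier ?Z" using center_tail_in_Zwr alg_homD(1)[OF P'(1)] by blast
  show "gen_alg ?Z ?X \<subseteq> carrier ?Z" by (rule gen_alg_least[OF Z X])
  let ?B = "gen_alg ?Z ?X"
  note B = subalg_gen_alg[OF Z X]
  have gen: "hgen_val G m n x \<in> ?B" if x: "x \<in> hgens G m" for x
  proof -
    have "(basis [x] :: 'a hgen list \<Rightarrow> 'f) \<in> carrier (hecke_free G m)"
      using x by (auto simp: hecke_free_basis_in)
    then have "hecke_gen G m x \<in> carrier (hecke G m :: ('f, _) module)"
      unfolding hecke_gen_def hecke_proj(2) by blast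
    then have "\<Psi> (hecke_gen G m x) \<in> ?X" by (intro UnI2 imageI)
    then have "\<Psi> (hecke_gen G m x) \<in> ?B" using B(2) by (rule subsetD[rotated])
    then show ?thesis unfolding P'(2)[OF x] .
  qed
  show "carrier ?Z \<subseteq> ?B"
  proof (rule Zwr_generate[OF B(1)])
    show "center_of (sg_alg (Gwr_tail G m n)) \<subseteq> ?B" using B(2) by blast
    show "Tsum G n l {l+1..n} \<in> ?B" if "l \<in> {1..m}" for l using gen[of "GenX l"] that by simp
    fix A assume A: "A \<in> carrier (Gwr G m)"
    \<comment> \<open>So far only images of generators are known to lie in the algebra;
      \<open>Gwr_generate\<close> extends this to all of \<open>Gwr G m\<close>.\<close>
    let ?M = "{A \<in> carrier (Gwr G m). basis (embed_mat G m n A) \<in> ?B}"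
    have "A \<in> ?M"
    proof (rule Gwr_generate[OF _ _ _ _ A])
      show "\<one>\<^bsub>Gbar G m\<^esub> \<in> ?M"
        using B(1) by (simp add: Gwr_one_in embed_one mn subalg_def sg_alg_ops)
      show "C \<otimes>\<^bsub>Gbar G m\<^esub> D \<in> ?M" if "C \<in> ?M" "D \<in> ?M" for C D
      proof -
        have "basis (embed_mat G m n C) \<otimes>\<^bsub>FGbar G n\<^esub> basis (embed_mat G m n D) \<in> ?B"
          using B(1) that by (simp add: subalg_def)
        then show ?thesis using that by (simp add: basis_mult embed_mult Gwr_Gbar mn Gwr_mult_in)
      qed
      show "transp_mat G m k (k+1) \<in> ?M" if k: "k \<in> {1..<m}" for k
      proof -
        have "k \<in> {1..m}" "k+1 \<in> {1..m}" using k by auto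
        then have "transp_mat G m k (k+1) \<in> carrier (Gwr G m)" by (rule transp_mat_in)
        moreover have "basis (transp_mat G n k (k+1)) \<in> ?B" using gen[of "GenS k"] k by simp
        ultimately show ?thesis using transp_mat_embed[OF k mn] by simp
      qed
      show "tuple_mat m g \<in> ?M" if g: "g \<in> carrier (Gpow G m)" for g
        using tuple_mat_in[OF g] gen[of "GenG g"] g by simp
    qed
    then show "basis (embed_mat G m n A) \<in> ?B" by simp
  qed
qed

end

section \<open>The algebra of sequences\<close>

lemma elem_deg_le_iff:
  assumes "fin_supp a"
  shows "elem_deg G n a \<le> D \<longleftrightarrow> (\<forall>A. a A \<noteq> 0 \<longrightarrow> mat_deg G n A \<le> D)"
  using assms by (auto simp: elem_deg_def)

lemma sg_alg_mult_supp:
  fixes a b :: "'a \<Rightarrow> 'f::field"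
  assumes "(a \<otimes>\<^bsub>sg_alg S\<^esub> b) z \<noteq> 0"
  obtains x y where "a x \<noteq> 0" "b y \<noteq> 0" "z = x \<otimes>\<^bsub>S\<^esub> y"
proof -
  obtain x where x: "a x \<noteq> 0" "lin_lift (\<lambda>y. basis (x \<otimes>\<^bsub>S\<^esub> y)) b z \<noteq> 0"
    using assms lin_lift_supp[of "\<lambda>x. lin_lift (\<lambda>y. basis (x \<otimes>\<^bsub>S\<^esub> y)) b" a]
    unfolding sg_alg_mult by blast
  obtain y where "b y \<noteq> 0" "basis (x \<otimes>\<^bsub>S\<^esub> y) z \<noteq> (0 :: 'f)"
    using x(2) lin_lift_supp[of "\<lambda>y. basis (x \<otimes>\<^bsub>S\<^esub> y)" b] by blast
  then show thesis using that x(1) by (auto simp: basis_def split: if_splits)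
qed

lemma alg_hom_sum:
  fixes \<phi> :: "('a \<Rightarrow> 'f::field) \<Rightarrow> 'b \<Rightarrow> 'f"
  assumes phi: "\<phi> \<in> alg_hom (sg_alg S) (sg_alg T)" and I: "finite I" "\<And>i. i \<in> I \<Longrightarrow> f i \<in> carrier (sg_alg S)"
  shows "\<phi> (\<lambda>z. \<Sum>i\<in>I. f i z) = (\<lambda>z. \<Sum>i\<in>I. \<phi> (f i) z)"
  using I
proof (induction I rule: finite_induct)
  case empty
  show ?case using alg_homD(4)[OF phi, of "\<lambda>z. 0" 0] by (simp add: sg_alg_ops)
next
  case (insert i I)
  then have "(\<lambda>z. \<Sum>i\<in>I. f i z) \<in> carrier (sg_alg S)" by (intro sg_alg_sum_in) auto
  then show ?case using insert alg_homD(3)[OF phi, of "f i" "\<lambda>z. \<Sum>i\<in>I. f i z"] by (simp add: sg_alg_ops)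
qed

context group
begin

lemma Zbar_subalg: "subalg (FGbar G n) (carrier (Zbar G m n) :: ('a zmat \<Rightarrow> 'f::field) set)"
  by (simp add: Zbar_def, rule centralizer_subalg[OF monoid_Gbar]) (auto simp: Gbar_tail_iff)

lemma Zbar_iff: "a \<in> carrier (Zbar G m n) \<longleftrightarrow> a \<in> carrier (FGbar G n) \<and>
   (\<forall>x\<in>carrier (Gbar_tail G m n). a \<otimes>\<^bsub>FGbar G n\<^esub> basis x = basis x \<otimes>\<^bsub>FGbar G n\<^esub> a)"
  by (simp add: Zbar_def centralizer_in_def)

lemma theta_eq: "fin_supp a \<Longrightarrow> theta n a = lin_lift (\<lambda>x. basis (corner (n - 1) x)) a"
  by (simp add: theta_def lin_ext_eq_lin_lift)

lemma theta_mult: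
  fixes a b :: "'a zmat \<Rightarrow> 'f::field"
  assumes n: "m < n" and a: "a \<in> carrier (Zbar G m n)" and b: "b \<in> carrier (Zbar G m n)"
  shows "theta n (a \<otimes>\<^bsub>FGbar G n\<^esub> b) = theta n a \<otimes>\<^bsub>FGbar G (n - 1)\<^esub> theta n b"
proof -
  let ?R = "FGbar G n :: ('f, 'a zmat \<Rightarrow> 'f) module"
  interpret R: ring ?R by (rule sg_alg_ring[OF monoid_Gbar])
  let ?e = "basis (eps_mat G n n) :: 'a zmat \<Rightarrow> 'f"
  have aR: "a \<in> carrier ?R" and bR: "b \<in> carrier ?R" using a b by (simp_all add: Zbar_iff)
  have eR: "?e \<in> carrier ?R" by (simp add: eps_mat_in)
  \<comment> \<open>As m < n, this idempotent lies in the tail semigroup, so \<open>a\<close>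
    commutes with it.\<close>
  have "eps_mat G n n i i = Some \<one>" if "i \<in> {1..m}" for i
    using that n by (simp add: eps_mat_def diag_def)
  then have "eps_mat G n n \<in> carrier (Gbar_tail G m n)"
    by (simp add: Gbar_tail_iff eps_mat_in)
  then have com: "a \<otimes>\<^bsub>?R\<^esub> ?e = ?e \<otimes>\<^bsub>?R\<^esub> a" using a by (simp add: Zbar_iff)
  have abR: "a \<otimes>\<^bsub>?R\<^esub> b \<in> carrier ?R" using aR bR by blast
  have fa: "fin_supp a" and fb: "fin_supp b" and fab: "fin_supp (a \<otimes>\<^bsub>?R\<^esub> b)"
    using sg_alg_fin aR bR abR by blast+
  have Ga: "x \<in> carrier (Gbar G n)" if "a x \<noteq> 0" for x using aR that by (simp add: sg_alg_carrier)
  have Gb: "x \<in> carrier (Gbar G n)" if "b x \<noteq> 0" for x using bR that by (simp add: sg_alg_carrier)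
  have Gab: "x \<in> carrier (Gbar G n)" if "(a \<otimes>\<^bsub>?R\<^esub> b) x \<noteq> 0" for x using abR that by (simp add: sg_alg_carrier)
  let ?c = "\<lambda>x. basis (corner (n - 1) x) :: 'a zmat \<Rightarrow> 'f"
  \<comment> \<open>Left multiplication by \<open>eps_mat G n n\<close> clears row \<open>n\<close>,
    which the corner does not see.\<close>
  have "lin_lift ?c (a \<otimes>\<^bsub>?R\<^esub> b) = lin_lift (\<lambda>x. ?c (eps_mat G n n \<otimes>\<^bsub>Gbar G n\<^esub> x)) (a \<otimes>\<^bsub>?R\<^esub> b)"
    by (rule lin_lift_cong) (use n Gab corner_eps(1)[of _ n "n - 1"] in simp)
  also have "\<dots> = lin_lift ?c (?e \<otimes>\<^bsub>?R\<^esub> (a \<otimes>\<^bsub>?R\<^esub> b))"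
    unfolding basis_mult_left using fab by (subst lin_lift_lin_lift) auto
  also have "?e \<otimes>\<^bsub>?R\<^esub> (a \<otimes>\<^bsub>?R\<^esub> b) = a \<otimes>\<^bsub>?R\<^esub> (?e \<otimes>\<^bsub>?R\<^esub> b)"
    using R.m_assoc[OF eR aR bR] R.m_assoc[OF aR eR bR] com by simp
  also have "a \<otimes>\<^bsub>?R\<^esub> (?e \<otimes>\<^bsub>?R\<^esub> b) =
      lin_lift (\<lambda>x. lin_lift (\<lambda>y. basis (x \<otimes>\<^bsub>Gbar G n\<^esub> (eps_mat G n n \<otimes>\<^bsub>Gbar G n\<^esub> y))) b) a"
    unfolding basis_mult_left unfolding sg_alg_mult using fb by (simp add: lin_lift_lin_lift)
  also have "lin_lift ?c \<dots> =
      lin_lift (\<lambda>x. lin_lift (\<lambda>y. ?c (x \<otimes>\<^bsub>Gbar G n\<^esub> (eps_mat G n n \<otimes>\<^bsub>Gbar G n\<^esub> y))) b) a"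
    using fa fb by (simp add: lin_lift_lin_lift fin_supp_lin_lift)
  also have "\<dots> = lin_lift (\<lambda>x. lin_lift (\<lambda>y. basis (corner (n - 1) x \<otimes>\<^bsub>Gbar G (n - 1)\<^esub> corner (n - 1) y)) b) a"
    using n by (intro lin_lift_cong) (simp add: corner_mult[OF Ga Gb])
  also have "\<dots> = lin_lift ?c a \<otimes>\<^bsub>FGbar G (n - 1)\<^esub> lin_lift ?c b"
    using fa fb by (simp add: sg_alg_mult lin_lift_lin_lift fin_supp_lin_lift)
  finally show ?thesis by (simp add: theta_eq fa fb fab)
qed

text \<open>An index with diagonal entry 1 in both factors keeps it in the product. This makes
  bounded degree stable under multiplication of sequences.\<close>

lemma mat_deg_mult:
  assumes A: "A \<in> carrier (Gbar G n)" and B: "B \<in> carrier (Gbar G n)"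
  shows "mat_deg G n (A \<otimes>\<^bsub>Gbar G n\<^esub> B) \<le> mat_deg G n A + mat_deg G n B"
proof -
  have "(A \<otimes>\<^bsub>Gbar G n\<^esub> B) k k = Some \<one>" if "A k k = Some \<one>" "B k k = Some \<one>" for k
    unfolding mat_mult_Some_iff[OF A B] using that by (intro exI[of _ k] exI[of _ "\<one>"]) simp
  then have "{k \<in> {1..n}. (A \<otimes>\<^bsub>Gbar G n\<^esub> B) k k \<noteq> Some \<one>} \<subseteq>
     {k \<in> {1..n}. A k k \<noteq> Some \<one>} \<union> {k \<in> {1..n}. B k k \<noteq> Some \<one>}" by blast
  then have "mat_deg G n (A \<otimes>\<^bsub>Gbar G n\<^esub> B) \<le>
     card ({k \<in> {1..n}. A k k \<noteq> Some \<one>} \<union> {k \<in> {1..n}. B k k \<noteq> Some \<one>})"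
    unfolding mat_deg_def by (rule card_mono[rotated]) simp
  also have "\<dots> \<le> mat_deg G n A + mat_deg G n B" unfolding mat_deg_def by (rule card_Un_le)
  finally show ?thesis .
qed

lemma Zseq_ops:
  "\<alpha> \<otimes>\<^bsub>Zseq G m\<^esub> \<beta> = (\<lambda>n\<in>{m..}. \<alpha> n \<otimes>\<^bsub>FGbar G n\<^esub> \<beta> n)"
  "\<one>\<^bsub>Zseq G m\<^esub> = (\<lambda>n\<in>{m..}. basis \<one>\<^bsub>Gbar G n\<^esub>)"
  "\<alpha> \<oplus>\<^bsub>Zseq G m\<^esub> \<beta> = (\<lambda>n\<in>{m..}. \<lambda>z. \<alpha> n z + \<beta> n z)"
  "c \<odot>\<^bsub>Zseq G m\<^esub> \<alpha> = (\<lambda>n\<in>{m..}. \<lambda>z. c * \<alpha> n z)"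
  by (simp_all add: Zseq_def sg_alg_ops)

lemma Zseq_iff:
  fixes \<alpha> :: "nat \<Rightarrow> 'a zmat \<Rightarrow> 'f::field"
  shows "\<alpha> \<in> carrier (Zseq G m) \<longleftrightarrow> \<alpha> \<in> extensional {m..} \<and> (\<forall>n\<ge>m. \<alpha> n \<in> carrier (Zbar G m n)) \<and>
    (\<forall>n>m. theta n (\<alpha> n) = \<alpha> (n - 1)) \<and> (\<exists>D. \<forall>n\<ge>m. \<forall>A. \<alpha> n A \<noteq> 0 \<longrightarrow> mat_deg G n A \<le> D)"
proof -
  have bdd: "bdd_above ((\<lambda>n. elem_deg G n (\<alpha> n)) ` {m..}) \<longleftrightarrow> (\<exists>D. \<forall>n\<ge>m. \<forall>A. \<alpha> n A \<noteq> 0 \<longrightarrow> mat_deg G n A \<le> D)"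
    if "\<forall>n\<ge>m. \<alpha> n \<in> carrier (Zbar G m n)"
  proof -
    have "fin_supp (\<alpha> n)" if "n \<ge> m" for n
      using \<open>\<forall>n\<ge>m. \<alpha> n \<in> carrier (Zbar G m n)\<close> that by (simp add: Zbar_iff sg_alg_carrier)
    then show ?thesis by (simp add: bdd_above_def elem_deg_le_iff) (simp add: Ball_def)
  qed
  have eq: "\<alpha> \<in> carrier (Zseq G m) \<longleftrightarrow> \<alpha> \<in> extensional {m..} \<and> (\<forall>n\<ge>m. \<alpha> n \<in> carrier (Zbar G m n)) \<and>
    (\<forall>n>m. theta n (\<alpha> n) = \<alpha> (n - 1)) \<and> bdd_above ((\<lambda>n. elem_deg G n (\<alpha> n)) ` {m..})"
    by (auto simp: Zseq_def PiE_def Pi_def)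
  show ?thesis
  \<comment> \<open>The maximum in \<open>elem_deg\<close> is meaningful for finite supports, which
    are guaranteed once the components lie in \<open>Zbar\<close>.\<close>
  proof (cases "\<forall>n\<ge>m. \<alpha> n \<in> carrier (Zbar G m n)")
    case True
    show ?thesis unfolding eq bdd[OF True] by (rule refl)
  next
    case False
    show ?thesis unfolding eq by (simp only: False simp_thms)
  qed
qed

lemma theta_one: "m < n \<Longrightarrow> corner (n - 1) \<one>\<^bsub>Gbar G n\<^esub> = \<one>\<^bsub>Gbar G (n - 1)\<^esub>"
  by (rule zmat_eqI) (auto simp: corner_Some_iff mat_one_Some_iff)

text \<open>Closure under products is the delicate point: compatibility with \<open>theta\<close> is
  \<open>theta_mult\<close>, which relies on the components being centralizing, and the degrees add
  up by \<open>mat_deg_mult\<close>.\<close>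

lemma Zseq_subalg:
  "subalg (Zseq G m) (carrier (Zseq G m) :: (nat \<Rightarrow> 'a zmat \<Rightarrow> 'f::field) set)"
  unfolding subalg_def
proof (intro conjI ballI allI subset_refl)
  let ?Z = "Zseq G m :: ('f, nat \<Rightarrow> 'a zmat \<Rightarrow> 'f) module"
  note Zb = Zbar_subalg[where 'f = 'f, unfolded subalg_def sg_alg_ops]
  have bone: "(basis \<one>\<^bsub>Gbar G n\<^esub> :: 'a zmat \<Rightarrow> 'f) \<in> carrier (Zbar G m n)" for n
    using Zb by blast
  have ad: "(\<lambda>z. a z + b z) \<in> carrier (Zbar G m n)" and mu: "a \<otimes>\<^bsub>FGbar G n\<^esub> b \<in> carrier (Zbar G m n)"
    if "a \<in> carrier (Zbar G m n)" "b \<in> carrier (Zbar G m n)" for a b :: "'a zmat \<Rightarrow> 'f" and n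
    using Zb that by blast+
  have sm: "(\<lambda>z. c * a z) \<in> carrier (Zbar G m n)"
    if "a \<in> carrier (Zbar G m n)" for a :: "'a zmat \<Rightarrow> 'f" and n c
    using Zb that by blast
  have fin: "fin_supp a" if "a \<in> carrier (Zbar G m n)" for a :: "'a zmat \<Rightarrow> 'f" and n
    using that by (simp add: Zbar_iff sg_alg_carrier)
  have Gs: "A \<in> carrier (Gbar G n)" if "a \<in> carrier (Zbar G m n)" "a A \<noteq> 0" for a :: "'a zmat \<Rightarrow> 'f" and A n
    using that by (simp add: Zbar_iff sg_alg_carrier)
  show "\<one>\<^bsub>?Z\<^esub> \<in> carrier ?Z"
    unfolding Zseq_iff Zseq_ops
  proof (intro conjI allI impI exI[of _ 0])
    fix n A assume "m \<le> n" "(\<lambda>n\<in>{m..}. basis \<one>\<^bsub>Gbar G n\<^esub>) n A \<noteq> (0 :: 'f)"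
    then have "A = \<one>\<^bsub>Gbar G n\<^esub>" by (auto simp: basis_def split: if_splits)
    moreover have "{k \<in> {1..n}. \<one>\<^bsub>Gbar G n\<^esub> k k \<noteq> Some \<one>} = {}" by (auto simp: mat_one_Some_iff)
    ultimately show "mat_deg G n A \<le> 0" by (simp add: mat_deg_def)
  qed (auto simp: bone theta_eq theta_one)
  fix \<alpha> assume a: "\<alpha> \<in> carrier ?Z"
  then obtain D where a': "\<And>n. n \<ge> m \<Longrightarrow> \<alpha> n \<in> carrier (Zbar G m n)"
    "\<And>n. n > m \<Longrightarrow> theta n (\<alpha> n) = \<alpha> (n - 1)" "\<And>n A. n \<ge> m \<Longrightarrow> \<alpha> n A \<noteq> 0 \<Longrightarrow> mat_deg G n A \<le> D"
    unfolding Zseq_iff by blast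
  show "c \<odot>\<^bsub>?Z\<^esub> \<alpha> \<in> carrier ?Z" for c
    unfolding Zseq_iff Zseq_ops
  proof (intro conjI allI impI exI[of _ D])
    fix n assume n: "m < n"
    then have "m \<le> n - 1" by simp
    with n show "theta n ((\<lambda>n\<in>{m..}. \<lambda>z. c * \<alpha> n z) n) = (\<lambda>n\<in>{m..}. \<lambda>z. c * \<alpha> n z) (n - 1)"
      using a'(2)[OF n] fin[OF a'(1)[of n]] fin[OF sm[OF a'(1)[of n]], of c]
      by (simp add: theta_eq lin_lift_smult)
  qed (use a' in \<open>auto simp: sm\<close>)
  fix \<beta> assume b: "\<beta> \<in> carrier ?Z"
  then obtain E where b': "\<And>n. n \<ge> m \<Longrightarrow> \<beta> n \<in> carrier (Zbar G m n)"
    "\<And>n. n > m \<Longrightarrow> theta n (\<beta> n) = \<beta> (n - 1)" "\<And>n A. n \<ge> m \<Longrightarrow> \<beta> n A \<noteq> 0 \<Longrightarrow> mat_deg G n A \<le> E"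
    unfolding Zseq_iff by blast
  show "\<alpha> \<oplus>\<^bsub>?Z\<^esub> \<beta> \<in> carrier ?Z"
    unfolding Zseq_iff Zseq_ops
  proof (intro conjI allI impI exI[of _ "D + E"])
    fix n assume n: "m < n"
    then have "m \<le> n - 1" by simp
    with n show "theta n ((\<lambda>n\<in>{m..}. \<lambda>z. \<alpha> n z + \<beta> n z) n) = (\<lambda>n\<in>{m..}. \<lambda>z. \<alpha> n z + \<beta> n z) (n - 1)"
      using a'(2)[OF n] b'(2)[OF n] fin[OF a'(1)[of n]] fin[OF b'(1)[of n]] fin[OF ad[OF a'(1)[of n] b'(1)[of n]]]
      by (simp add: theta_eq lin_lift_add)
  next
    fix n A assume n: "m \<le> n" and "(\<lambda>n\<in>{m..}. \<lambda>z. \<alpha> n z + \<beta> n z) n A \<noteq> 0"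
    then have "\<alpha> n A \<noteq> 0 \<or> \<beta> n A \<noteq> 0" by auto
    then show "mat_deg G n A \<le> D + E" using a'(3)[OF n, of A] b'(3)[OF n, of A] by auto
  qed (use a' b' in \<open>auto simp: ad\<close>)
  show "\<alpha> \<otimes>\<^bsub>?Z\<^esub> \<beta> \<in> carrier ?Z"
    unfolding Zseq_iff Zseq_ops
  proof (intro conjI allI impI exI[of _ "D + E"])
    fix n assume n: "m < n"
    then have "m \<le> n - 1" by simp
    with n show "theta n ((\<lambda>n\<in>{m..}. \<alpha> n \<otimes>\<^bsub>FGbar G n\<^esub> \<beta> n) n) = (\<lambda>n\<in>{m..}. \<alpha> n \<otimes>\<^bsub>FGbar G n\<^esub> \<beta> n) (n - 1)"
      using a'(2)[OF n] b'(2)[OF n] theta_mult[OF n a'(1)[of n] b'(1)[of n]] by auto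
  next
    fix n A assume n: "m \<le> n" and "(\<lambda>n\<in>{m..}. \<alpha> n \<otimes>\<^bsub>FGbar G n\<^esub> \<beta> n) n A \<noteq> 0"
    then have "(\<alpha> n \<otimes>\<^bsub>FGbar G n\<^esub> \<beta> n) A \<noteq> 0" by simp
    then obtain B C where BC: "\<alpha> n B \<noteq> 0" "\<beta> n C \<noteq> 0" "A = B \<otimes>\<^bsub>Gbar G n\<^esub> C" by (rule sg_alg_mult_supp)
    then have "mat_deg G n A \<le> mat_deg G n B + mat_deg G n C"
      using mat_deg_mult Gs[OF a'(1)[OF n]] Gs[OF b'(1)[OF n]] by blast
    then show "mat_deg G n A \<le> D + E" using a'(3)[OF n BC(1)] b'(3)[OF n BC(2)] by linarith
  qed (use a' b' in \<open>auto simp: mu\<close>)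
qed

lemma embed_alg_hom:
  assumes "m \<le> n"
  shows "lin_lift (\<lambda>A. basis (embed_mat G m n A)) \<in> alg_hom (FGbar G m) (FGbar G n :: ('f::field, _) module)"
  by (rule lin_lift_alg_hom[OF monoid_Gbar])
    (use assms in \<open>auto simp: embed_in basis_mult embed_mult embed_one\<close>)

lemma const_seq_eq:
  "a \<in> carrier (FGbar G m) \<Longrightarrow> const_seq G m a = (\<lambda>n\<in>{m..}. lin_lift (\<lambda>A. basis (embed_mat G m n A)) a)"
  unfolding const_seq_def by (intro restrict_ext) (simp add: lin_ext_eq_lin_lift sg_alg_fin)

lemma const_seq_in:
  fixes a :: "'a zmat \<Rightarrow> 'f::field"
  assumes a: "a \<in> carrier (FGbar G m)"
  shows "const_seq G m a \<in> carrier (Zseq G m)"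
  unfolding const_seq_eq[OF a] Zseq_iff
\<comment> \<open>The bound is \<open>m\<close> because an embedded matrix has diagonal entry 1
  beyond index \<open>m\<close>.\<close>
proof (intro conjI allI impI exI[of _ m])
  let ?e = "\<lambda>n. lin_lift (\<lambda>A. basis (embed_mat G m n A)) :: ('a zmat \<Rightarrow> 'f) \<Rightarrow> 'a zmat \<Rightarrow> 'f"
  have fa: "fin_supp a" using a by (simp add: sg_alg_fin)
  have Ga: "x \<in> carrier (Gbar G m)" if "a x \<noteq> 0" for x using a that by (simp add: sg_alg_carrier)
  fix n
  show "(\<lambda>n\<in>{m..}. ?e n a) n \<in> carrier (Zbar G m n)" if n: "m \<le> n"
  proof -
    have "?e n a \<otimes>\<^bsub>FGbar G n\<^esub> basis x = basis x \<otimes>\<^bsub>FGbar G n\<^esub> ?e n a" if "x \<in> carrier (Gbar_tail G m n)" for x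
      unfolding basis_mult_left basis_mult_right using fa
      by (simp add: lin_lift_lin_lift, intro lin_lift_cong) (simp add: embed_commute_tail[OF Ga n that])
    then show ?thesis using alg_homD(1)[OF embed_alg_hom[OF n] a] n by (simp add: Zbar_iff)
  qed
  show "theta n ((\<lambda>n\<in>{m..}. ?e n a) n) = (\<lambda>n\<in>{m..}. ?e n a) (n - 1)" if n: "m < n"
  proof -
    have "theta n (?e n a) = lin_lift (\<lambda>x. basis (corner (n - 1) (embed_mat G m n x))) a"
      using fa by (simp add: theta_eq fin_supp_lin_lift lin_lift_lin_lift)
    also have "\<dots> = ?e (n - 1) a"
      by (rule lin_lift_cong) (simp add: corner_embed[OF n Ga])
    finally have "theta n (?e n a) = ?e (n - 1) a" .
    moreover have "m \<le> n - 1" using n by simp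
    ultimately show ?thesis using n by simp
  qed
  fix A assume n: "m \<le> n" and "(\<lambda>n\<in>{m..}. ?e n a) n A \<noteq> 0"
  then have "?e n a A \<noteq> 0" by simp
  then obtain x where "basis (embed_mat G m n x) A \<noteq> (0 :: 'f)"
    using lin_lift_supp[of "\<lambda>A. basis (embed_mat G m n A) :: 'a zmat \<Rightarrow> 'f" a] by blast
  then have "A = embed_mat G m n x" by (auto simp: basis_def split: if_splits)
  then have "{k \<in> {1..n}. A k k \<noteq> Some \<one>} \<subseteq> {1..m}" by (auto simp: embed_mat_def split: if_splits)
  then show "mat_deg G n A \<le> m" unfolding mat_deg_def using card_mono[of "{1..m}"] by fastforce
qed auto

section \<open>The elements of the sequence algebra lifting the Jucys--Murphy elements\<close>

text \<open>The factor \<open>1 - \<epsilon>\<^sub>i\<close> of the elements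
  \<open>u\<^sub>k\<close>, given by its coefficients; \<open>eps_comp_eq\<close> links it to the
  ring expression in \<open>u_at\<close>.\<close>

definition eps_comp :: "nat \<Rightarrow> nat \<Rightarrow> 'a zmat \<Rightarrow> 'f::field" where
  "eps_comp n i = (\<lambda>z. basis \<one>\<^bsub>Gbar G n\<^esub> z - basis (eps_mat G n i) z)"

lemma eps_comp_eq: "eps_comp n i = \<one>\<^bsub>FGbar G n\<^esub> \<ominus>\<^bsub>FGbar G n\<^esub> (basis (eps_mat G n i) :: _ \<Rightarrow> 'f::field)"
  by (subst sg_alg_minus[OF monoid_Gbar]) (simp_all add: eps_mat_in eps_comp_def sg_alg_ops)

lemma eps_comp_in: "(eps_comp n i :: 'a zmat \<Rightarrow> 'f::field) \<in> carrier (FGbar G n)"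
proof -
  interpret R: ring "FGbar G n :: ('f, 'a zmat \<Rightarrow> 'f) module" by (rule sg_alg_ring[OF monoid_Gbar])
  show ?thesis unfolding eps_comp_eq by (intro R.minus_closed R.one_closed) (simp add: eps_mat_in)
qed

lemma basis_eps_comp:
  assumes x: "x \<in> carrier (Gbar G n)"
  shows "basis x \<otimes>\<^bsub>FGbar G n\<^esub> eps_comp n i = (\<lambda>z. basis x z - basis (x \<otimes>\<^bsub>Gbar G n\<^esub> eps_mat G n i) z :: 'f::field)"
    and "eps_comp n i \<otimes>\<^bsub>FGbar G n\<^esub> basis x = (\<lambda>z. basis x z - basis (eps_mat G n i \<otimes>\<^bsub>Gbar G n\<^esub> x) z :: 'f)"
proof -
  let ?R = "FGbar G n :: ('f, 'a zmat \<Rightarrow> 'f) module"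
  interpret R: ring ?R by (rule sg_alg_ring[OF monoid_Gbar])
  have c: "basis x \<in> carrier ?R" "basis (eps_mat G n i) \<in> carrier ?R" using x by (simp_all add: eps_mat_in)
  have "basis x \<otimes>\<^bsub>?R\<^esub> eps_comp n i = basis x \<ominus>\<^bsub>?R\<^esub> basis x \<otimes>\<^bsub>?R\<^esub> basis (eps_mat G n i)"
    unfolding eps_comp_eq using c by (simp add: R.minus_eq R.r_distr R.r_minus)
  then show "basis x \<otimes>\<^bsub>?R\<^esub> eps_comp n i = (\<lambda>z. basis x z - basis (x \<otimes>\<^bsub>Gbar G n\<^esub> eps_mat G n i) z)"
    using x by (simp add: basis_mult sg_alg_minus monoid_Gbar mat_mult_in eps_mat_in)
  have "eps_comp n i \<otimes>\<^bsub>?R\<^esub> basis x = basis x \<ominus>\<^bsub>?R\<^esub> basis (eps_mat G n i) \<otimes>\<^bsub>?R\<^esub> basis x"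
    unfolding eps_comp_eq using c by (simp add: R.minus_eq R.l_distr R.l_minus)
  then show "eps_comp n i \<otimes>\<^bsub>?R\<^esub> basis x = (\<lambda>z. basis x z - basis (eps_mat G n i \<otimes>\<^bsub>Gbar G n\<^esub> x) z)"
    using x by (simp add: basis_mult sg_alg_minus monoid_Gbar mat_mult_in eps_mat_in)
qed

lemma eps_comp_commute:
  assumes "x \<in> carrier (Gbar G n)" "x j i = Some b"
  shows "basis x \<otimes>\<^bsub>FGbar G n\<^esub> eps_comp n i = eps_comp n j \<otimes>\<^bsub>FGbar G n\<^esub> (basis x :: _ \<Rightarrow> 'f::field)"
  by (simp add: basis_eps_comp[OF assms(1)] eps_commute[OF assms])

text \<open>Deleting a column or row that is already zero changes nothing, so the idempotent returns
  \<open>x\<close> and its complement annihilates it.\<close>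

lemma eps_comp_zero:
  assumes "x \<in> carrier (Gbar G n)"
  shows "(\<And>j. x j i = None) \<Longrightarrow> basis x \<otimes>\<^bsub>FGbar G n\<^esub> eps_comp n i = (\<lambda>z. 0 :: 'f::field)"
    and "(\<And>j. x i j = None) \<Longrightarrow> eps_comp n i \<otimes>\<^bsub>FGbar G n\<^esub> basis x = (\<lambda>z. 0 :: 'f::field)"
  by (simp_all add: basis_eps_comp[OF assms] eps_absorb[OF assms])

definition u_term :: "nat \<Rightarrow> nat \<Rightarrow> nat \<Rightarrow> 'a \<Rightarrow> 'a zmat \<Rightarrow> 'f::field" where
  "u_term n k i h = basis (tau G n k i h) \<otimes>\<^bsub>FGbar G n\<^esub> eps_comp n k \<otimes>\<^bsub>FGbar G n\<^esub> eps_comp n i"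

lemma u_term_in:
  assumes "k \<in> {1..n}" "i \<in> {1..n}" "k \<noteq> i" "h \<in> carrier G"
  shows "(u_term n k i h :: 'a zmat \<Rightarrow> 'f::field) \<in> carrier (FGbar G n)"
  unfolding u_term_def
  by (intro sg_alg_mult_in monoid_Gbar eps_comp_in) (use assms in \<open>auto intro!: Gwr_Gbar tau_in_Gwr\<close>)

lemma u_at_eq:
  assumes k: "1 \<le> k"
  shows "u_at G k n = (\<lambda>z. \<Sum>i\<in>{k+1..n}. \<Sum>h\<in>carrier G. u_term n k i h z :: 'f::field)"
proof -
  let ?R = "FGbar G n :: ('f, 'a zmat \<Rightarrow> 'f) module"
  let ?U = "\<lambda>i. t_elem G n ?R (\<lambda>g. basis (tuple_mat n g)) k i \<otimes>\<^bsub>?R\<^esub> basis (transp_mat G n k i)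
          \<otimes>\<^bsub>?R\<^esub> eps_comp n k \<otimes>\<^bsub>?R\<^esub> eps_comp n i"
  have U: "?U i = (\<lambda>z. \<Sum>h\<in>carrier G. u_term n k i h z)" if i: "i \<in> {k+1..n}" for i
  proof -
    have "k \<in> {1..n}" "i \<in> {1..n}" "k \<noteq> i" using k i by auto
    note kin = this and t = t_elem_tau[OF this, where 'f = 'f]
    have "basis (tau G n k i h) \<otimes>\<^bsub>?R\<^esub> eps_comp n k \<in> carrier ?R" if h: "h \<in> carrier G" for h
      using kin h by (intro sg_alg_mult_in monoid_Gbar eps_comp_in) (simp add: Gwr_Gbar tau_in_Gwr)
    then have "fin_supp (basis (tau G n k i h) \<otimes>\<^bsub>?R\<^esub> eps_comp n k)" if "h \<in> carrier G" for h
      using sg_alg_fin that by blast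
    then show ?thesis unfolding t u_term_def by (simp add: sg_alg_sum_mult)
  qed
  have "u_at G k n = finsum ?R ?U {k+1..n}" by (simp add: u_at_def Let_def eps_comp_eq)
  also have "\<dots> = (\<lambda>z. \<Sum>i\<in>{k+1..n}. ?U i z)"
  proof (rule sg_alg_finsum[OF monoid_Gbar])
    fix i assume i: "i \<in> {k+1..n}"
    show "?U i \<in> carrier ?R" unfolding U[OF i] using i k by (intro sg_alg_sum_in u_term_in) auto
  qed
  also have "\<dots> = (\<lambda>z. \<Sum>i\<in>{k+1..n}. \<Sum>h\<in>carrier G. u_term n k i h z)"
    by (intro ext sum.cong refl) (simp only: U)
  finally show ?thesis .
qed

lemma tau_Gbar:
  "k \<in> {1..n} \<Longrightarrow> i \<in> {1..n} \<Longrightarrow> k \<noteq> i \<Longrightarrow> h \<in> carrier G \<Longrightarrow> tau G n k i h \<in> carrier (Gbar G n)"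
  by (intro Gwr_Gbar tau_in_Gwr)

lemma u_term_commute:
  assumes x: "x \<in> carrier (Gbar G n)" "x k k = Some \<one>" "x j i = Some b" and ki: "k \<noteq> i" and h: "h \<in> carrier G"
  shows "basis x \<otimes>\<^bsub>FGbar G n\<^esub> u_term n k i h = u_term n k j (h \<otimes> inv b) \<otimes>\<^bsub>FGbar G n\<^esub> (basis x :: _ \<Rightarrow> 'f::field)"
proof -
  let ?R = "FGbar G n :: ('f, 'a zmat \<Rightarrow> 'f) module"
  interpret R: ring ?R by (rule sg_alg_ring[OF monoid_Gbar])
  have r: "k \<in> {1..n}" "i \<in> {1..n}" "j \<in> {1..n}" "b \<in> carrier G"
    using Gbar_rangeD[OF x(1,2)] Gbar_rangeD[OF x(1,3)] by auto
  have kj: "k \<noteq> j" using Gbar_rowD[OF x(1), of k k \<one> i b] x ki by auto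
  let ?t = "basis (tau G n k i h) :: _ \<Rightarrow> 'f" and ?t' = "basis (tau G n k j (h \<otimes> inv b)) :: _ \<Rightarrow> 'f"
  let ?x = "basis x :: _ \<Rightarrow> 'f" and ?ek = "eps_comp n k :: _ \<Rightarrow> 'f"
  let ?ei = "eps_comp n i :: _ \<Rightarrow> 'f" and ?ej = "eps_comp n j :: _ \<Rightarrow> 'f"
  have c: "?t \<in> carrier ?R" "?t' \<in> carrier ?R" "?x \<in> carrier ?R" "?ek \<in> carrier ?R" "?ei \<in> carrier ?R" "?ej \<in> carrier ?R"
    using r kj ki h x(1) by (simp_all add: tau_Gbar eps_comp_in)
  have "?x \<otimes>\<^bsub>?R\<^esub> (?t \<otimes>\<^bsub>?R\<^esub> ?ek \<otimes>\<^bsub>?R\<^esub> ?ei) = ?x \<otimes>\<^bsub>?R\<^esub> ?t \<otimes>\<^bsub>?R\<^esub> ?ek \<otimes>\<^bsub>?R\<^esub> ?ei"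
    using c by (simp add: R.m_assoc)
  also have "?x \<otimes>\<^bsub>?R\<^esub> ?t = ?t' \<otimes>\<^bsub>?R\<^esub> ?x"
    using tau_commute[OF x ki h] h by (simp add: basis_mult)
  also have "?t' \<otimes>\<^bsub>?R\<^esub> ?x \<otimes>\<^bsub>?R\<^esub> ?ek = ?t' \<otimes>\<^bsub>?R\<^esub> ?ek \<otimes>\<^bsub>?R\<^esub> ?x"
    using c eps_comp_commute[OF x(1,2), where 'f = 'f] by (simp add: R.m_assoc)
  also have "?t' \<otimes>\<^bsub>?R\<^esub> ?ek \<otimes>\<^bsub>?R\<^esub> ?x \<otimes>\<^bsub>?R\<^esub> ?ei = ?t' \<otimes>\<^bsub>?R\<^esub> ?ek \<otimes>\<^bsub>?R\<^esub> ?ej \<otimes>\<^bsub>?R\<^esub> ?x"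
    using c eps_comp_commute[OF x(1,3), where 'f = 'f] by (simp add: R.m_assoc)
  finally show ?thesis by (simp add: u_term_def)
qed

text \<open>Passing \<open>tau\<close> through the complements exchanges \<open>k\<close> and
  \<open>i\<close>, so a complement belonging to \<open>i\<close> can stand at either end of
  \<open>u_term\<close>. There it meets the zero column or zero row of \<open>x\<close>.\<close>

lemma u_term_zero:
  assumes x: "x \<in> carrier (Gbar G n)" and ki: "k \<in> {1..n}" "i \<in> {1..n}" "k \<noteq> i" and h: "h \<in> carrier G"
  shows "(\<And>j. x j i = None) \<Longrightarrow> basis x \<otimes>\<^bsub>FGbar G n\<^esub> u_term n k i h = (\<lambda>z. 0 :: 'f::field)"
    and "(\<And>j. x i j = None) \<Longrightarrow> u_term n k i h \<otimes>\<^bsub>FGbar G n\<^esub> basis x = (\<lambda>z. 0 :: 'f)"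
proof -
  let ?R = "FGbar G n :: ('f, 'a zmat \<Rightarrow> 'f) module"
  interpret R: ring ?R by (rule sg_alg_ring[OF monoid_Gbar])
  let ?t = "basis (tau G n k i h) :: _ \<Rightarrow> 'f" and ?x = "basis x :: _ \<Rightarrow> 'f"
  let ?ek = "eps_comp n k :: _ \<Rightarrow> 'f" and ?ei = "eps_comp n i :: _ \<Rightarrow> 'f"
  have tG: "tau G n k i h \<in> carrier (Gbar G n)" using ki h by (rule tau_Gbar)
  have c: "?t \<in> carrier ?R" "?x \<in> carrier ?R" "?ek \<in> carrier ?R" "?ei \<in> carrier ?R"
    using tG x by (simp_all add: eps_comp_in)
  have z: "(\<lambda>z. 0) = \<zero>\<^bsub>?R\<^esub>" by (simp add: sg_alg_ops)
  have tk: "tau G n k i h i k = Some (inv h)" "tau G n k i h k i = Some h" using ki by (auto simp: tau_def)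
  note com = eps_comp_commute[OF tG tk(1), where 'f = 'f] eps_comp_commute[OF tG tk(2), where 'f = 'f]
  have "u_term n k i h = ?ei \<otimes>\<^bsub>?R\<^esub> ?t \<otimes>\<^bsub>?R\<^esub> ?ei"
    by (simp add: u_term_def com(1))
  also have "\<dots> = ?ei \<otimes>\<^bsub>?R\<^esub> (?ek \<otimes>\<^bsub>?R\<^esub> ?t)" using c by (simp add: R.m_assoc com(2))
  finally have u: "u_term n k i h = ?ei \<otimes>\<^bsub>?R\<^esub> (?ek \<otimes>\<^bsub>?R\<^esub> ?t)" .
  show "basis x \<otimes>\<^bsub>FGbar G n\<^esub> u_term n k i h = (\<lambda>z. 0 :: 'f)" if "\<And>j. x j i = None"
  proof -
    have "?x \<otimes>\<^bsub>?R\<^esub> u_term n k i h = ?x \<otimes>\<^bsub>?R\<^esub> ?ei \<otimes>\<^bsub>?R\<^esub> (?ek \<otimes>\<^bsub>?R\<^esub> ?t)"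
      unfolding u using c by (simp add: R.m_assoc)
    also have "?x \<otimes>\<^bsub>?R\<^esub> ?ei = \<zero>\<^bsub>?R\<^esub>" unfolding z[symmetric] by (rule eps_comp_zero(1)[OF x that])
    finally show ?thesis using c z by simp
  qed
  show "u_term n k i h \<otimes>\<^bsub>FGbar G n\<^esub> basis x = (\<lambda>z. 0 :: 'f)" if "\<And>j. x i j = None"
  proof -
    have "u_term n k i h \<otimes>\<^bsub>?R\<^esub> ?x = ?t \<otimes>\<^bsub>?R\<^esub> ?ek \<otimes>\<^bsub>?R\<^esub> (?ei \<otimes>\<^bsub>?R\<^esub> ?x)"
      unfolding u_term_def using c by (simp add: R.m_assoc)
    also have "?ei \<otimes>\<^bsub>?R\<^esub> ?x = \<zero>\<^bsub>?R\<^esub>" unfolding z[symmetric] by (rule eps_comp_zero(2)[OF x that])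
    finally show ?thesis using c z by simp
  qed
qed

lemma u_at_commute:
  assumes x: "x \<in> carrier (Gbar_tail G m n)" and k: "k \<in> {1..m}" and mn: "m \<le> n"
  shows "basis x \<otimes>\<^bsub>FGbar G n\<^esub> u_at G k n = u_at G k n \<otimes>\<^bsub>FGbar G n\<^esub> (basis x :: _ \<Rightarrow> 'f::field)"
proof
  fix z
  let ?R = "FGbar G n :: ('f, 'a zmat \<Rightarrow> 'f) module"
  have x1: "x p p = Some \<one>" if "p \<in> {1..k}" for p
    using x k that by (simp add: Gbar_tail_iff)
  have xG: "x \<in> carrier (Gbar G n)" using x by (simp add: Gbar_tail_iff)
  have xk: "x k k = Some \<one>" using x1 k by simp
  let ?I = "{k+1..n}"
  \<comment> \<open>\<open>?C\<close> collects the columns and \<open>?D\<close> the rows of the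
    range in which \<open>x\<close> has an entry. Terms outside are annihilated, and
    \<open>act x\<close> maps \<open>?C\<close> bijectively onto \<open>?D\<close>.\<close>
  let ?C = "{i \<in> ?I. \<exists>j b. x j i = Some b}" and ?D = "{j \<in> ?I. \<exists>i b. x j i = Some b}"
  \<comment> \<open>On \<open>1, ..., k\<close> the matrix \<open>x\<close> is the identity, so its
    other entries join later indices only.\<close>
  have tailI: "i \<in> ?I \<longleftrightarrow> j \<in> ?I" if jb: "x j i = Some b" for i j b
  proof -
    have r: "i \<in> {1..n}" "j \<in> {1..n}" using Gbar_rangeD[OF xG jb] by auto
    have "i \<le> k \<Longrightarrow> j = i" using x1[of i] r Gbar_colD[OF xG jb] by simp
    moreover have "j \<le> k \<Longrightarrow> j = i" using x1[of j] r Gbar_rowD[OF xG jb] by simp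
    ultimately have "j = i \<or> k < i \<and> k < j" by linarith
    then show ?thesis using r by auto
  qed
  have kn: "k \<in> {1..n}" using k mn by auto
  have fin: "fin_supp (u_term n k i h :: _ \<Rightarrow> 'f)" if "i \<in> ?I" "h \<in> carrier G" for i h
    using u_term_in[OF kn _ _ that(2), of i, where 'f = 'f] that(1) k sg_alg_fin by fastforce
  have k1: "1 \<le> k" using k by simp
  have U: "u_at G k n = (\<lambda>z. \<Sum>p\<in>?I \<times> carrier G. u_term n k (fst p) (snd p) z :: 'f)"
    by (simp add: u_at_eq[OF k1] sum.cartesian_product case_prod_unfold)
  have finp: "fin_supp (u_term n k (fst p) (snd p) :: _ \<Rightarrow> 'f)" if "p \<in> ?I \<times> carrier G" for p
    using fin that by auto
  have "(basis x \<otimes>\<^bsub>?R\<^esub> u_at G k n) z = (\<Sum>i\<in>?I. \<Sum>h\<in>carrier G. (basis x \<otimes>\<^bsub>?R\<^esub> u_term n k i h) z)"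
    unfolding U by (subst sg_alg_mult_sum, erule finp) (simp add: sum.cartesian_product case_prod_unfold)
  also have "\<dots> = (\<Sum>i\<in>?C. \<Sum>h\<in>carrier G. (basis x \<otimes>\<^bsub>?R\<^esub> u_term n k i h) z)"
  proof (rule sum.mono_neutral_right)
    show "\<forall>i\<in>?I - ?C. (\<Sum>h\<in>carrier G. (basis x \<otimes>\<^bsub>?R\<^esub> u_term n k i h) z) = 0"
    proof
      fix i assume i: "i \<in> ?I - ?C"
      then have "x j i = None" for j by auto
      moreover have "i \<in> {1..n}" "k \<noteq> i" using i by auto
      ultimately show "(\<Sum>h\<in>carrier G. (basis x \<otimes>\<^bsub>?R\<^esub> u_term n k i h) z) = 0"
        using u_term_zero(1)[OF xG kn, of i, where 'f = 'f] by simp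
    qed
  qed auto
  also have "\<dots> = (\<Sum>i\<in>?C. \<Sum>h\<in>carrier G. (u_term n k (act x i) h \<otimes>\<^bsub>?R\<^esub> basis x) z)"
  proof (rule sum.cong[OF refl])
    fix i assume i: "i \<in> ?C"
    then obtain j b where jb: "x j i = Some b" by blast
    have b: "b \<in> carrier G" using Gbar_rangeD[OF xG jb] by simp
    have ki: "k \<noteq> i" using i by auto
    have "(\<Sum>h\<in>carrier G. (basis x \<otimes>\<^bsub>?R\<^esub> u_term n k i h) z) =
      (\<Sum>h\<in>carrier G. (u_term n k j (h \<otimes> inv b) \<otimes>\<^bsub>?R\<^esub> basis x) z)"
      by (rule sum.cong[OF refl]) (simp only: u_term_commute[OF xG xk jb ki])
    \<comment> \<open>Right multiplication by \<open>inv b\<close> permutes the labels.\<close>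
    also have "\<dots> = (\<Sum>h\<in>carrier G. (u_term n k j h \<otimes>\<^bsub>?R\<^esub> basis x) z)"
      by (rule sum.reindex_bij_witness[of _ "\<lambda>h. h \<otimes> b" "\<lambda>h. h \<otimes> inv b"]) (use b in \<open>auto simp: m_assoc\<close>)
    finally show "(\<Sum>h\<in>carrier G. (basis x \<otimes>\<^bsub>?R\<^esub> u_term n k i h) z) =
      (\<Sum>h\<in>carrier G. (u_term n k (act x i) h \<otimes>\<^bsub>?R\<^esub> basis x) z)"
      using act_eq[OF xG jb] by simp
  qed
  also have "\<dots> = (\<Sum>j\<in>?D. \<Sum>h\<in>carrier G. (u_term n k j h \<otimes>\<^bsub>?R\<^esub> basis x) z)"
  proof (rule sum.reindex_bij_betw)
    have "inj_on (act x) ?C"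
    proof (rule inj_onI)
      fix i i' assume i: "i \<in> ?C" "i' \<in> ?C" "act x i = act x i'"
      obtain j b where jb: "x j i = Some b" using i(1) by blast
      obtain j' b' where jb': "x j' i' = Some b'" using i(2) by blast
      have "j = j'" using i(3) act_eq[OF xG jb] act_eq[OF xG jb'] by simp
      then show "i = i'" using Gbar_rowD[OF xG] jb jb' by blast
    qed
    moreover have "act x ` ?C = ?D"
    proof (intro equalityI subsetI)
      fix j assume "j \<in> act x ` ?C"
      then obtain i j' b where i: "i \<in> ?I" "x j' i = Some b" "j = act x i" by blast
      then have "j = j'" using act_eq[OF xG] by blast
      then show "j \<in> ?D" using i tailI by blast
    next
      fix j assume "j \<in> ?D"
      then obtain i b where i: "j \<in> ?I" "x j i = Some b" by blast
      then have "i \<in> ?C" using tailI by blast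
      moreover have "j = act x i" using act_eq[OF xG i(2)] by simp
      ultimately show "j \<in> act x ` ?C" by blast
    qed
    ultimately show "bij_betw (act x) ?C ?D" by (simp add: bij_betw_def)
  qed
  also have "\<dots> = (\<Sum>j\<in>?I. \<Sum>h\<in>carrier G. (u_term n k j h \<otimes>\<^bsub>?R\<^esub> basis x) z)"
  proof (rule sum.mono_neutral_left)
    show "\<forall>i\<in>?I - ?D. (\<Sum>h\<in>carrier G. (u_term n k i h \<otimes>\<^bsub>?R\<^esub> basis x) z) = 0"
    proof
      fix i assume i: "i \<in> ?I - ?D"
      then have "x i j = None" for j by auto
      moreover have "i \<in> {1..n}" "k \<noteq> i" using i by auto
      ultimately show "(\<Sum>h\<in>carrier G. (u_term n k i h \<otimes>\<^bsub>?R\<^esub> basis x) z) = 0"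
        using u_term_zero(2)[OF xG kn, of i, where 'f = 'f] by simp
    qed
  qed auto
  also have "\<dots> = (u_at G k n \<otimes>\<^bsub>?R\<^esub> basis x) z"
    unfolding U by (subst sg_alg_sum_mult, erule finp) (simp add: sum.cartesian_product case_prod_unfold)
  finally show "(basis x \<otimes>\<^bsub>?R\<^esub> u_at G k n) z = (u_at G k n \<otimes>\<^bsub>?R\<^esub> basis x) z" .
qed

text \<open>Written with four basis vectors, the term allows \<open>theta\<close> and the degree to
  be read off directly.\<close>

lemma u_term_expand:
  assumes "k \<in> {1..n}" "i \<in> {1..n}" "k \<noteq> i" "h \<in> carrier G"
  defines "t \<equiv> tau G n k i h"
  shows "u_term n k i h = (\<lambda>z. basis t z - basis (t \<otimes>\<^bsub>Gbar G n\<^esub> eps_mat G n k) z -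
     (basis (t \<otimes>\<^bsub>Gbar G n\<^esub> eps_mat G n i) z -
      basis (t \<otimes>\<^bsub>Gbar G n\<^esub> eps_mat G n k \<otimes>\<^bsub>Gbar G n\<^esub> eps_mat G n i) z) :: 'f::field)"
proof -
  let ?R = "FGbar G n :: ('f, 'a zmat \<Rightarrow> 'f) module"
  interpret R: ring ?R by (rule sg_alg_ring[OF monoid_Gbar])
  have t: "t \<in> carrier (Gbar G n)" unfolding t_def using assms by (intro tau_Gbar)
  let ?tk = "t \<otimes>\<^bsub>Gbar G n\<^esub> eps_mat G n k"
  have tk: "?tk \<in> carrier (Gbar G n)" by (intro mat_mult_in t eps_mat_in)
  have c: "basis t \<in> carrier ?R" "basis ?tk \<in> carrier ?R" using t tk by simp_all
  have "basis t \<otimes>\<^bsub>?R\<^esub> eps_comp n k = basis t \<ominus>\<^bsub>?R\<^esub> basis ?tk"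
    using c(2) by (simp only: basis_eps_comp(1)[OF t] sg_alg_minus[OF monoid_Gbar])
  then have "u_term n k i h = (basis t \<ominus>\<^bsub>?R\<^esub> basis ?tk) \<otimes>\<^bsub>?R\<^esub> eps_comp n i"
    by (simp add: u_term_def t_def)
  also have "\<dots> = basis t \<otimes>\<^bsub>?R\<^esub> eps_comp n i \<ominus>\<^bsub>?R\<^esub> basis ?tk \<otimes>\<^bsub>?R\<^esub> eps_comp n i"
    using c eps_comp_in[of n i, where 'f = 'f] by (simp add: R.minus_eq R.l_distr R.l_minus)
  also have "\<dots> = (\<lambda>z. (basis t \<otimes>\<^bsub>?R\<^esub> eps_comp n i) z - (basis ?tk \<otimes>\<^bsub>?R\<^esub> eps_comp n i) z)"
    by (rule sg_alg_minus[OF monoid_Gbar]) (rule R.m_closed[OF c(2) eps_comp_in])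
  finally show ?thesis unfolding basis_eps_comp(1)[OF t] basis_eps_comp(1)[OF tk] by (simp add: algebra_simps)
qed

lemma lin_lift_diff:
  assumes "fin_supp a" "fin_supp b"
  shows "lin_lift f (\<lambda>z. a z - b z) = (\<lambda>z. lin_lift f a z - lin_lift f b z)"
  using lin_lift_add[of a "\<lambda>z. (-1) * b z" f] assms lin_lift_smult[of f "-1" b] by simp

lemma fin_supp_diff: "fin_supp a \<Longrightarrow> fin_supp b \<Longrightarrow> fin_supp (\<lambda>z. a z - b z)"
  by (rule finite_subset[of _ "{x. a x \<noteq> 0} \<union> {x. b x \<noteq> 0}"]) auto

lemma theta_u_term:
  assumes k: "k \<in> {1..<n}" and i: "i \<in> {1..n}" and ki: "k \<noteq> i" and h: "h \<in> carrier G"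
  shows "theta n (u_term n k i h) = (if i < n then u_term (n - 1) k i h else (\<lambda>z. 0 :: 'f::field))"
proof -
  have r: "k \<in> {1..n}" using k by auto
  have t: "tau G n k i h \<in> carrier (Gbar G n)" using r i ki h by (rule tau_Gbar)
  let ?t = "tau G n k i h" and ?c = "corner (n - 1) :: 'a zmat \<Rightarrow> 'a zmat"
  have tk: "?t \<otimes>\<^bsub>Gbar G n\<^esub> eps_mat G n k \<in> carrier (Gbar G n)" by (intro mat_mult_in t eps_mat_in)
  have f: "fin_supp (\<lambda>z. basis A z - basis B z :: 'f)" for A B :: "'a zmat"
    by (intro fin_supp_diff fin_supp_basis)
  have "theta n (u_term n k i h) = (\<lambda>z. basis (?c ?t) z - basis (?c (?t \<otimes>\<^bsub>Gbar G n\<^esub> eps_mat G n k)) z -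
     (basis (?c (?t \<otimes>\<^bsub>Gbar G n\<^esub> eps_mat G n i)) z -
      basis (?c (?t \<otimes>\<^bsub>Gbar G n\<^esub> eps_mat G n k \<otimes>\<^bsub>Gbar G n\<^esub> eps_mat G n i)) z) :: 'f)"
    unfolding u_term_expand[OF r i ki h] theta_eq[OF fin_supp_diff[OF f f]] lin_lift_diff[OF f f]
      lin_lift_diff[OF fin_supp_basis fin_supp_basis] lin_lift_basis ..
  also have "\<dots> = (if i < n then u_term (n - 1) k i h else (\<lambda>z. 0))"
  proof (cases "i < n")
    case True
    have r': "k \<in> {1..n - 1}" "i \<in> {1..n - 1}" using k i True by auto
    let ?s = "tau G (n - 1) k i h"
    have s: "?s \<in> carrier (Gbar G (n - 1))" using r' ki h by (rule tau_Gbar)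
    have sk: "?s \<otimes>\<^bsub>Gbar G (n - 1)\<^esub> eps_mat G (n - 1) k \<in> carrier (Gbar G (n - 1))" by (intro mat_mult_in s eps_mat_in)
    have c: "?c ?t = ?s" using r' by (auto simp: corner_def tau_def fun_eq_iff)
    have ce: "corner (n - 1) (\<lambda>p q. if q = j then None else A p q) = (\<lambda>p q. if q = j then None else corner (n - 1) A p q)"
      for j and A :: "'a zmat" by (auto simp: corner_def fun_eq_iff)
    have ck: "?c (?t \<otimes>\<^bsub>Gbar G n\<^esub> eps_mat G n j) = ?s \<otimes>\<^bsub>Gbar G (n - 1)\<^esub> eps_mat G (n - 1) j" for j
      unfolding eps_mult(2)[OF t] eps_mult(2)[OF s] ce c ..
    have cki: "?c (?t \<otimes>\<^bsub>Gbar G n\<^esub> eps_mat G n k \<otimes>\<^bsub>Gbar G n\<^esub> eps_mat G n i) =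
       ?s \<otimes>\<^bsub>Gbar G (n - 1)\<^esub> eps_mat G (n - 1) k \<otimes>\<^bsub>Gbar G (n - 1)\<^esub> eps_mat G (n - 1) i"
      unfolding eps_mult(2)[OF tk] eps_mult(2)[OF sk] ce ck ..
    show ?thesis unfolding c ck cki u_term_expand[OF r' ki h] using True by simp
  next
    case False
    then have n: "i = n" using i by auto
    \<comment> \<open>Column \<open>k\<close> of \<open>tau\<close> has its entry in row
      \<open>n\<close>, so inside the corner both columns \<open>k\<close> and \<open>n\<close> are
      gone already. The idempotents change nothing there, and the four terms cancel in
      pairs.\<close>
    have 1: "?c (?t \<otimes>\<^bsub>Gbar G n\<^esub> eps_mat G n k) = ?c ?t" "?c (?t \<otimes>\<^bsub>Gbar G n\<^esub> eps_mat G n i) = ?c ?t"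
      unfolding eps_mult(2)[OF t] using n ki k by (auto simp: corner_def tau_def fun_eq_iff)
    have 2: "?c (?t \<otimes>\<^bsub>Gbar G n\<^esub> eps_mat G n k \<otimes>\<^bsub>Gbar G n\<^esub> eps_mat G n i) = ?c (?t \<otimes>\<^bsub>Gbar G n\<^esub> eps_mat G n k)"
      unfolding eps_mult(2)[OF tk] using n by (auto simp: corner_def fun_eq_iff)
    show ?thesis unfolding 2 1 using False by simp
  qed
  finally show ?thesis .
qed

lemma u_at_in:
  assumes "1 \<le> k"
  shows "(u_at G k n :: 'a zmat \<Rightarrow> 'f::field) \<in> carrier (FGbar G n)"
  unfolding u_at_eq[OF assms] using assms by (intro sg_alg_sum_in u_term_in) auto

lemma theta_u_at:
  assumes k: "k \<in> {1..<n}"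
  shows "theta n (u_at G k n) = (u_at G k (n - 1) :: 'a zmat \<Rightarrow> 'f::field)"
proof -
  let ?c = "\<lambda>x. basis (corner (n - 1) x) :: 'a zmat \<Rightarrow> 'f"
  have k1: "1 \<le> k" using k by simp
  have U: "u_at G k n = (\<lambda>z. \<Sum>p\<in>{k+1..n} \<times> carrier G. u_term n k (fst p) (snd p) z :: 'f)" for n
    by (simp add: u_at_eq[OF k1] sum.cartesian_product case_prod_unfold)
  have fin: "fin_supp (u_term n k (fst p) (snd p) :: _ \<Rightarrow> 'f)" if p: "p \<in> {k+1..n} \<times> carrier G" for p
    by (rule sg_alg_fin, rule u_term_in) (use p k in auto)
  have "theta n (u_at G k n) = lin_lift ?c (u_at G k n :: 'a zmat \<Rightarrow> 'f)"
    by (rule theta_eq) (rule sg_alg_fin[OF u_at_in[OF k1]])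
  also have "\<dots> = (\<lambda>z. \<Sum>p\<in>{k+1..n} \<times> carrier G. lin_lift ?c (u_term n k (fst p) (snd p)) z)"
    unfolding U by (rule lin_lift_sum) (erule fin)
  also have "\<dots> = (\<lambda>z. \<Sum>p\<in>{k+1..n - 1} \<times> carrier G. u_term (n - 1) k (fst p) (snd p) z)"
  proof
    fix z
    have e: "lin_lift ?c (u_term n k (fst p) (snd p)) = (if fst p < n then u_term (n - 1) k (fst p) (snd p) else (\<lambda>z. 0))"
      if p: "p \<in> {k+1..n} \<times> carrier G" for p
      using theta_u_term[OF k, of "fst p" "snd p", where 'f = 'f] p by (auto simp: theta_eq[OF fin[OF p], symmetric])
    have "(\<Sum>p\<in>{k+1..n} \<times> carrier G. lin_lift ?c (u_term n k (fst p) (snd p)) z) =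
      (\<Sum>i\<in>{k+1..n}. \<Sum>h\<in>carrier G. if i < n then u_term (n - 1) k i h z else 0)"
      unfolding sum.cartesian_product by (rule sum.cong[OF refl]) (auto simp: e)
    also have "\<dots> = (\<Sum>i\<in>{k+1..n - 1}. \<Sum>h\<in>carrier G. u_term (n - 1) k i h z)"
      by (rule sum.mono_neutral_cong_right) (use k in \<open>auto intro!: sum.neutral sum.cong\<close>)
    also have "\<dots> = (\<Sum>p\<in>{k+1..n - 1} \<times> carrier G. u_term (n - 1) k (fst p) (snd p) z)"
      by (simp add: sum.cartesian_product case_prod_unfold)
    finally show "(\<Sum>p\<in>{k+1..n} \<times> carrier G. lin_lift ?c (u_term n k (fst p) (snd p)) z) =
      (\<Sum>p\<in>{k+1..n - 1} \<times> carrier G. u_term (n - 1) k (fst p) (snd p) z)" .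
  qed
  also have "\<dots> = u_at G k (n - 1)" unfolding U ..
  finally show ?thesis .
qed

text \<open>All four matrices in \<open>u_term_expand\<close> agree with the identity on the
  diagonal away from \<open>k\<close> and \<open>i\<close>, whence the bound 2.\<close>

lemma u_at_deg:
  assumes k: "1 \<le> k" and A: "u_at G k n A \<noteq> (0 :: 'f::field)"
  shows "mat_deg G n A \<le> 2"
proof -
  obtain i h where ih: "i \<in> {k+1..n}" "h \<in> carrier G" "u_term n k i h A \<noteq> (0 :: 'f)"
    using A unfolding u_at_eq[OF k] by (meson sum.not_neutral_contains_not_neutral)
  have r: "k \<in> {1..n}" "i \<in> {1..n}" "k \<noteq> i" using ih k by auto
  let ?t = "tau G n k i h"
  have t: "?t \<in> carrier (Gbar G n)" using r ih(2) by (rule tau_Gbar)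
  have tk: "?t \<otimes>\<^bsub>Gbar G n\<^esub> eps_mat G n k \<in> carrier (Gbar G n)" by (intro mat_mult_in t eps_mat_in)
  have "A \<in> {?t, ?t \<otimes>\<^bsub>Gbar G n\<^esub> eps_mat G n k, ?t \<otimes>\<^bsub>Gbar G n\<^esub> eps_mat G n i,
     ?t \<otimes>\<^bsub>Gbar G n\<^esub> eps_mat G n k \<otimes>\<^bsub>Gbar G n\<^esub> eps_mat G n i}"
    using ih(3) unfolding u_term_expand[OF r ih(2)] basis_def by (auto split: if_splits)
  then have "A j j = Some \<one>" if "j \<in> {1..n} - {k, i}" for j
    using that unfolding eps_mult(2)[OF tk] unfolding eps_mult(2)[OF t] by (auto simp: tau_def)
  then have "{j \<in> {1..n}. A j j \<noteq> Some \<one>} \<subseteq> {k, i}" by blast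
  then have "mat_deg G n A \<le> card {k, i}" unfolding mat_deg_def by (rule card_mono[rotated]) simp
  also have "\<dots> \<le> 2" using card_insert_le_m1[of 2 "{i}" k] by simp
  finally show ?thesis .
qed

lemma u_seq_in:
  assumes k: "k \<in> {1..m}"
  shows "(u_seq G m k :: nat \<Rightarrow> 'a zmat \<Rightarrow> 'f::field) \<in> carrier (Zseq G m)"
  unfolding Zseq_iff
proof (intro conjI allI impI exI[of _ 2])
  have k1: "1 \<le> k" using k by simp
  show "u_seq G m k n \<in> carrier (Zbar G m n :: ('f, _) module)" if "m \<le> n" for n
    using that u_at_in[OF k1, of n, where 'f = 'f] u_at_commute[OF _ k that, where 'f = 'f]
    by (simp add: u_seq_def Zbar_iff)
  show "theta n (u_seq G m k n) = (u_seq G m k (n - 1) :: _ \<Rightarrow> 'f)" if n: "m < n" for n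
  proof -
    have "k \<in> {1..<n}" "m \<le> n - 1" "m \<le> n" using k n by auto
    then show ?thesis using theta_u_at[of k n, where 'f = 'f] by (simp add: u_seq_def)
  qed
  show "mat_deg G n A \<le> 2" if "m \<le> n" "u_seq G m k n A \<noteq> (0 :: 'f)" for n A
    using that u_at_deg[OF k1] by (simp add: u_seq_def)
qed (simp add: u_seq_def)

section \<open>Compatibility of the homomorphisms\<close>

text \<open>\<phi> sends each \<open>1 - \<epsilon>\<close> to 1, so every term of
  \<open>u_at\<close> loses its two idempotent factors and becomes a labelled transposition.\<close>

lemma Phi_u_at:
  fixes \<phi> :: "('a zmat \<Rightarrow> 'f::field) \<Rightarrow> 'a zmat \<Rightarrow> 'f"
  assumes phi: "\<phi> \<in> alg_hom (FGbar G n) (FGwr G n)"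
    and fix1: "\<And>A. A \<in> carrier (Gwr G n) \<Longrightarrow> \<phi> (basis A) = basis A"
    and eps: "\<And>j. j \<in> {1..n} \<Longrightarrow> \<phi> (basis (eps_mat G n j)) = (\<lambda>z. 0)"
    and fin: "finite (carrier G)" and k: "k \<in> {1..n}"
  shows "\<phi> (u_at G k n) = Tsum G n k {k+1..n}"
proof -
  let ?R = "FGbar G n :: ('f, 'a zmat \<Rightarrow> 'f) module"
  interpret R: ring "FGwr G n :: ('f, 'a zmat \<Rightarrow> 'f) module" by (rule sg_alg_ring[OF monoid_Gwr])
  note hom = alg_homD[OF phi, simplified]
  have k1: "1 \<le> k" using k by simp
  have one: "\<phi> (eps_comp n j) = \<one>\<^bsub>?R\<^esub>" if j: "j \<in> {1..n}" for j
  proof -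
    have "(\<lambda>z. (-1) * basis (eps_mat G n j) z) \<in> carrier ?R" by (rule sg_alg_smult_in) (simp add: eps_mat_in)
    then have "\<phi> (\<lambda>z. basis \<one>\<^bsub>Gbar G n\<^esub> z + (-1) * basis (eps_mat G n j) z) =
      (\<lambda>z. \<phi> (basis \<one>\<^bsub>Gbar G n\<^esub>) z + (-1) * \<phi> (basis (eps_mat G n j)) z)"
      using hom(3)[of "basis \<one>\<^bsub>Gbar G n\<^esub>" "\<lambda>z. (-1) * basis (eps_mat G n j) z"] hom(4)[of "basis (eps_mat G n j)" "-1"]
      by (simp add: sg_alg_ops eps_mat_in monoid.one_closed[OF monoid_Gbar])
    then show ?thesis using eps[OF j] fix1[OF Gwr_one_in] by (simp add: eps_comp_def sg_alg_ops)
  qed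
  have tterm: "\<phi> (u_term n k (fst p) (snd p)) = basis (tau G n k (fst p) (snd p))" and
    tin: "(u_term n k (fst p) (snd p) :: _ \<Rightarrow> 'f) \<in> carrier ?R" if p: "p \<in> {k+1..n} \<times> carrier G" for p
  proof -
    have r: "k \<in> {1..n}" "fst p \<in> {1..n}" "k \<noteq> fst p" "snd p \<in> carrier G" using p k by auto
    show "(u_term n k (fst p) (snd p) :: _ \<Rightarrow> 'f) \<in> carrier ?R" using r by (rule u_term_in)
    have tW: "tau G n k (fst p) (snd p) \<in> carrier (Gwr G n)" using r by (rule tau_in_Gwr)
    then have tR: "basis (tau G n k (fst p) (snd p)) \<in> carrier ?R" by (simp add: Gwr_Gbar)
    have "basis (tau G n k (fst p) (snd p)) \<otimes>\<^bsub>?R\<^esub> eps_comp n k \<in> carrier ?R"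
      by (intro sg_alg_mult_in monoid_Gbar tR eps_comp_in)
    then have "\<phi> (u_term n k (fst p) (snd p)) = basis (tau G n k (fst p) (snd p)) \<otimes>\<^bsub>?R\<^esub> \<one>\<^bsub>?R\<^esub> \<otimes>\<^bsub>?R\<^esub> \<one>\<^bsub>?R\<^esub>"
      unfolding u_term_def using tR r by (simp add: hom(2) eps_comp_in one fix1[OF tW])
    also have "\<dots> = basis (tau G n k (fst p) (snd p))"
      using R.r_one[of "basis (tau G n k (fst p) (snd p))"] tW by simp
    finally show "\<phi> (u_term n k (fst p) (snd p)) = basis (tau G n k (fst p) (snd p))" .
  qed
  have U: "u_at G k n = (\<lambda>z. \<Sum>p\<in>{k+1..n} \<times> carrier G. u_term n k (fst p) (snd p) z :: 'f)"
    by (simp add: u_at_eq[OF k1] sum.cartesian_product case_prod_unfold)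
  have "\<phi> (u_at G k n) = (\<lambda>z. \<Sum>p\<in>{k+1..n} \<times> carrier G. \<phi> (u_term n k (fst p) (snd p)) z)"
    unfolding U by (rule alg_hom_sum[OF phi _ tin]) (use fin in auto)
  also have "\<dots> = Tsum G n k {k+1..n}" unfolding Tsum_def by (intro ext sum.cong refl) (simp only: tterm)
  finally show ?thesis .
qed

lemma const_seq_hom:
  "const_seq G m \<in> alg_hom (FGbar G m) (Zseq G m :: ('f::field, nat \<Rightarrow> 'a zmat \<Rightarrow> 'f) module)"
proof -
  let ?R = "FGbar G m :: ('f, 'a zmat \<Rightarrow> 'f) module"
  let ?Z = "Zseq G m :: ('f, nat \<Rightarrow> 'a zmat \<Rightarrow> 'f) module"
  have "subalg ?R (carrier ?R)" by (rule sg_alg_subalg[OF monoid_Gbar])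
  note R = this[unfolded subalg_def] and E = alg_homD[OF embed_alg_hom[where 'f = 'f], unfolded sg_alg_ops]
  have "const_seq G m \<in> ring_hom ?R ?Z"
  proof (rule ring_hom_memI)
    fix a b assume a: "a \<in> carrier ?R" and b: "b \<in> carrier ?R"
    show "const_seq G m a \<in> carrier ?Z" using a by (rule const_seq_in)
    have ab: "a \<otimes>\<^bsub>?R\<^esub> b \<in> carrier ?R" "a \<oplus>\<^bsub>?R\<^esub> b \<in> carrier ?R" using R a b by blast+
    show "const_seq G m (a \<otimes>\<^bsub>?R\<^esub> b) = const_seq G m a \<otimes>\<^bsub>?Z\<^esub> const_seq G m b"
      unfolding Zseq_ops const_seq_eq[OF ab(1)] const_seq_eq[OF a] const_seq_eq[OF b]
      by (intro restrict_ext) (simp add: E(2) a b)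
    show "const_seq G m (a \<oplus>\<^bsub>?R\<^esub> b) = const_seq G m a \<oplus>\<^bsub>?Z\<^esub> const_seq G m b"
      unfolding Zseq_ops const_seq_eq[OF ab(2)] const_seq_eq[OF a] const_seq_eq[OF b]
      by (intro restrict_ext) (simp add: E(3) a b sg_alg_ops)
  next
    have one: "\<one>\<^bsub>?R\<^esub> \<in> carrier ?R" using R by blast
    show "const_seq G m \<one>\<^bsub>?R\<^esub> = \<one>\<^bsub>?Z\<^esub>"
      unfolding Zseq_ops const_seq_eq[OF one] by (intro restrict_ext) (simp add: embed_one sg_alg_ops)
  qed
  moreover have "const_seq G m (c \<odot>\<^bsub>?R\<^esub> a) = c \<odot>\<^bsub>?Z\<^esub> const_seq G m a" if a: "a \<in> carrier ?R" for c a
  proof -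
    have ca: "c \<odot>\<^bsub>?R\<^esub> a \<in> carrier ?R" using R a by blast
    show ?thesis
      unfolding Zseq_ops const_seq_eq[OF ca] const_seq_eq[OF a]
      by (intro restrict_ext) (simp add: lin_lift_smult sg_alg_ops)
  qed
  ultimately show ?thesis by (simp add: alg_hom_def)
qed

lemma Hbar_gens:
  "const_seq G m ` carrier (FGbar G m) \<union> u_seq G m ` {1..m} \<subseteq>
     (carrier (Zseq G m) :: (nat \<Rightarrow> 'a zmat \<Rightarrow> 'f::field) set)"
  using const_seq_in u_seq_in by blast

text \<open>Linearity gives this, the zero class being \<open>0\<close> times the class of 1. It
  describes what \<Psi> does to the images of the idempotents \<open>eps_mat\<close> in
  \<open>hecke\<close>.\<close>

lemma Psi_zero:
  assumes P: "\<Psi> \<in> alg_hom (hecke G m) (Zwr G m n :: ('f::field, _) module)"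
  shows "\<Psi> \<zero>\<^bsub>hecke G m :: ('f, _) module\<^esub> = (\<lambda>z. 0)"
proof -
  let ?A = "hecke_free G m :: ('f, 'a hgen list \<Rightarrow> 'f) module"
  let ?H = "hecke G m :: ('f, ('a hgen list \<Rightarrow> 'f) set) module"
  interpret A: ring ?A by (rule ring_hecke_free)
  interpret ideal "hecke_ideal G m" ?A by (rule hecke_ideal)
  note p = alg_homD[OF hecke_proj(1)[of m, where 'f = 'f]]
  have "\<zero>\<^bsub>?H\<^esub> = hecke_ideal G m" by (simp add: hecke_def quot_alg_def FactRing_def)
  also have "\<dots> = hecke_ideal G m +>\<^bsub>?A\<^esub> \<zero>\<^bsub>?A\<^esub>"
    using A.a_coset_add_zero[OF a_subset] by simp
  also have "\<zero>\<^bsub>?A\<^esub> = 0 \<odot>\<^bsub>?A\<^esub> \<one>\<^bsub>?A\<^esub>" by (simp add: hecke_free_def sg_alg_ops)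
  also have "hecke_ideal G m +>\<^bsub>?A\<^esub> (0 \<odot>\<^bsub>?A\<^esub> \<one>\<^bsub>?A\<^esub>) = 0 \<odot>\<^bsub>?H\<^esub> (hecke_ideal G m +>\<^bsub>?A\<^esub> \<one>\<^bsub>?A\<^esub>)"
    by (rule p(4)) simp
  finally have "\<Psi> \<zero>\<^bsub>?H\<^esub> = 0 \<odot>\<^bsub>Zwr G m n\<^esub> \<Psi> (hecke_ideal G m +>\<^bsub>?A\<^esub> \<one>\<^bsub>?A\<^esub>)"
    using alg_homD(4)[OF P p(1)[OF A.one_closed], of 0] by simp
  then show ?thesis by (simp add: sg_alg_ops)
qed

lemma Psi_Phibar:
  fixes \<Psi> :: "('a hgen list \<Rightarrow> 'f::field) set \<Rightarrow> 'a zmat \<Rightarrow> 'f"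
  assumes fin: "finite (carrier G)" and mn: "m \<le> n"
    and Psi: "is_Psi G m n \<Psi>" and Phibar: "is_Phibar G m \<Phi>'" and Psibar: "is_Psibar G m n \<Psi>'"
    and Phi: "is_Phi G m n \<Phi>" and \<alpha>: "\<alpha> \<in> carrier (Hbar G m)"
  shows "\<Psi> (\<Phi>' \<alpha>) = \<Phi> (\<Psi>' \<alpha>)"
proof -
  let ?Z = "Zseq G m :: ('f, nat \<Rightarrow> 'a zmat \<Rightarrow> 'f) module"
  let ?H = "Hbar G m :: ('f, nat \<Rightarrow> 'a zmat \<Rightarrow> 'f) module"
  let ?W = "FGwr G n :: ('f, 'a zmat \<Rightarrow> 'f) module"
  let ?R = "FGbar G m :: ('f, 'a zmat \<Rightarrow> 'f) module"
  let ?X = "const_seq G m ` carrier ?R \<union> u_seq G m ` {1..m}"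
  note gen = subalg_gen_alg[OF Zseq_subalg[of m, where 'f = 'f] Hbar_gens[of m, where 'f = 'f]]
  have H: "?H = ?Z\<lparr>carrier := gen_alg ?Z ?X\<rparr>" by (simp add: Hbar_def)
  obtain \<phi> where \<phi>: "\<phi> \<in> alg_hom (FGbar G n) ?W" "\<And>A. A \<in> carrier (Gwr G n) \<Longrightarrow> \<phi> (basis A) = basis A"
    "\<And>j. j \<in> {1..n} \<Longrightarrow> \<phi> (basis (eps_mat G n j)) = (\<lambda>z. 0)" and \<Phi>: "\<Phi> = restrict \<phi> (carrier (Zbar G m n))"
    using Phi unfolding is_Phi_def by (auto simp: sg_alg_ops)
  have P: "\<Psi> \<in> alg_hom (hecke G m) (Zwr G m n)" "\<And>x. x \<in> hgens G m \<Longrightarrow> \<Psi> (hecke_gen G m x) = hgen_val G m n x"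
    using Psi unfolding is_Psi_iff[OF mn] by blast+
  have P'h: "\<Psi>' \<in> alg_hom ?H (Zbar G m n)" and P'g: "\<And>g. g \<in> carrier (Gpow G m) \<Longrightarrow>
        \<Psi>' (const_seq G m (basis (tuple_mat m g))) = basis (embed_mat G m n (tuple_mat m g))"
     and P's: "\<And>l. l \<in> {1..<m} \<Longrightarrow> \<Psi>' (const_seq G m (basis (transp_mat G m l (l+1)))) = basis (transp_mat G n l (l+1))"
     and P'e: "\<And>k. k \<in> {1..m} \<Longrightarrow> \<Psi>' (const_seq G m (basis (eps_mat G m k))) = basis (eps_mat G n k)"
     and P'u: "\<And>k. k \<in> {1..m} \<Longrightarrow> \<Psi>' (u_seq G m k) = u_at G k n"
    using Psibar unfolding is_Psibar_def by blast+
  have F'h: "\<Phi>' \<in> alg_hom ?H (hecke G m)" and F'g: "\<And>g. g \<in> carrier (Gpow G m) \<Longrightarrow>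
        \<Phi>' (const_seq G m (basis (tuple_mat m g))) = hecke_gen G m (GenG g)"
     and F's: "\<And>k. k \<in> {1..<m} \<Longrightarrow> \<Phi>' (const_seq G m (basis (transp_mat G m k (k+1)))) = hecke_gen G m (GenS k)"
     and F'u: "\<And>l. l \<in> {1..m} \<Longrightarrow> \<Phi>' (u_seq G m l) = hecke_gen G m (GenX l)"
     and F'e: "\<And>l. l \<in> {1..m} \<Longrightarrow> \<Phi>' (const_seq G m (basis (eps_mat G m l))) = \<zero>\<^bsub>hecke G m :: ('f, _) module\<^esub>"
    using Phibar unfolding is_Phibar_def by blast+
  let ?F = "\<lambda>\<alpha>. \<Psi> (\<Phi>' \<alpha>)" and ?K = "\<lambda>\<alpha>. \<phi> (\<Psi>' \<alpha>)"
  \<comment> \<open>Both composites are regarded as maps into \<open>FGwr\<close>, with the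
    homomorphism \<phi> in place of its restriction \<Phi>, so that they have a common
    target.\<close>
  have toW: "f \<in> alg_hom A ?W" if "f \<in> alg_hom A (Zwr G m n)" for f and A :: "('f, 'v, 'w) module_scheme"
    using that by (auto simp: alg_hom_def ring_hom_def Zwr_iff)
  have fromZ: "\<phi> \<in> alg_hom (Zbar G m n) ?W"
    using \<phi>(1) by (auto simp: alg_hom_def ring_hom_def Zbar_iff)
  have F: "?F \<in> alg_hom ?H ?W" using toW alg_hom_comp[OF F'h P(1)] by blast
  have K: "?K \<in> alg_hom ?H ?W" using alg_hom_comp[OF P'h fromZ] .
  let ?E = "{\<alpha> \<in> gen_alg ?Z ?X. ?F \<alpha> = ?K \<alpha>}"
  have E: "subalg ?Z ?E"
    by (rule subalg_equalizer[OF gen(1)]) (use F K in \<open>simp_all only: H\<close>)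
  have cH: "const_seq G m \<in> alg_hom ?R ?H"
    using const_seq_hom[of m, where 'f = 'f] gen(2) unfolding H by (auto simp: alg_hom_def ring_hom_def)
  \<comment> \<open>On constant sequences both composites are multiplicative in the matrix, so the
    matrices of agreement are closed under products and \<open>Gbar_generate\<close>
    applies.\<close>
  let ?M = "{A \<in> carrier (Gbar G m). ?F (const_seq G m (basis A)) = ?K (const_seq G m (basis A))}"
  have Fc: "(\<lambda>a. ?F (const_seq G m a)) \<in> alg_hom ?R ?W" and Kc: "(\<lambda>a. ?K (const_seq G m a)) \<in> alg_hom ?R ?W"
    using alg_hom_comp[OF cH F] alg_hom_comp[OF cH K] by blast+
  note Fc' = alg_homD[OF Fc] and Kc' = alg_homD[OF Kc]
  have "A \<in> ?M" if A: "A \<in> carrier (Gbar G m)" for A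
  proof (rule Gbar_generate[OF _ _ _ _ _ A])
    show "\<one>\<^bsub>Gbar G m\<^esub> \<in> ?M"
      using Fc'(5) Kc'(5) monoid.one_closed[OF monoid_Gbar] by (simp add: sg_alg_ops)
    show "B \<otimes>\<^bsub>Gbar G m\<^esub> C \<in> ?M" if BC: "B \<in> ?M" "C \<in> ?M" for B C
      using Fc'(2)[of "basis B" "basis C"] Kc'(2)[of "basis B" "basis C"] BC
      by (simp add: basis_mult mat_mult_in)
    show "transp_mat G m k (k+1) \<in> ?M" if k: "k \<in> {1..<m}" for k
    proof -
      have "transp_mat G m k (k+1) \<in> carrier (Gbar G m)" "transp_mat G n k (k+1) \<in> carrier (Gwr G n)"
        using k mn by (auto intro!: Gwr_Gbar transp_mat_in)
      then show ?thesis using P(2)[of "GenS k"] k by (simp add: F's P's \<phi>(2))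
    qed
    show "tuple_mat m g \<in> ?M" if g: "g \<in> carrier (Gpow G m)" for g
      using P(2)[of "GenG g"] g embed_in_Gwr[OF tuple_mat_in[OF g] mn] tuple_mat_in[OF g]
      by (simp add: F'g P'g \<phi>(2) Gwr_Gbar)
    show "eps_mat G m k \<in> ?M" if k: "k \<in> {1..m}" for k
    proof -
      have "k \<in> {1..n}" using k mn by auto
      then show ?thesis using k Psi_zero[OF P(1)] by (simp add: F'e P'e \<phi>(3) eps_mat_in)
    qed
  qed
  moreover have "subalg ?R {a \<in> carrier ?R. ?F (const_seq G m a) = ?K (const_seq G m a)}"
    by (rule subalg_equalizer[OF sg_alg_subalg[OF monoid_Gbar]]) (use Fc Kc in simp_all)
  ultimately have c: "carrier ?R \<subseteq> {a \<in> carrier ?R. ?F (const_seq G m a) = ?K (const_seq G m a)}"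
    by (intro sg_alg_subset_subalg) auto
  have u: "?F (u_seq G m k) = ?K (u_seq G m k)" if k: "k \<in> {1..m}" for k
  proof -
    have "k \<in> {1..n}" using k mn by auto
    then show ?thesis using k P(2)[of "GenX k"] Phi_u_at[OF \<phi> fin] by (simp add: F'u P'u)
  qed
  have "?X \<subseteq> ?E" using gen(2) c u by blast
  then have "gen_alg ?Z ?X \<subseteq> ?E" by (rule gen_alg_least[OF E])
  moreover have "\<alpha> \<in> gen_alg ?Z ?X" using \<alpha> by (simp add: H)
  ultimately have "?F \<alpha> = ?K \<alpha>" by blast
  \<comment> \<open>On the carrier of \<open>Zbar\<close> the restriction \<Phi> coincides with
    \<phi>.\<close>
  moreover have "\<Psi>' \<alpha> \<in> carrier (Zbar G m n)" using alg_homD(1)[OF P'h \<alpha>] .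
  ultimately show ?thesis by (simp add: \<Phi>)
qed

end

theorem proposition5p3:
  fixes G :: "('g, 'c) monoid_scheme" and m n :: nat
  assumes "group G" and "finite (carrier G)" and "1 \<le> m" and "m \<le> n"
  shows
    "(\<exists>!\<Psi> :: ('g hgen list \<Rightarrow> 'f::field) set \<Rightarrow> 'g zmat \<Rightarrow> 'f.
        \<Psi> \<in> extensional (carrier (hecke G m :: ('f, _) module)) \<and> is_Psi G m n \<Psi>) \<and>
     (\<forall>\<Psi> :: ('g hgen list \<Rightarrow> 'f) set \<Rightarrow> 'g zmat \<Rightarrow> 'f. is_Psi G m n \<Psi> \<longrightarrow>
        (\<forall>\<Phi>' \<Psi>' \<Phi>. is_Phibar G m \<Phi>' \<and> is_Psibar G m n \<Psi>' \<and> is_Phi G m n \<Phi> \<longrightarrow>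
           (\<forall>\<alpha> \<in> carrier (Hbar G m). \<Psi> (\<Phi>' \<alpha>) = \<Phi> (\<Psi>' \<alpha>))) \<and>
        carrier (Zwr G m n) =
          gen_alg (Zwr G m n)
            (center_of (sg_alg (Gwr_tail G m n)) \<union> \<Psi> ` carrier (hecke G m)))"
proof (intro conjI allI impI ballI)
  interpret tail_conj G m n using assms by (simp add: tail_conj_def tail_conj_axioms_def)
  show "\<exists>!\<Psi> :: ('g hgen list \<Rightarrow> 'f::field) set \<Rightarrow> 'g zmat \<Rightarrow> 'f.
      \<Psi> \<in> extensional (carrier (hecke G m :: ('f, _) module)) \<and> is_Psi G m n \<Psi>"
    by (rule ex1_Psi[OF mn])
  fix \<Psi> :: "('g hgen list \<Rightarrow> 'f) set \<Rightarrow> 'g zmat \<Rightarrow> 'f"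
  assume \<Psi>: "is_Psi G m n \<Psi>"
  show "carrier (Zwr G m n) =
      gen_alg (Zwr G m n) (center_of (sg_alg (Gwr_tail G m n)) \<union> \<Psi> ` carrier (hecke G m))"
    by (rule Zwr_eq_gen_alg[OF \<Psi>])
  fix \<Phi>' :: "(nat \<Rightarrow> 'g zmat \<Rightarrow> 'f) \<Rightarrow> ('g hgen list \<Rightarrow> 'f) set"
    and \<Psi>' :: "(nat \<Rightarrow> 'g zmat \<Rightarrow> 'f) \<Rightarrow> 'g zmat \<Rightarrow> 'f"
    and \<Phi> :: "('g zmat \<Rightarrow> 'f) \<Rightarrow> 'g zmat \<Rightarrow> 'f" and \<alpha> :: "nat \<Rightarrow> 'g zmat \<Rightarrow> 'f"
  assume "is_Phibar G m \<Phi>' \<and> is_Psibar G m n \<Psi>' \<and> is_Phi G m n \<Phi>" "\<alpha> \<in> carrier (Hbar G m)"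
  then show "\<Psi> (\<Phi>' \<alpha>) = \<Phi> (\<Psi>' \<alpha>)"
    using Psi_Phibar[OF fin mn \<Psi>] by blast
qed

end
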